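(* Let $k$ be a field and let $A$ be the algebra of all linear operators in a $k$-vector space $V$ of finite dimension $n$. Then every non-zero element $\Delta\in A$ is well-tempered. If $\Delta\in A$ is a non-zero operator of corank $s$, then the homotope $B=\widehat{A}_\Delta$ is Morita equivalent to the algebra of the quiver with two vertices, $s$ arrows $\alpha_i$ in one direction and $s$ arrows $\beta_j$ in the opposite direction, with relations $\beta_j\alpha_i=0$ for all $1\le i,j\le s$.
   Context: Homotope: for a unital $k$-algebra $A$ and $\Delta\in A$, $B^+=A_\Delta$ is the algebra with underlying space $A$ and multiplication $a\cdot_\Delta b=a\Delta b$; $B=\widehat{A}_\Delta=k\cdot 1\oplus B^+$ is obtained by adjoining a unit, so $B^+$ is a two-sided ideal of $B$. Well-tempered: $\Delta\in A$ is well-tempered if the multiplication map $B^+\otimes_kB^+\to B^+$ is surjective (equivalently $A\Delta A=A$, the two-sided ideal generated by $\Delta$ being all of $A$) and $B^+$ is projective both as a left and as a right $B$-module. The corank of $\Delta$ is $n-\mathrm{rank}\,\Delta$. The algebra of a quiver with relations is the path algebra over $k$ modulo the two-sided ideal generated by the relations; the composites in the other order, $\alpha_i\beta_j$, are not set to zero. *)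

theory Defs
  imports
    "HOL-Algebra.QuotRing"
    "HOL-Algebra.Module"
    "HOL-Library.FuncSet"
    "Graph_Theory.Arc_Walk"
begin

section \<open>Algebras over a field\<close>

text \<open>
  The ground field is a type \<open>'k\<close> of class \<^class>\<open>field\<close>; algebras are records of type
  \<open>('k, 'a) module\<close>, i.e. rings with a scalar multiplication.  The library's locale for algebras
  covers commutative rings only, hence the following one.
\<close>

locale unital_algebra = ring A for A :: "('k::field, 'a) module" (structure) +
  assumes scalar_closed: "x \<in> carrier A \<Longrightarrow> c \<odot> x \<in> carrier A"
    and scalar_add_left: "x \<in> carrier A \<Longrightarrow> (c + d) \<odot> x = c \<odot> x \<oplus> d \<odot> x"
    and scalar_add_right:
      "x \<in> carrier A \<Longrightarrow> y \<in> carrier A \<Longrightarrow> c \<odot> (x \<oplus> y) = c \<odot> x \<oplus> c \<odot> y"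
    and scalar_assoc: "x \<in> carrier A \<Longrightarrow> (c * d) \<odot> x = c \<odot> (d \<odot> x)"
    and scalar_one: "x \<in> carrier A \<Longrightarrow> 1 \<odot> x = x"
    and scalar_mult_left:
      "x \<in> carrier A \<Longrightarrow> y \<in> carrier A \<Longrightarrow> (c \<odot> x) \<otimes> y = c \<odot> (x \<otimes> y)"
    and scalar_mult_right:
      "x \<in> carrier A \<Longrightarrow> y \<in> carrier A \<Longrightarrow> x \<otimes> (c \<odot> y) = c \<odot> (x \<otimes> y)"

definition operator_algebra ::
    "('k::field \<Rightarrow> 'v::ab_group_add \<Rightarrow> 'v) \<Rightarrow> ('k, 'v \<Rightarrow> 'v) module"
  where "operator_algebra scale =
    \<lparr>carrier = {f. Vector_Spaces.linear scale scale f}, mult = (\<circ>), one = id,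
     zero = (\<lambda>v. 0), add = (\<lambda>f g v. f v + g v), smult = (\<lambda>c f v. scale c (f v))\<rparr>"

definition corank ::
    "('k::field \<Rightarrow> 'v::ab_group_add \<Rightarrow> 'v) \<Rightarrow> ('v \<Rightarrow> 'v) \<Rightarrow> nat"
  where "corank scale f = vector_space.dim scale UNIV - vector_space.dim scale (range f)"


section \<open>Homotopes\<close>

text \<open>\<open>A\<^sub>\<Delta>\<close> is in general not unital; its field \<open>one\<close>, inherited from \<open>A\<close>, has no meaning.\<close>

definition nonunital_homotope :: "('k::field, 'a) module \<Rightarrow> 'a \<Rightarrow> ('k, 'a) module"
  where "nonunital_homotope A \<Delta> = A\<lparr>mult := \<lambda>a b. a \<otimes>\<^bsub>A\<^esub> \<Delta> \<otimes>\<^bsub>A\<^esub> b\<rparr>"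

text \<open>The pair \<open>(c, a)\<close> stands for \<open>c \<cdot> 1 + a\<close>.\<close>

definition adjoin_unit :: "('k::field, 'a) module \<Rightarrow> ('k, 'k \<times> 'a) module"
  where "adjoin_unit P =
    \<lparr>carrier = UNIV \<times> carrier P,
     mult = (\<lambda>(c, a) (d, b). (c * d, c \<odot>\<^bsub>P\<^esub> b \<oplus>\<^bsub>P\<^esub> d \<odot>\<^bsub>P\<^esub> a \<oplus>\<^bsub>P\<^esub> a \<otimes>\<^bsub>P\<^esub> b)),
     one = (1, \<zero>\<^bsub>P\<^esub>),
     zero = (0, \<zero>\<^bsub>P\<^esub>),
     add = (\<lambda>(c, a) (d, b). (c + d, a \<oplus>\<^bsub>P\<^esub> b)),
     smult = (\<lambda>r (c, a). (r * c, r \<odot>\<^bsub>P\<^esub> a))\<rparr>"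

definition homotope :: "('k::field, 'a) module \<Rightarrow> 'a \<Rightarrow> ('k, 'k \<times> 'a) module"
  where "homotope A \<Delta> = adjoin_unit (nonunital_homotope A \<Delta>)"

definition homotope_ideal :: "('k::field, 'a) module \<Rightarrow> 'a \<Rightarrow> ('k \<times> 'a) set"
  where "homotope_ideal A \<Delta> = {0} \<times> carrier (nonunital_homotope A \<Delta>)"


section \<open>Modules over not necessarily commutative rings\<close>

text \<open>
  As in the library's commutative notion, the ring multiplication and the unit of the record
  \<open>M\<close> are irrelevant here.  Right modules are left modules over the opposite ring.
\<close>

locale left_module = R?: ring R + M?: abelian_group M
  for R (structure) and M :: "('r, 'm) module" (structure) +
  assumes act_closed: "a \<in> carrier R \<Longrightarrow> x \<in> carrier M \<Longrightarrow> a \<odot>\<^bsub>M\<^esub> x \<in> carrier M"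
    and act_add_left: "a \<in> carrier R \<Longrightarrow> b \<in> carrier R \<Longrightarrow> x \<in> carrier M \<Longrightarrow>
      (a \<oplus>\<^bsub>R\<^esub> b) \<odot>\<^bsub>M\<^esub> x = a \<odot>\<^bsub>M\<^esub> x \<oplus>\<^bsub>M\<^esub> b \<odot>\<^bsub>M\<^esub> x"
    and act_add_right: "a \<in> carrier R \<Longrightarrow> x \<in> carrier M \<Longrightarrow> y \<in> carrier M \<Longrightarrow>
      a \<odot>\<^bsub>M\<^esub> (x \<oplus>\<^bsub>M\<^esub> y) = a \<odot>\<^bsub>M\<^esub> x \<oplus>\<^bsub>M\<^esub> a \<odot>\<^bsub>M\<^esub> y"
    and act_assoc: "a \<in> carrier R \<Longrightarrow> b \<in> carrier R \<Longrightarrow> x \<in> carrier M \<Longrightarrow>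
      (a \<otimes>\<^bsub>R\<^esub> b) \<odot>\<^bsub>M\<^esub> x = a \<odot>\<^bsub>M\<^esub> (b \<odot>\<^bsub>M\<^esub> x)"
    and act_one: "x \<in> carrier M \<Longrightarrow> \<one>\<^bsub>R\<^esub> \<odot>\<^bsub>M\<^esub> x = x"

definition opposite :: "('a, 'b) ring_scheme \<Rightarrow> ('a, 'b) ring_scheme"
  where "opposite R = R\<lparr>mult := \<lambda>x y. y \<otimes>\<^bsub>R\<^esub> x\<rparr>"

definition ideal_module :: "('a, 'b) ring_scheme \<Rightarrow> 'a set \<Rightarrow> ('a, 'a) module"
  where "ideal_module R I =
    \<lparr>carrier = I, mult = mult R, one = \<one>\<^bsub>R\<^esub>, zero = \<zero>\<^bsub>R\<^esub>, add = add R, smult = mult R\<rparr>"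

definition lmod_hom ::
    "('r, 'b) ring_scheme \<Rightarrow> ('r, 'm) module \<Rightarrow> ('r, 'n) module \<Rightarrow> ('m \<Rightarrow> 'n) set"
  where "lmod_hom R M N = {f \<in> carrier M \<rightarrow>\<^sub>E carrier N.
    (\<forall>x\<in>carrier M. \<forall>y\<in>carrier M. f (x \<oplus>\<^bsub>M\<^esub> y) = f x \<oplus>\<^bsub>N\<^esub> f y) \<and>
    (\<forall>a\<in>carrier R. \<forall>x\<in>carrier M. f (a \<odot>\<^bsub>M\<^esub> x) = a \<odot>\<^bsub>N\<^esub> f x)}"

definition free_module :: "('r, 'b) ring_scheme \<Rightarrow> 'i set \<Rightarrow> ('r, 'i \<Rightarrow> 'r) module"
  where "free_module R I =
    \<lparr>carrier = {f. (\<forall>i. f i \<in> carrier R) \<and> (\<forall>i. i \<notin> I \<longrightarrow> f i = \<zero>\<^bsub>R\<^esub>) \<and>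
       finite {i. f i \<noteq> \<zero>\<^bsub>R\<^esub>}},
     mult = undefined, one = undefined,
     zero = (\<lambda>i. \<zero>\<^bsub>R\<^esub>), add = (\<lambda>f g i. f i \<oplus>\<^bsub>R\<^esub> g i), smult = (\<lambda>a f i. a \<otimes>\<^bsub>R\<^esub> f i)\<rparr>"

text \<open>
  Projective modules are the direct summands of free modules.  Bases indexed by subsets of the
  element type of \<open>P\<close> suffice, since \<open>P\<close> is a quotient of the free module on the set
  \<open>carrier P\<close>.
\<close>

definition projective_module :: "('r, 'b) ring_scheme \<Rightarrow> ('r, 'm) module \<Rightarrow> bool"
  where "projective_module R P \<longleftrightarrow> left_module R P \<and>
    (\<exists>I :: 'm set. \<exists>\<iota> \<in> lmod_hom R P (free_module R I). \<exists>\<pi> \<in> lmod_hom R (free_module R I) P.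
      \<forall>x\<in>carrier P. \<pi> (\<iota> x) = x)"


section \<open>Well-tempered elements\<close>

text \<open>
  The elements of a tensor product are the finite sums of elementary tensors, so the image of the
  multiplication map \<open>P \<otimes> P \<rightarrow> P\<close> consists of the finite sums of products.
\<close>

definition multiplication_surjective :: "('k::field, 'a) module \<Rightarrow> bool"
  where "multiplication_surjective P \<longleftrightarrow> (\<forall>c\<in>carrier P. \<exists>(m::nat) x y.
    (\<forall>i<m. x i \<in> carrier P \<and> y i \<in> carrier P) \<and> c = (\<Oplus>\<^bsub>P\<^esub>i\<in>{..<m}. x i \<otimes>\<^bsub>P\<^esub> y i))"

definition well_tempered :: "('k::field, 'a) module \<Rightarrow> 'a \<Rightarrow> bool"
  where "well_tempered A \<Delta> \<longleftrightarrow>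
    multiplication_surjective (nonunital_homotope A \<Delta>) \<and>
    projective_module (homotope A \<Delta>)
      (ideal_module (homotope A \<Delta>) (homotope_ideal A \<Delta>)) \<and>
    projective_module (opposite (homotope A \<Delta>))
      (ideal_module (opposite (homotope A \<Delta>)) (homotope_ideal A \<Delta>))"


section \<open>Morita equivalence\<close>

text \<open>
  Linear categories over the field \<open>'k\<close>: \<open>Hom C X Y\<close> is a vector space, and
  \<open>Comp C X Y Z g f\<close> is the composite of \<open>f : X \<rightarrow> Y\<close> and \<open>g : Y \<rightarrow> Z\<close>.
\<close>

record ('k, 'o, 'm) linear_category =
  Obj :: "'o set"
  Hom :: "'o \<Rightarrow> 'o \<Rightarrow> ('k, 'm) module"
  Comp :: "'o \<Rightarrow> 'o \<Rightarrow> 'o \<Rightarrow> 'm \<Rightarrow> 'm \<Rightarrow> 'm"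
  Ident :: "'o \<Rightarrow> 'm"

locale linear_functor =
  fixes C :: "('k::field, 'o, 'm) linear_category" and D :: "('k, 'p, 'n) linear_category"
    and Fo :: "'o \<Rightarrow> 'p" and Fm :: "'o \<Rightarrow> 'o \<Rightarrow> 'm \<Rightarrow> 'n"
  assumes map_obj: "X \<in> Obj C \<Longrightarrow> Fo X \<in> Obj D"
    and map_hom: "\<lbrakk>X \<in> Obj C; Y \<in> Obj C; f \<in> carrier (Hom C X Y)\<rbrakk> \<Longrightarrow>
      Fm X Y f \<in> carrier (Hom D (Fo X) (Fo Y))"
    and map_ident: "X \<in> Obj C \<Longrightarrow> Fm X X (Ident C X) = Ident D (Fo X)"
    and map_comp: "\<lbrakk>X \<in> Obj C; Y \<in> Obj C; Z \<in> Obj C;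
        f \<in> carrier (Hom C X Y); g \<in> carrier (Hom C Y Z)\<rbrakk> \<Longrightarrow>
      Fm X Z (Comp C X Y Z g f) = Comp D (Fo X) (Fo Y) (Fo Z) (Fm Y Z g) (Fm X Y f)"
    and map_add: "\<lbrakk>X \<in> Obj C; Y \<in> Obj C; f \<in> carrier (Hom C X Y); g \<in> carrier (Hom C X Y)\<rbrakk> \<Longrightarrow>
      Fm X Y (f \<oplus>\<^bsub>Hom C X Y\<^esub> g) = Fm X Y f \<oplus>\<^bsub>Hom D (Fo X) (Fo Y)\<^esub> Fm X Y g"
    and map_smult: "\<lbrakk>X \<in> Obj C; Y \<in> Obj C; f \<in> carrier (Hom C X Y)\<rbrakk> \<Longrightarrow>
      Fm X Y (c \<odot>\<^bsub>Hom C X Y\<^esub> f) = c \<odot>\<^bsub>Hom D (Fo X) (Fo Y)\<^esub> Fm X Y f"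

definition isomorphism ::
    "('k, 'o, 'm) linear_category \<Rightarrow> 'o \<Rightarrow> 'o \<Rightarrow> 'm \<Rightarrow> bool"
  where "isomorphism C X Y f \<longleftrightarrow> f \<in> carrier (Hom C X Y) \<and>
    (\<exists>g \<in> carrier (Hom C Y X). Comp C X Y X g f = Ident C X \<and> Comp C Y X Y f g = Ident C Y)"

locale natural_isomorphism =
  fixes C :: "('k, 'o, 'm) linear_category" and D :: "('k, 'p, 'n) linear_category"
    and Fo :: "'o \<Rightarrow> 'p" and Fm :: "'o \<Rightarrow> 'o \<Rightarrow> 'm \<Rightarrow> 'n"
    and Go :: "'o \<Rightarrow> 'p" and Gm :: "'o \<Rightarrow> 'o \<Rightarrow> 'm \<Rightarrow> 'n"
    and \<eta> :: "'o \<Rightarrow> 'n"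
  assumes component: "X \<in> Obj C \<Longrightarrow> isomorphism D (Fo X) (Go X) (\<eta> X)"
    and natural: "\<lbrakk>X \<in> Obj C; Y \<in> Obj C; f \<in> carrier (Hom C X Y)\<rbrakk> \<Longrightarrow>
      Comp D (Fo X) (Fo Y) (Go Y) (\<eta> Y) (Fm X Y f) =
      Comp D (Fo X) (Go X) (Go Y) (Gm X Y f) (\<eta> X)"

definition linearly_equivalent ::
    "('k::field, 'o, 'm) linear_category \<Rightarrow> ('k, 'p, 'n) linear_category \<Rightarrow> bool"
  where "linearly_equivalent C D \<longleftrightarrow> (\<exists>Fo Fm Go Gm \<eta> \<epsilon>.
    linear_functor C D Fo Fm \<and> linear_functor D C Go Gm \<and>
    natural_isomorphism C C (\<lambda>X. X) (\<lambda>X Y f. f)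
      (\<lambda>X. Go (Fo X)) (\<lambda>X Y f. Gm (Fo X) (Fo Y) (Fm X Y f)) \<eta> \<and>
    natural_isomorphism D D (\<lambda>X. Fo (Go X)) (\<lambda>X Y f. Fm (Go X) (Go Y) (Gm X Y f))
      (\<lambda>X. X) (\<lambda>X Y f. f) \<epsilon>)"

text \<open>A scalar \<open>c\<close> acts on an \<open>A\<close>-module through the element \<open>c \<cdot> 1\<close> of \<open>A\<close>.\<close>

definition hom_space ::
    "('k::field, 'a) module \<Rightarrow> ('a, 'u) module \<Rightarrow> ('a, 'w) module \<Rightarrow> ('k, 'u \<Rightarrow> 'w) module"
  where "hom_space A M N =
    \<lparr>carrier = lmod_hom A M N, mult = undefined, one = undefined,
     zero = (\<lambda>x\<in>carrier M. \<zero>\<^bsub>N\<^esub>),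
     add = (\<lambda>f g. \<lambda>x\<in>carrier M. f x \<oplus>\<^bsub>N\<^esub> g x),
     smult = (\<lambda>c f. \<lambda>x\<in>carrier M. (c \<odot>\<^bsub>A\<^esub> \<one>\<^bsub>A\<^esub>) \<odot>\<^bsub>N\<^esub> f x)\<rparr>"

text \<open>
  The type \<open>'u\<close> is the universe of discourse: the objects are all left \<open>A\<close>-modules whose underlying
  set consists of elements of \<open>'u\<close>.
\<close>

definition module_category ::
    "'u itself \<Rightarrow> ('k::field, 'a) module \<Rightarrow> ('k, ('a, 'u) module, 'u \<Rightarrow> 'u) linear_category"
  where "module_category U A =
    \<lparr>Obj = {M. left_module A M}, Hom = hom_space A,
     Comp = (\<lambda>L M N g f. compose (carrier L) g f),
     Ident = (\<lambda>M. \<lambda>x\<in>carrier M. x)\<rparr>"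

text \<open>
  Morita equivalence: the module categories in the universe \<open>'u\<close> are equivalent as linear categories.
  This is the usual notion once \<open>'u\<close> is infinite and at least as large as \<open>A\<close> and \<open>B\<close>; for smaller
  types it says little, as there are few modules.  A statement for all infinite types \<open>'u\<close> covers
  modules of every size.
\<close>

definition morita_equivalent ::
    "'u itself \<Rightarrow> ('k::field, 'a) module \<Rightarrow> ('k, 'b) module \<Rightarrow> bool"
  where "morita_equivalent U A B \<longleftrightarrow>
    linearly_equivalent (module_category U A) (module_category U B)"


section \<open>Quivers with relations\<close>

text \<open>
  A quiver is a directed multigraph.  A path is a pair of its starting vertex and the list of its
  arrows in the order in which they are traversed; paths of length zero are the vertices.
\<close>

definition quiver_paths :: "('q, 'e) pre_digraph \<Rightarrow> ('q \<times> 'e list) set"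
  where "quiver_paths Q = {(u, p). \<exists>v. pre_digraph.awalk Q u p v}"

text \<open>
  Products of paths are written like composites of maps: \<open>f \<otimes> g\<close> traverses \<open>g\<close> first.
\<close>

definition path_algebra :: "('q, 'e) pre_digraph \<Rightarrow> ('k::field, 'q \<times> 'e list \<Rightarrow> 'k) module"
  where "path_algebra Q =
    \<lparr>carrier = {f. finite {x. f x \<noteq> 0} \<and> {x. f x \<noteq> 0} \<subseteq> quiver_paths Q},
     mult = (\<lambda>f g (u, p). \<Sum>(q, r) | q @ r = p. f (pre_digraph.awlast Q u q, r) * g (u, q)),
     one = (\<lambda>(u, p). if u \<in> verts Q \<and> p = [] then 1 else 0),
     zero = (\<lambda>x. 0), add = (\<lambda>f g x. f x + g x), smult = (\<lambda>c f x. c * f x)\<rparr>"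

definition arrow_element :: "('q, 'e) pre_digraph \<Rightarrow> 'e \<Rightarrow> 'q \<times> 'e list \<Rightarrow> 'k::field"
  where "arrow_element Q e = (\<lambda>x. if x = (tail Q e, [e]) then 1 else 0)"

definition quotient_algebra :: "('k::field, 'a) module \<Rightarrow> 'a set \<Rightarrow> ('k, 'a set) module"
  where "quotient_algebra A I =
    \<lparr>carrier = carrier (A Quot I), mult = mult (A Quot I), one = one (A Quot I),
     zero = zero (A Quot I), add = add (A Quot I),
     smult = (\<lambda>c X. \<Union>x\<in>X. I +>\<^bsub>A\<^esub> (c \<odot>\<^bsub>A\<^esub> x))\<rparr>"

definition quiver_algebra ::
    "('q, 'e) pre_digraph \<Rightarrow> ('q \<times> 'e list \<Rightarrow> 'k::field) set \<Rightarrow>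
      ('k, ('q \<times> 'e list \<Rightarrow> 'k) set) module"
  where "quiver_algebra Q rels = quotient_algebra (path_algebra Q) (Idl\<^bsub>path_algebra Q\<^esub> rels)"

datatype vertex = V1 | V2
datatype arrow = Alpha nat | Beta nat

definition alpha_beta_quiver :: "nat \<Rightarrow> (vertex, arrow) pre_digraph"
  where "alpha_beta_quiver s =
    \<lparr>verts = {V1, V2}, arcs = Alpha ` {1..s} \<union> Beta ` {1..s},
     tail = (\<lambda>e. case e of Alpha i \<Rightarrow> V1 | Beta j \<Rightarrow> V2),
     head = (\<lambda>e. case e of Alpha i \<Rightarrow> V2 | Beta j \<Rightarrow> V1)\<rparr>"

definition beta_alpha_relations :: "nat \<Rightarrow> (vertex \<times> arrow list \<Rightarrow> 'k::field) set"
  where "beta_alpha_relations s =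
    {arrow_element (alpha_beta_quiver s) (Beta j) \<otimes>\<^bsub>path_algebra (alpha_beta_quiver s)\<^esub>
     arrow_element (alpha_beta_quiver s) (Alpha i) | i j. i \<in> {1..s} \<and> j \<in> {1..s}}"

section \<open>The constructions yield algebras\<close>

lemma unital_algebra_operator_algebra:
  assumes "vector_space scale"
  shows "unital_algebra (operator_algebra scale)"
proof -
  interpret vector_space scale by fact
  interpret vector_space_pair scale scale ..
  have lin: "Vector_Spaces.linear scale scale f \<longleftrightarrow>
      (\<forall>x y. f (x + y) = f x + f y) \<and> (\<forall>c x. f (scale c x) = scale c (f x))" for f
    using assms by (simp add: Vector_Spaces.linear_iff)
  have grp: "abelian_group (operator_algebra scale)"
  proof (rule abelian_groupI)
    fix f assume "f \<in> carrier (operator_algebra scale)"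
    then show "\<exists>g\<in>carrier (operator_algebra scale).
        g \<oplus>\<^bsub>operator_algebra scale\<^esub> f = \<zero>\<^bsub>operator_algebra scale\<^esub>"
      by (intro bexI[of _ "\<lambda>v. - f v"]) (simp_all add: operator_algebra_def lin fun_eq_iff)
  qed (simp_all add: operator_algebra_def lin fun_eq_iff scale_right_distrib add_ac)
  have mon: "Group.monoid (operator_algebra scale)"
    by (rule monoidI) (simp_all add: operator_algebra_def lin fun_eq_iff)
  have "ring (operator_algebra scale)"
    by (rule ringI[OF grp mon]) (simp_all add: operator_algebra_def lin fun_eq_iff)
  then show ?thesis
    by (intro unital_algebra.intro unital_algebra_axioms.intro)
      (simp_all add: operator_algebra_def lin fun_eq_iff scale_right_distrib scale_left_distrib mult.commute)
qed

lemma unital_algebra_homotope: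
  assumes A: "unital_algebra A" and D: "\<Delta> \<in> carrier A"
  shows "unital_algebra (homotope A \<Delta>)"
    and "ideal (homotope_ideal A \<Delta>) (homotope A \<Delta>)"
proof -
  interpret unital_algebra A by fact
  note simps = homotope_def adjoin_unit_def nonunital_homotope_def
  have z0: "c \<odot>\<^bsub>A\<^esub> \<zero>\<^bsub>A\<^esub> = \<zero>\<^bsub>A\<^esub>" for c
    using scalar_add_right[of "\<zero>\<^bsub>A\<^esub>" "\<zero>\<^bsub>A\<^esub>" c] scalar_closed[of "\<zero>\<^bsub>A\<^esub>" c]
    by (metis add.one_closed add.r_cancel_one' l_zero)
  have 0: "0 \<odot>\<^bsub>A\<^esub> x = \<zero>\<^bsub>A\<^esub>" if "x \<in> carrier A" for x
    using scalar_add_left[of x 0 0] scalar_closed[of x 0] that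
    by (metis add.r_cancel_one' add_0)
  note sc = scalar_closed scalar_add_left scalar_add_right scalar_one
    scalar_mult_left scalar_mult_right z0 0
  have grp: "abelian_group (homotope A \<Delta>)"
  proof (rule abelian_groupI)
    fix x assume "x \<in> carrier (homotope A \<Delta>)"
    then show "\<exists>y\<in>carrier (homotope A \<Delta>). y \<oplus>\<^bsub>homotope A \<Delta>\<^esub> x = \<zero>\<^bsub>homotope A \<Delta>\<^esub>"
      by (intro bexI[of _ "(- fst x, \<ominus>\<^bsub>A\<^esub> snd x)"]) (auto simp: simps l_neg)
  qed (auto simp: simps a_ac)
  have mon: "Group.monoid (homotope A \<Delta>)"
    by (rule monoidI) (auto simp: simps D sc l_distr r_distr m_assoc a_ac mult.assoc mult.commute
      scalar_assoc[symmetric] mult.left_commute)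
  have rng: "ring (homotope A \<Delta>)"
    by (rule ringI[OF grp mon]) (auto simp: simps D sc l_distr r_distr a_ac distrib_left distrib_right)
  then show "unital_algebra (homotope A \<Delta>)"
    by (intro unital_algebra.intro unital_algebra_axioms.intro)
      (auto simp: simps D sc a_ac distrib_left distrib_right scalar_assoc[symmetric]
        mult.assoc mult.commute mult.left_commute)
  show "ideal (homotope_ideal A \<Delta>) (homotope A \<Delta>)"
  proof (rule idealI[OF rng])
    have inv: "inv\<^bsub>add_monoid (homotope A \<Delta>)\<^esub> (0, a) = (0, \<ominus>\<^bsub>A\<^esub> a)" if "a \<in> carrier A" for a
      using abelian_group.minus_equality[OF grp, of "(0, \<ominus>\<^bsub>A\<^esub> a)" "(0, a)"] that
      by (simp add: simps l_neg a_inv_def)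
    show "subgroup (homotope_ideal A \<Delta>) (add_monoid (homotope A \<Delta>))"
      by (rule group.subgroupI[OF abelian_group.a_group[OF grp]])
        (auto simp: inv homotope_ideal_def nonunital_homotope_def, auto simp: simps)
  qed (auto simp: homotope_ideal_def simps D sc)
qed

lemma awlast_append:
  "pre_digraph.awlast Q u (p @ q) = pre_digraph.awlast Q (pre_digraph.awlast Q u p) q"
proof (induction p arbitrary: u)
  case (Cons e p)
  have ne: "pre_digraph.awalk_verts Q v r \<noteq> []" for v r
    by (cases r) (auto simp: pre_digraph.awalk_verts.simps)
  show ?case using Cons by (simp add: pre_digraph.awalk_verts.simps ne)
qed (simp add: pre_digraph.awalk_verts.simps)

lemma path_append:
  assumes "wf_digraph Q"
  shows "(u, p) \<in> quiver_paths Q \<Longrightarrow> (pre_digraph.awlast Q u p, q) \<in> quiver_paths Q \<Longrightarrow>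
    (u, p @ q) \<in> quiver_paths Q"
proof -
  interpret wf_digraph Q by fact
  assume "(u, p) \<in> quiver_paths Q" "(awlast u p, q) \<in> quiver_paths Q"
  then show ?thesis unfolding quiver_paths_def by (auto intro: awalk_appendI)
qed

lemma finite_splits: "finite {(q, r). q @ r = p}"
proof -
  have "{(q, r). q @ r = p} \<subseteq> (\<lambda>i. (take i p, drop i p)) ` {..length p}"
  proof clarify
    fix q r assume "p = q @ r"
    then show "(q, r) \<in> (\<lambda>i. (take i (q @ r), drop i (q @ r))) ` {..length (q @ r)}"
      by (intro image_eqI[of _ _ "length q"]) auto
  qed
  then show ?thesis by (rule finite_subset) simp
qed

lemma unital_algebra_path_algebra:
  fixes Q :: "('q, 'e) pre_digraph"
  assumes Q: "wf_digraph Q" and fin: "finite (verts Q)"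
  shows "unital_algebra (path_algebra Q :: ('k::field, _) module)"
proof -
  interpret wf_digraph Q by fact
  let ?P = "path_algebra Q :: ('k, _) module"
  have carr: "f \<in> carrier ?P \<longleftrightarrow> finite {x. f x \<noteq> 0} \<and> {x. f x \<noteq> 0} \<subseteq> quiver_paths Q" for f
    by (simp add: path_algebra_def)
  have mulv: "(f \<otimes>\<^bsub>?P\<^esub> g) (u, p) = (\<Sum>(q, r) | q @ r = p. f (awlast u q, r) * g (u, q))" for f g u p
    by (simp add: path_algebra_def)
  have addv: "f \<oplus>\<^bsub>?P\<^esub> g = (\<lambda>x. f x + g x)" for f g by (simp add: path_algebra_def)
  have smv: "c \<odot>\<^bsub>?P\<^esub> g = (\<lambda>x. c * g x)" for c g by (simp add: path_algebra_def)
  have zerov: "\<zero>\<^bsub>?P\<^esub> = (\<lambda>x. 0)" by (simp add: path_algebra_def)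
  have onev: "\<one>\<^bsub>?P\<^esub> (u,p) = (if u \<in> verts Q \<and> p = [] then 1 else 0)" for u p
    by (simp add: path_algebra_def)
  have addc: "f \<oplus>\<^bsub>?P\<^esub> g \<in> carrier ?P" if "f \<in> carrier ?P" "g \<in> carrier ?P" for f g
  proof -
    have "{x. f x + g x \<noteq> 0} \<subseteq> {x. f x \<noteq> 0} \<union> {x. g x \<noteq> 0}" by auto
    with that show ?thesis unfolding carr addv by (meson finite_UnI finite_subset le_sup_iff subset_trans)
  qed
  have smc: "c \<odot>\<^bsub>?P\<^esub> g \<in> carrier ?P" if "g \<in> carrier ?P" for c g
  proof -
    have "{x. c * g x \<noteq> 0} \<subseteq> {x. g x \<noteq> 0}" by auto
    with that show ?thesis unfolding carr smv by (meson finite_subset subset_trans)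
  qed
  have mulc: "f \<otimes>\<^bsub>?P\<^esub> g \<in> carrier ?P" if f: "f \<in> carrier ?P" and g: "g \<in> carrier ?P" for f g
  proof -
    have ex: "\<exists>q r. q @ r = p \<and> f (awlast u q, r) \<noteq> 0 \<and> g (u, q) \<noteq> 0"
      if "(f \<otimes>\<^bsub>?P\<^esub> g) (u, p) \<noteq> 0" for u p
    proof (rule ccontr)
      assume "\<not> ?thesis"
      then have "(f \<otimes>\<^bsub>?P\<^esub> g) (u, p) = 0"
        unfolding mulv by (intro sum.neutral) auto
      with that show False by simp
    qed
    have "{x. (f \<otimes>\<^bsub>?P\<^esub> g) x \<noteq> 0} \<subseteq>
        (\<lambda>((w, r), (u, q)). (u, q @ r)) ` ({x. f x \<noteq> 0} \<times> {x. g x \<noteq> 0})"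
    proof
      fix x assume "x \<in> {x. (f \<otimes>\<^bsub>?P\<^esub> g) x \<noteq> 0}"
      moreover obtain u p where x: "x = (u, p)" by (cases x)
      ultimately have "(f \<otimes>\<^bsub>?P\<^esub> g) (u, p) \<noteq> 0" by simp
      then obtain q r where "q @ r = p" "f (awlast u q, r) \<noteq> 0" "g (u, q) \<noteq> 0"
        using ex[of u p] by blast
      then show "x \<in> (\<lambda>((w, r), (u, q)). (u, q @ r)) ` ({x. f x \<noteq> 0} \<times> {x. g x \<noteq> 0})"
        unfolding x by (intro image_eqI[of _ _ "((awlast u q, r), (u, q))"]) auto
    qed
    then have 1: "finite {x. (f \<otimes>\<^bsub>?P\<^esub> g) x \<noteq> 0}"
      by (rule finite_subset) (use f g in \<open>simp add: carr\<close>)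
    have 2: "{x. (f \<otimes>\<^bsub>?P\<^esub> g) x \<noteq> 0} \<subseteq> quiver_paths Q"
    proof
      fix x assume "x \<in> {x. (f \<otimes>\<^bsub>?P\<^esub> g) x \<noteq> 0}"
      moreover obtain u p where x: "x = (u, p)" by (cases x)
      ultimately have "(f \<otimes>\<^bsub>?P\<^esub> g) (u, p) \<noteq> 0" by simp
      then obtain q r where qr: "q @ r = p" "f (awlast u q, r) \<noteq> 0" "g (u, q) \<noteq> 0"
        using ex[of u p] by blast
      then have "(u, q) \<in> quiver_paths Q" "(awlast u q, r) \<in> quiver_paths Q"
        using f g by (auto simp: carr)
      then show "x \<in> quiver_paths Q" using path_append[OF Q] qr(1) x by auto
    qed
    from 1 2 show ?thesis by (simp add: carr)
  qed
  have onec: "\<one>\<^bsub>?P\<^esub> \<in> carrier ?P"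
  proof -
    have "{x. \<one>\<^bsub>?P\<^esub> x \<noteq> 0} = (\<lambda>u. (u, [])) ` verts Q"
      by (auto simp: path_algebra_def split: if_splits)
    then show ?thesis unfolding carr
      using fin by (auto simp: quiver_paths_def awalk_def cas.simps)
  qed
  have grp: "abelian_group ?P"
  proof (rule abelian_groupI)
    fix f assume "f \<in> carrier ?P"
    then show "\<exists>g\<in>carrier ?P. g \<oplus>\<^bsub>?P\<^esub> f = \<zero>\<^bsub>?P\<^esub>"
      by (intro bexI[of _ "\<lambda>x. - f x"]) (simp_all add: carr addv zerov)
  next
    show "\<zero>\<^bsub>?P\<^esub> \<in> carrier ?P" by (simp add: carr zerov)
  qed (use addc in \<open>simp_all add: addv zerov fun_eq_iff add_ac\<close>)
  have assoc: "(f \<otimes>\<^bsub>?P\<^esub> g) \<otimes>\<^bsub>?P\<^esub> h = f \<otimes>\<^bsub>?P\<^esub> (g \<otimes>\<^bsub>?P\<^esub> h)" for f g h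
  proof
    fix x :: "'q \<times> 'e list" obtain u p where x: "x = (u, p)" by (cases x)
    let ?S = "\<lambda>p :: 'e list. {(q, r). q @ r = p}"
    let ?F = "\<lambda>a c d. f (awlast u (a @ c), d) * g (awlast u a, c) * h (u, a)"
    have "((f \<otimes>\<^bsub>?P\<^esub> g) \<otimes>\<^bsub>?P\<^esub> h) (u, p) = (\<Sum>(a, b)\<in>?S p. \<Sum>(c, d)\<in>?S b. ?F a c d)"
      unfolding mulv by (auto simp: sum_distrib_right awlast_append intro!: sum.cong)
    also have "\<dots> = (\<Sum>((a, b), (c, d)) \<in> Sigma (?S p) (\<lambda>(a, b). ?S b). ?F a c d)"
      by (subst sum.Sigma[symmetric]) (auto simp: finite_splits intro!: sum.cong)
    also have "\<dots> = (\<Sum>((e, d), (a, c)) \<in> Sigma (?S p) (\<lambda>(e, d). ?S e). ?F a c d)"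
      by (rule sum.reindex_bij_witness[of _ "\<lambda>((e, d), (a, c)). ((a, c @ d), (c, d))"
          "\<lambda>((a, b), (c, d)). ((a @ c, d), (a, c))"]) auto
    also have "\<dots> = (\<Sum>(e, d)\<in>?S p. \<Sum>(a, c)\<in>?S e. ?F a c d)"
      by (subst sum.Sigma[symmetric]) (auto simp: finite_splits intro!: sum.cong)
    also have "\<dots> = (f \<otimes>\<^bsub>?P\<^esub> (g \<otimes>\<^bsub>?P\<^esub> h)) (u, p)"
      unfolding mulv by (auto simp: sum_distrib_left mult.assoc intro!: sum.cong)
    finally show "((f \<otimes>\<^bsub>?P\<^esub> g) \<otimes>\<^bsub>?P\<^esub> h) x = (f \<otimes>\<^bsub>?P\<^esub> (g \<otimes>\<^bsub>?P\<^esub> h)) x" unfolding x .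
  qed
  have ends: "u \<in> verts Q \<and> awlast u p \<in> verts Q" if "f \<in> carrier ?P" "f (u, p) \<noteq> 0" for f u p
  proof -
    have "(u, p) \<in> quiver_paths Q" using that by (auto simp: carr)
    then obtain v where "awalk u p v" by (auto simp: quiver_paths_def)
    then show ?thesis by auto
  qed
  have onel: "\<one>\<^bsub>?P\<^esub> \<otimes>\<^bsub>?P\<^esub> f = f" if f: "f \<in> carrier ?P" for f
  proof
    fix x :: "'q \<times> 'e list" obtain u p where x: "x = (u, p)" by (cases x)
    have "(\<one>\<^bsub>?P\<^esub> \<otimes>\<^bsub>?P\<^esub> f) (u, p) = (\<Sum>(q, r)\<in>{(p, [])}. \<one>\<^bsub>?P\<^esub> (awlast u q, r) * f (u, q))"
      unfolding mulv by (rule sum.mono_neutral_right) (auto simp: finite_splits onev split: if_splits)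
    then show "(\<one>\<^bsub>?P\<^esub> \<otimes>\<^bsub>?P\<^esub> f) x = f x" using ends[OF f, of u p] by (auto simp: x onev)
  qed
  have oner: "f \<otimes>\<^bsub>?P\<^esub> \<one>\<^bsub>?P\<^esub> = f" if f: "f \<in> carrier ?P" for f
  proof
    fix x :: "'q \<times> 'e list" obtain u p where x: "x = (u, p)" by (cases x)
    have "(f \<otimes>\<^bsub>?P\<^esub> \<one>\<^bsub>?P\<^esub>) (u, p) = (\<Sum>(q, r)\<in>{([], p)}. f (awlast u q, r) * \<one>\<^bsub>?P\<^esub> (u, q))"
      unfolding mulv by (rule sum.mono_neutral_right) (auto simp: finite_splits onev split: if_splits)
    then show "(f \<otimes>\<^bsub>?P\<^esub> \<one>\<^bsub>?P\<^esub>) x = f x" using ends[OF f, of u p]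
      by (auto simp: x onev awalk_verts.simps)
  qed
  have mon: "Group.monoid ?P"
    by (rule monoidI) (use mulc onec assoc onel oner in auto)
  have ext: "f = g" if "\<And>u p. f (u, p) = g (u, p)" for f g :: "'q \<times> 'e list \<Rightarrow> 'k"
    using that by auto
  have rng: "ring ?P"
    by (rule ringI[OF grp mon]; rule ext)
      (auto simp: mulv addv algebra_simps sum.distrib[symmetric] intro!: sum.cong)
  have ml: "(c \<odot>\<^bsub>?P\<^esub> f) \<otimes>\<^bsub>?P\<^esub> g = c \<odot>\<^bsub>?P\<^esub> (f \<otimes>\<^bsub>?P\<^esub> g)" for c f g
    by (rule ext) (auto simp: mulv smv sum_distrib_left mult.assoc intro!: sum.cong)
  have mr: "f \<otimes>\<^bsub>?P\<^esub> (c \<odot>\<^bsub>?P\<^esub> g) = c \<odot>\<^bsub>?P\<^esub> (f \<otimes>\<^bsub>?P\<^esub> g)" for c f g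
    by (rule ext) (auto simp: mulv smv sum_distrib_left mult_ac intro!: sum.cong)
  show ?thesis
    by (intro unital_algebra.intro unital_algebra_axioms.intro rng smc ml mr)
      (simp_all add: addv smv fun_eq_iff algebra_simps)
qed

lemma unital_algebra_quotient_algebra:
  assumes A: "unital_algebra A" and I: "ideal I A"
  shows "unital_algebra (quotient_algebra A I)"
proof -
  interpret unital_algebra A by fact
  interpret ideal I A by fact
  let ?B = "quotient_algebra A I"
  interpret Q: ring "A Quot I" by (rule quotient_is_ring)
  have eqs: "carrier ?B = carrier (A Quot I)" "mult ?B = mult (A Quot I)" "one ?B = one (A Quot I)"
    "zero ?B = zero (A Quot I)" "add ?B = add (A Quot I)"
    by (simp_all add: quotient_algebra_def)
  have grp: "abelian_group ?B"
    by (rule abelian_groupI) (auto simp: eqs Q.a_ac intro: Q.l_neg)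
  have mon: "Group.monoid ?B"
    by (rule monoidI) (simp_all add: eqs Q.m_assoc)
  have rng: "ring ?B"
    by (rule ringI[OF grp mon]) (simp_all add: eqs Q.l_distr Q.r_distr)
  have coset: "\<exists>x\<in>carrier A. X = I +>\<^bsub>A\<^esub> x" if "X \<in> carrier ?B" for X
    using that by (auto simp: quotient_algebra_def FactRing_simps)
  have cc: "I +>\<^bsub>A\<^esub> x \<in> carrier ?B" if "x \<in> carrier A" for x
    using that by (auto simp: quotient_algebra_def FactRing_simps)
  have Isc: "c \<odot>\<^bsub>A\<^esub> i \<in> I" if "i \<in> I" for c i
  proof -
    have ic: "i \<in> carrier A" using that by (rule Icarr)
    have "c \<odot>\<^bsub>A\<^esub> i = (c \<odot>\<^bsub>A\<^esub> \<one>\<^bsub>A\<^esub>) \<otimes>\<^bsub>A\<^esub> i"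
      using ic by (simp add: scalar_mult_left)
    then show ?thesis using that by (simp add: I_l_closed scalar_closed)
  qed
  have sm: "c \<odot>\<^bsub>?B\<^esub> (I +>\<^bsub>A\<^esub> x) = I +>\<^bsub>A\<^esub> (c \<odot>\<^bsub>A\<^esub> x)" if x: "x \<in> carrier A" for c x
  proof -
    have const: "I +>\<^bsub>A\<^esub> (c \<odot>\<^bsub>A\<^esub> y) = I +>\<^bsub>A\<^esub> (c \<odot>\<^bsub>A\<^esub> x)" if "y \<in> I +>\<^bsub>A\<^esub> x" for y
    proof -
      have "\<exists>i\<in>I. y = i \<oplus>\<^bsub>A\<^esub> x" using that unfolding a_r_coset_def' by simp
      then obtain i where i: "i \<in> I" "y = i \<oplus>\<^bsub>A\<^esub> x" by (elim bexE)
      have "c \<odot>\<^bsub>A\<^esub> y = c \<odot>\<^bsub>A\<^esub> i \<oplus>\<^bsub>A\<^esub> c \<odot>\<^bsub>A\<^esub> x"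
        unfolding i(2) by (rule scalar_add_right[OF Icarr[OF i(1)] x])
      then have "c \<odot>\<^bsub>A\<^esub> y \<in> I +>\<^bsub>A\<^esub> (c \<odot>\<^bsub>A\<^esub> x)" 
        unfolding a_r_coset_def' by (simp only:) (rule UN_I[OF Isc[OF i(1)]], rule singletonI)
      then show ?thesis
        by (rule a_repr_independence[OF _ scalar_closed[OF x] a_subgroup, symmetric])
    qed
    have "I +>\<^bsub>A\<^esub> x \<noteq> {}" using a_rcos_self[OF x] by (metis empty_iff)
    then have "(\<Union>y\<in>I +>\<^bsub>A\<^esub> x. I +>\<^bsub>A\<^esub> (c \<odot>\<^bsub>A\<^esub> y)) = I +>\<^bsub>A\<^esub> (c \<odot>\<^bsub>A\<^esub> x)"
      by (rule SUP_eq_const) (rule const)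
    then show ?thesis by (simp only: quotient_algebra_def module.simps)
  qed
  have ad: "(I +>\<^bsub>A\<^esub> x) \<oplus>\<^bsub>?B\<^esub> (I +>\<^bsub>A\<^esub> y) = I +>\<^bsub>A\<^esub> (x \<oplus>\<^bsub>A\<^esub> y)"
    if "x \<in> carrier A" "y \<in> carrier A" for x y
    using that by (simp add: quotient_algebra_def FactRing_def a_rcos_sum)
  have mu: "(I +>\<^bsub>A\<^esub> x) \<otimes>\<^bsub>?B\<^esub> (I +>\<^bsub>A\<^esub> y) = I +>\<^bsub>A\<^esub> (x \<otimes>\<^bsub>A\<^esub> y)"
    if "x \<in> carrier A" "y \<in> carrier A" for x y
    using that by (simp add: quotient_algebra_def FactRing_def rcoset_mult_add)
  show ?thesis
    by (intro unital_algebra.intro unital_algebra_axioms.intro rng)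
      (auto dest!: coset simp: sm ad mu cc scalar_closed scalar_add_left scalar_add_right
        scalar_assoc scalar_one scalar_mult_left scalar_mult_right)
qed

lemma unital_algebra_alpha_beta_quiver:
  "unital_algebra (quiver_algebra (alpha_beta_quiver s)
     (beta_alpha_relations s :: (vertex \<times> arrow list \<Rightarrow> 'k::field) set))"
proof -
  let ?Q = "alpha_beta_quiver s"
  let ?P = "path_algebra ?Q :: ('k, _) module"
  have wf: "wf_digraph ?Q" by unfold_locales (auto simp: alpha_beta_quiver_def)
  have P: "unital_algebra ?P"
    by (rule unital_algebra_path_algebra[OF wf]) (simp add: alpha_beta_quiver_def)
  interpret unital_algebra ?P by (rule P)
  have arr: "arrow_element ?Q e \<in> carrier ?P" if "e \<in> arcs ?Q" for e
  proof -
    have "{x. (arrow_element ?Q e x :: 'k) \<noteq> 0} = {(tail ?Q e, [e])}"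
      by (auto simp: arrow_element_def)
    moreover have "(tail ?Q e, [e]) \<in> quiver_paths ?Q"
      using that wf_digraph.tail_in_verts[OF wf that]
      by (auto simp: quiver_paths_def pre_digraph.awalk_def pre_digraph.cas.simps)
    ultimately show ?thesis by (simp add: path_algebra_def)
  qed
  have "beta_alpha_relations s \<subseteq> carrier ?P"
    unfolding beta_alpha_relations_def by (auto intro!: m_closed arr) (auto simp: alpha_beta_quiver_def)
  then have "ideal (Idl\<^bsub>?P\<^esub> (beta_alpha_relations s)) ?P" by (rule genideal_ideal)
  then show ?thesis unfolding quiver_algebra_def by (rule unital_algebra_quotient_algebra[OF P])
qed

lemma beta_alpha_product:
  "arrow_element (alpha_beta_quiver s) (Beta j) \<otimes>\<^bsub>path_algebra (alpha_beta_quiver s)\<^esub>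
     arrow_element (alpha_beta_quiver s) (Alpha i) =
   (\<lambda>x. if x = (V1, [Alpha i, Beta j]) then 1 else (0::'k::field))" (is "?l = ?r")
proof
  fix x :: "vertex \<times> arrow list" obtain u p where x: "x = (u,p)" by (cases x)
  have "?l (u,p) = (\<Sum>(q, r) \<in> {(q,r). q @ r = p}. if (u,q) = (V1,[Alpha i]) \<and> r = [Beta j] then 1 else 0)"
    unfolding path_algebra_def arrow_element_def
    by (auto simp: alpha_beta_quiver_def pre_digraph.awalk_verts.simps intro!: sum.cong)
  also have "\<dots> = (\<Sum>(q, r) \<in> (if u = V1 \<and> p = [Alpha i, Beta j] then {([Alpha i],[Beta j])} else {}). 1)"
    by (rule sum.mono_neutral_cong_right) (auto simp: finite_splits split: if_splits)
  finally show "?l x = ?r x" by (auto simp: x)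
qed

end

(*
  Write B^+ for the homotope of A = End(V) before the unit is adjoined.  Since A is simple, an equation
  1 = sum u_p Delta p holds in A.  Hence x = sum (x u_p) Delta p = sum u_p Delta (p x) for all x, which
  shows that the multiplication of B^+ is surjective and provides dual bases of B^+ over B on both sides.

  For the Morita equivalence let E be a generalized inverse of Delta and choose a vector w and a
  functional mu with E Delta w = w, mu Delta E = mu and mu (Delta w) = 1.  The orthogonal idempotents
  e1 = (w tensor mu) and e2 = 1 - E of B add up to a full idempotent e.  With a basis k_i of the kernel
  of Delta and a basis rho_j of the functionals that vanish on its range, eBe has the basis e1, e2,
  alpha_i = (k_i tensor mu), beta_j = (w tensor rho_j), alpha_i beta_j = (k_i tensor rho_j), and
  beta_j alpha_i = 0 because Delta k_i = 0; so eBe is the algebra of the quiver.  The functor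
  M |-> eM to its modules is an equivalence.  Its inverse is N |-> Hom(eB, N), which fits into any
  infinite universe that contains N since eB is finitely generated over eBe.
*)

theory Submission
  imports Defs "HOL-Library.Equipollence"
begin

text \<open>Products of rank-one operators in B^+ follow one formula: (x tensor l)(y tensor m) =
  l(Delta y) (x tensor m). It explains the choice of e. In B^+ the element E is an idempotent and a
  sum of r equivalent rank-one idempotents, r being the rank of Delta; e1 is one of them.
  Compression by 1 - E turns a left factor into its projection to ker Delta and restricts a right
  factor to functionals that vanish on the range of Delta, which is where k_i and rho_j come from.
  An equivalence is to be exhibited inside one fixed universe, and this is the main obstacle.
  Homomorphisms out of eB are preferred to the tensor product of Be with N because they are
  functions rather than classes of a quotient: they are determined by finitely many values, and a
  finite power of an infinite set embeds into the set. They are used only object by object, for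
  essential surjectivity; that M |-> eM is full and faithful is proved directly, from 1 being a
  finite sum of products x e y.\<close>

section \<open>Linear categories\<close>

text \<open>The record of the same name carries only data. Associativity, units and bilinearity of
  composition are what the construction of a quasi-inverse functor consumes.\<close>

locale linear_category =
  fixes C :: "('k::field, 'o, 'm) linear_category"
  assumes ident_closed: "X \<in> Obj C \<Longrightarrow> Ident C X \<in> carrier (Hom C X X)"
    and comp_closed: "\<lbrakk>X \<in> Obj C; Y \<in> Obj C; Z \<in> Obj C; f \<in> carrier (Hom C X Y);
      g \<in> carrier (Hom C Y Z)\<rbrakk> \<Longrightarrow> Comp C X Y Z g f \<in> carrier (Hom C X Z)"
    and comp_assoc: "\<lbrakk>W \<in> Obj C; X \<in> Obj C; Y \<in> Obj C; Z \<in> Obj C; f \<in> carrier (Hom C W X);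
      g \<in> carrier (Hom C X Y); h \<in> carrier (Hom C Y Z)\<rbrakk> \<Longrightarrow>
      Comp C W X Z (Comp C X Y Z h g) f = Comp C W Y Z h (Comp C W X Y g f)"
    and comp_ident_left: "\<lbrakk>X \<in> Obj C; Y \<in> Obj C; f \<in> carrier (Hom C X Y)\<rbrakk> \<Longrightarrow>
      Comp C X Y Y (Ident C Y) f = f"
    and comp_ident_right: "\<lbrakk>X \<in> Obj C; Y \<in> Obj C; f \<in> carrier (Hom C X Y)\<rbrakk> \<Longrightarrow>
      Comp C X X Y f (Ident C X) = f"
    and hom_add_closed: "\<lbrakk>X \<in> Obj C; Y \<in> Obj C; f \<in> carrier (Hom C X Y);
      g \<in> carrier (Hom C X Y)\<rbrakk> \<Longrightarrow> f \<oplus>\<^bsub>Hom C X Y\<^esub> g \<in> carrier (Hom C X Y)"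
    and hom_smult_closed: "\<lbrakk>X \<in> Obj C; Y \<in> Obj C; f \<in> carrier (Hom C X Y)\<rbrakk> \<Longrightarrow>
      c \<odot>\<^bsub>Hom C X Y\<^esub> f \<in> carrier (Hom C X Y)"
    and comp_add_left: "\<lbrakk>X \<in> Obj C; Y \<in> Obj C; Z \<in> Obj C; f \<in> carrier (Hom C X Y);
      g \<in> carrier (Hom C Y Z); h \<in> carrier (Hom C Y Z)\<rbrakk> \<Longrightarrow>
      Comp C X Y Z (g \<oplus>\<^bsub>Hom C Y Z\<^esub> h) f =
      Comp C X Y Z g f \<oplus>\<^bsub>Hom C X Z\<^esub> Comp C X Y Z h f"
    and comp_add_right: "\<lbrakk>X \<in> Obj C; Y \<in> Obj C; Z \<in> Obj C; f \<in> carrier (Hom C X Y);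
      g \<in> carrier (Hom C X Y); h \<in> carrier (Hom C Y Z)\<rbrakk> \<Longrightarrow>
      Comp C X Y Z h (f \<oplus>\<^bsub>Hom C X Y\<^esub> g) =
      Comp C X Y Z h f \<oplus>\<^bsub>Hom C X Z\<^esub> Comp C X Y Z h g"
    and comp_smult_left: "\<lbrakk>X \<in> Obj C; Y \<in> Obj C; Z \<in> Obj C; f \<in> carrier (Hom C X Y);
      g \<in> carrier (Hom C Y Z)\<rbrakk> \<Longrightarrow>
      Comp C X Y Z (c \<odot>\<^bsub>Hom C Y Z\<^esub> g) f = c \<odot>\<^bsub>Hom C X Z\<^esub> Comp C X Y Z g f"
    and comp_smult_right: "\<lbrakk>X \<in> Obj C; Y \<in> Obj C; Z \<in> Obj C; f \<in> carrier (Hom C X Y);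
      g \<in> carrier (Hom C Y Z)\<rbrakk> \<Longrightarrow>
      Comp C X Y Z g (c \<odot>\<^bsub>Hom C X Y\<^esub> f) = c \<odot>\<^bsub>Hom C X Z\<^esub> Comp C X Y Z g f"

text \<open>Choice produces the quasi-inverse: \<open>Go Y\<close> is an object whose image is
  isomorphic to \<open>Y\<close>, and on morphisms G is the unique lift of the conjugate by the
  chosen isomorphisms. As F is faithful, functoriality and linearity of G can be checked after
  applying F.\<close>

lemma linearly_equivalentI:
  fixes C :: "('k::field, 'o, 'm) linear_category" and D :: "('k, 'p, 'n) linear_category"
  assumes C: "linear_category C" and D: "linear_category D"
    and F: "linear_functor C D Fo Fm"
    and faithful: "\<And>X Y. X \<in> Obj C \<Longrightarrow> Y \<in> Obj C \<Longrightarrow> inj_on (Fm X Y) (carrier (Hom C X Y))"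
    and full: "\<And>X Y g. X \<in> Obj C \<Longrightarrow> Y \<in> Obj C \<Longrightarrow> g \<in> carrier (Hom D (Fo X) (Fo Y)) \<Longrightarrow>
      \<exists>f\<in>carrier (Hom C X Y). Fm X Y f = g"
    and ess_surj: "\<And>Y. Y \<in> Obj D \<Longrightarrow> \<exists>X\<in>Obj C. \<exists>f. isomorphism D (Fo X) Y f"
  shows "linearly_equivalent C D"
proof -
  interpret C: linear_category C by fact
  interpret D: linear_category D by fact
  interpret F: linear_functor C D Fo Fm by fact
  have "\<forall>Y\<in>Obj D. \<exists>X\<in>Obj C. \<exists>f\<in>carrier (Hom D (Fo X) Y). \<exists>g\<in>carrier (Hom D Y (Fo X)).
      Comp D (Fo X) Y (Fo X) g f = Ident D (Fo X) \<and> Comp D Y (Fo X) Y f g = Ident D Y"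
    using ess_surj unfolding isomorphism_def by blast
  then obtain Go \<epsilon> \<epsilon>' where Go: "\<And>Y. Y \<in> Obj D \<Longrightarrow> Go Y \<in> Obj C"
    and \<epsilon>: "\<And>Y. Y \<in> Obj D \<Longrightarrow> \<epsilon> Y \<in> carrier (Hom D (Fo (Go Y)) Y)"
    and \<epsilon>': "\<And>Y. Y \<in> Obj D \<Longrightarrow> \<epsilon>' Y \<in> carrier (Hom D Y (Fo (Go Y)))"
    and \<epsilon>'\<epsilon>: "\<And>Y. Y \<in> Obj D \<Longrightarrow> Comp D (Fo (Go Y)) Y (Fo (Go Y)) (\<epsilon>' Y) (\<epsilon> Y) = Ident D (Fo (Go Y))"
    and \<epsilon>\<epsilon>': "\<And>Y. Y \<in> Obj D \<Longrightarrow> Comp D Y (Fo (Go Y)) Y (\<epsilon> Y) (\<epsilon>' Y) = Ident D Y"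
    by metis
  note Fo = F.map_obj
  have eqI: "f = g" if "Fm X Y f = Fm X Y g" "X \<in> Obj C" "Y \<in> Obj C"
      "f \<in> carrier (Hom C X Y)" "g \<in> carrier (Hom C X Y)" for X Y f g
    using faithful that by (meson inj_onD)
  define lft where "lft X Y g = (SOME f. f \<in> carrier (Hom C X Y) \<and> Fm X Y f = g)" for X Y g
  have lft: "lft X Y g \<in> carrier (Hom C X Y)" "Fm X Y (lft X Y g) = g"
    if "X \<in> Obj C" "Y \<in> Obj C" "g \<in> carrier (Hom D (Fo X) (Fo Y))" for X Y g
  proof -
    have "lft X Y g \<in> carrier (Hom C X Y) \<and> Fm X Y (lft X Y g) = g"
      unfolding lft_def by (rule someI_ex) (use full[OF that] in auto)
    then show "lft X Y g \<in> carrier (Hom C X Y)" "Fm X Y (lft X Y g) = g" by auto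
  qed
  \<comment> \<open>Conjugation of h : X -> Y by the chosen isomorphisms gives a morphism from F (G
    X) to F (G Y); its lift will be G h.\<close>
  define con where "con X Y h = Comp D (Fo (Go X)) Y (Fo (Go Y)) (\<epsilon>' Y)
    (Comp D (Fo (Go X)) X Y h (\<epsilon> X))" for X Y h
  have con: "con X Y h \<in> carrier (Hom D (Fo (Go X)) (Fo (Go Y)))"
    if "X \<in> Obj D" "Y \<in> Obj D" "h \<in> carrier (Hom D X Y)" for X Y h
    unfolding con_def using that
    by (intro D.comp_closed[of _ Y] D.comp_closed[of _ X] Fo Go \<epsilon> \<epsilon>') 
  \<comment> \<open>Since \<open>con X Y h\<close> is F (G h), this is already the naturality of
    \<open>\<epsilon>\<close>.\<close>
  have \<epsilon>con: "Comp D (Fo (Go X)) (Fo (Go Y)) Y (\<epsilon> Y) (con X Y h) = Comp D (Fo (Go X)) X Y h (\<epsilon> X)"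
    if "X \<in> Obj D" "Y \<in> Obj D" "h \<in> carrier (Hom D X Y)" for X Y h
    unfolding con_def using that
    by (simp add: D.comp_assoc[symmetric, where W = "Fo (Go X)" and X = Y] Fo Go \<epsilon> \<epsilon>' D.comp_closed[of _ X]
        \<epsilon>\<epsilon>' D.comp_ident_left)
  define Gm where "Gm X Y h = lft (Go X) (Go Y) (con X Y h)" for X Y h
  have Gm: "Gm X Y h \<in> carrier (Hom C (Go X) (Go Y))" "Fm (Go X) (Go Y) (Gm X Y h) = con X Y h"
    if "X \<in> Obj D" "Y \<in> Obj D" "h \<in> carrier (Hom D X Y)" for X Y h
    unfolding Gm_def using that by (simp_all add: lft Go con)
  \<comment> \<open>The unit is the lift of the inverse of \<open>\<epsilon>\<close> at F X, so its
    properties become identities between \<open>\<epsilon>\<close> and \<open>\<epsilon>'\<close>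
    once F is applied.\<close>
  define \<eta> where "\<eta> X = lft X (Go (Fo X)) (\<epsilon>' (Fo X))" for X
  have \<eta>: "\<eta> X \<in> carrier (Hom C X (Go (Fo X)))" "Fm X (Go (Fo X)) (\<eta> X) = \<epsilon>' (Fo X)"
    if "X \<in> Obj C" for X
    unfolding \<eta>_def using that by (simp_all add: lft Go Fo \<epsilon>')
  define \<eta>' where "\<eta>' X = lft (Go (Fo X)) X (\<epsilon> (Fo X))" for X
  have \<eta>': "\<eta>' X \<in> carrier (Hom C (Go (Fo X)) X)" "Fm (Go (Fo X)) X (\<eta>' X) = \<epsilon> (Fo X)"
    if "X \<in> Obj C" for X
    unfolding \<eta>'_def using that by (simp_all add: lft Go Fo \<epsilon>)
  have G: "linear_functor D C Go Gm"
  proof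
    fix X assume X: "X \<in> Obj D"
    show "Gm X X (Ident D X) = Ident C (Go X)"
      by (rule eqI) (use X in \<open>auto intro!: Go Gm C.ident_closed D.ident_closed simp: Gm D.ident_closed
        F.map_ident Go con_def D.comp_ident_left[of "Fo (Go X)" X] Fo \<epsilon> \<epsilon>'\<epsilon>\<close>)
  next
    fix X Y Z f g assume *: "X \<in> Obj D" "Y \<in> Obj D" "Z \<in> Obj D"
      "f \<in> carrier (Hom D X Y)" "g \<in> carrier (Hom D Y Z)"
    have fg: "Comp D X Y Z g f \<in> carrier (Hom D X Z)" using * by (rule D.comp_closed)
    \<comment> \<open>The isomorphisms in the middle of the composite cancel through
      \<open>\<epsilon>con\<close>.\<close>
    have "Comp D (Fo (Go X)) (Fo (Go Y)) (Fo (Go Z)) (con Y Z g) (con X Y f) =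
      Comp D (Fo (Go X)) Z (Fo (Go Z)) (\<epsilon>' Z) (Comp D (Fo (Go X)) (Fo (Go Y)) Z
        (Comp D (Fo (Go Y)) Y Z g (\<epsilon> Y)) (con X Y f))"
      unfolding con_def[of Y Z] using *
      by (intro D.comp_assoc) (auto intro!: Fo Go con \<epsilon> \<epsilon>' D.comp_closed[of _ Y])
    also have "Comp D (Fo (Go X)) (Fo (Go Y)) Z (Comp D (Fo (Go Y)) Y Z g (\<epsilon> Y)) (con X Y f) =
       Comp D (Fo (Go X)) Y Z g (Comp D (Fo (Go X)) X Y f (\<epsilon> X))"
      using * by (subst D.comp_assoc) (auto intro!: Fo Go con \<epsilon> simp: \<epsilon>con)
    also have "\<dots> = Comp D (Fo (Go X)) X Z (Comp D X Y Z g f) (\<epsilon> X)"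
      using * by (subst D.comp_assoc) (auto intro!: Fo Go \<epsilon>)
    finally have "Comp D (Fo (Go X)) (Fo (Go Y)) (Fo (Go Z)) (con Y Z g) (con X Y f) =
      con X Z (Comp D X Y Z g f)" unfolding con_def[of X Z] .
    then show "Gm X Z (Comp D X Y Z g f) = Comp C (Go X) (Go Y) (Go Z) (Gm Y Z g) (Gm X Y f)"
      by (intro eqI[of "Go X" "Go Z"])
        (use * fg in \<open>auto simp: Gm F.map_comp Go intro!: C.comp_closed[of _ "Go Y"]\<close>)
  next
    fix X Y f g assume *: "X \<in> Obj D" "Y \<in> Obj D" "f \<in> carrier (Hom D X Y)" "g \<in> carrier (Hom D X Y)"
    show "Gm X Y (f \<oplus>\<^bsub>Hom D X Y\<^esub> g) = Gm X Y f \<oplus>\<^bsub>Hom C (Go X) (Go Y)\<^esub> Gm X Y g"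
    proof (rule eqI)
      have "con X Y (f \<oplus>\<^bsub>Hom D X Y\<^esub> g) = con X Y f \<oplus>\<^bsub>Hom D (Fo (Go X)) (Fo (Go Y))\<^esub> con X Y g"
        unfolding con_def using *
        by (simp add: D.comp_add_left D.comp_add_right[where Y = Y] Fo Go \<epsilon> \<epsilon>' D.comp_closed[of _ X])
      then show "Fm (Go X) (Go Y) (Gm X Y (f \<oplus>\<^bsub>Hom D X Y\<^esub> g)) =
         Fm (Go X) (Go Y) (Gm X Y f \<oplus>\<^bsub>Hom C (Go X) (Go Y)\<^esub> Gm X Y g)"
        using * by (simp add: Gm F.map_add Go D.hom_add_closed)
    qed (use * in \<open>auto intro!: Gm Go C.hom_add_closed D.hom_add_closed\<close>)
  next
    fix X Y f c assume *: "X \<in> Obj D" "Y \<in> Obj D" "f \<in> carrier (Hom D X Y)"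
    show "Gm X Y (c \<odot>\<^bsub>Hom D X Y\<^esub> f) = c \<odot>\<^bsub>Hom C (Go X) (Go Y)\<^esub> Gm X Y f"
    proof (rule eqI)
      have "con X Y (c \<odot>\<^bsub>Hom D X Y\<^esub> f) = c \<odot>\<^bsub>Hom D (Fo (Go X)) (Fo (Go Y))\<^esub> con X Y f"
        unfolding con_def using *
        by (simp add: D.comp_smult_left D.comp_smult_right[where Y = Y] Fo Go \<epsilon> \<epsilon>' D.comp_closed[of _ X])
      then show "Fm (Go X) (Go Y) (Gm X Y (c \<odot>\<^bsub>Hom D X Y\<^esub> f)) =
         Fm (Go X) (Go Y) (c \<odot>\<^bsub>Hom C (Go X) (Go Y)\<^esub> Gm X Y f)"
        using * by (simp add: Gm F.map_smult Go D.hom_smult_closed)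
    qed (use * in \<open>auto intro!: Gm Go C.hom_smult_closed D.hom_smult_closed\<close>)
  qed (auto intro: Go Gm)
  have \<eta>_nat: "natural_isomorphism C C (\<lambda>X. X) (\<lambda>X Y f. f)
      (\<lambda>X. Go (Fo X)) (\<lambda>X Y f. Gm (Fo X) (Fo Y) (Fm X Y f)) \<eta>"
  proof
    fix X assume X: "X \<in> Obj C"
    then have GFX: "Go (Fo X) \<in> Obj C" by (intro Go Fo)
    have "Comp C X (Go (Fo X)) X (\<eta>' X) (\<eta> X) = Ident C X"
      by (rule eqI) (use X GFX in \<open>auto intro!: C.comp_closed[of X "Go (Fo X)"] C.ident_closed
        simp: \<eta> \<eta>' F.map_comp F.map_ident \<epsilon>\<epsilon>' Fo\<close>)
    moreover have "Comp C (Go (Fo X)) X (Go (Fo X)) (\<eta> X) (\<eta>' X) = Ident C (Go (Fo X))"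
      by (rule eqI[of "Go (Fo X)" "Go (Fo X)"]) (use X GFX in \<open>auto intro!: C.comp_closed[of _ X] C.ident_closed
        simp: \<eta> \<eta>' F.map_comp F.map_ident \<epsilon>'\<epsilon> Fo\<close>)
    ultimately show "isomorphism C X (Go (Fo X)) (\<eta> X)"
      unfolding isomorphism_def using \<eta>[OF X] \<eta>'[OF X] by blast
  next
    fix X Y f assume *: "X \<in> Obj C" "Y \<in> Obj C" "f \<in> carrier (Hom C X Y)"
    then have GF: "Go (Fo X) \<in> Obj C" "Go (Fo Y) \<in> Obj C" and F: "Fo X \<in> Obj D" "Fo Y \<in> Obj D"
      and Ff: "Fm X Y f \<in> carrier (Hom D (Fo X) (Fo Y))" by (auto intro: Go Fo F.map_hom)
    have "Comp D (Fo X) (Fo (Go (Fo X))) (Fo (Go (Fo Y))) (con (Fo X) (Fo Y) (Fm X Y f)) (\<epsilon>' (Fo X)) =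
      Comp D (Fo X) (Fo Y) (Fo (Go (Fo Y))) (\<epsilon>' (Fo Y)) (Comp D (Fo X) (Fo (Go (Fo X))) (Fo Y)
        (Comp D (Fo (Go (Fo X))) (Fo X) (Fo Y) (Fm X Y f) (\<epsilon> (Fo X))) (\<epsilon>' (Fo X)))"
      unfolding con_def
      by (intro D.comp_assoc) (auto intro!: Fo GF \<epsilon> \<epsilon>' F * Ff D.comp_closed[of _ "Fo X"])
    also have "Comp D (Fo X) (Fo (Go (Fo X))) (Fo Y)
        (Comp D (Fo (Go (Fo X))) (Fo X) (Fo Y) (Fm X Y f) (\<epsilon> (Fo X))) (\<epsilon>' (Fo X)) = Fm X Y f"
      by (subst D.comp_assoc) (auto simp: Fo GF \<epsilon> \<epsilon>' F * Ff \<epsilon>\<epsilon>' D.comp_ident_right)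
    finally show "Comp C X Y (Go (Fo Y)) (\<eta> Y) f =
        Comp C X (Go (Fo X)) (Go (Fo Y)) (Gm (Fo X) (Fo Y) (Fm X Y f)) (\<eta> X)"
      by (intro eqI[of X "Go (Fo Y)"]) (auto intro!: C.comp_closed[of _ Y] C.comp_closed[of X "Go (Fo X)"]
        simp: * GF F Ff \<eta> Gm F.map_comp)
  qed
  have \<epsilon>_nat: "natural_isomorphism D D (\<lambda>X. Fo (Go X)) (\<lambda>X Y f. Fm (Go X) (Go Y) (Gm X Y f))
      (\<lambda>X. X) (\<lambda>X Y f. f) \<epsilon>"
  proof
    fix X assume "X \<in> Obj D"
    then show "isomorphism D (Fo (Go X)) X (\<epsilon> X)"
      unfolding isomorphism_def using \<epsilon> \<epsilon>' \<epsilon>'\<epsilon> \<epsilon>\<epsilon>' by blast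
  next
    fix X Y f assume "X \<in> Obj D" "Y \<in> Obj D" "f \<in> carrier (Hom D X Y)"
    then show "Comp D (Fo (Go X)) (Fo (Go Y)) Y (\<epsilon> Y) (Fm (Go X) (Go Y) (Gm X Y f)) =
        Comp D (Fo (Go X)) X Y f (\<epsilon> X)"
      by (simp add: Gm \<epsilon>con)
  qed
  show ?thesis unfolding linearly_equivalent_def using F G \<eta>_nat \<epsilon>_nat by blast
qed

section \<open>Finite powers of a universe, generated two-sided ideals, module categories\<close>

section \<open>Modules over algebras\<close>

text \<open>Homomorphisms from a finitely generated module into one over \<open>'u\<close> embed
  into a finite power of \<open>'u\<close>, and this brings them back into \<open>'u\<close>. The
  induction step is \<open>'u \<times> 'u \<approx> 'u\<close>.\<close>

lemma finite_PiE_lepoll_infinite: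
  assumes "finite Y" and "infinite (UNIV :: 'u set)"
  shows "(\<Pi>\<^sub>E y\<in>Y. UNIV :: 'u set) \<lesssim> (UNIV :: 'u set)"
  using assms(1)
proof induction
  case empty
  show ?case by (simp add: lepoll_def inj_on_def)
next
  case (insert y Y)
  have "(\<Pi>\<^sub>E x\<in>insert y Y. UNIV :: 'u set) \<lesssim> (UNIV :: 'u set) \<times> (\<Pi>\<^sub>E x\<in>Y. UNIV :: 'u set)"
    unfolding lepoll_def
  proof (intro exI[of _ "\<lambda>f. (f y, restrict f Y)"] conjI inj_onI)
    fix f g assume *: "f \<in> (\<Pi>\<^sub>E x\<in>insert y Y. UNIV :: 'u set)" "g \<in> (\<Pi>\<^sub>E x\<in>insert y Y. UNIV :: 'u set)"
      "(f y, restrict f Y) = (g y, restrict g Y)"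
    show "f = g"
    proof (rule PiE_ext[OF *(1,2)])
      fix x assume "x \<in> insert y Y"
      then show "f x = g x" using *(3) by (auto dest: fun_cong[of _ _ x])
    qed
  qed auto
  also have "\<dots> \<lesssim> (UNIV :: 'u set) \<times> (UNIV :: 'u set)"
    by (intro times_lepoll_mono insert lepoll_refl)
  also have "\<dots> \<approx> (UNIV :: 'u set)"
    unfolding eqpoll_iff_card_of_ordIso by (rule card_of_Times_same_infinite) (rule assms)
  finally show ?case .
qed

text \<open>The two-sided ideal generated by e in a form that comes with an induction over finite
  sums of products x e y. Zero is 0 e 0, and a sign moves into the left factor.\<close>

inductive_set sandwich_span :: "('a, 'b) ring_scheme \<Rightarrow> 'a \<Rightarrow> 'a set" for R e where
  sandwich: "\<lbrakk>x \<in> carrier R; y \<in> carrier R\<rbrakk> \<Longrightarrow> x \<otimes>\<^bsub>R\<^esub> e \<otimes>\<^bsub>R\<^esub> y \<in> sandwich_span R e"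
| sum: "\<lbrakk>a \<in> sandwich_span R e; b \<in> sandwich_span R e\<rbrakk> \<Longrightarrow> a \<oplus>\<^bsub>R\<^esub> b \<in> sandwich_span R e"

lemma (in ring) sandwich_span_closed:
  assumes "a \<in> sandwich_span R e" "e \<in> carrier R"
  shows "a \<in> carrier R"
  using assms by induction auto

lemma (in ring) ideal_sandwich_span:
  assumes e: "e \<in> carrier R"
  shows "ideal (sandwich_span R e) R"
proof (rule idealI[OF ring_axioms])
  note cl = sandwich_span_closed[OF _ e]
  have "\<zero> \<otimes> e \<otimes> \<zero> \<in> sandwich_span R e" by (rule sandwich_span.sandwich) auto
  then have zero: "\<zero> \<in> sandwich_span R e" using e by simp
  have neg: "\<ominus> a \<in> sandwich_span R e" if "a \<in> sandwich_span R e" for a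
    using that
  proof induction
    case (sandwich x y)
    have "(\<ominus> x) \<otimes> e \<otimes> y \<in> sandwich_span R e" by (rule sandwich_span.sandwich) (use sandwich in auto)
    then show ?case using sandwich e by (simp add: l_minus)
  next
    case (sum a b)
    then show ?case by (simp add: minus_add cl a_comm sandwich_span.sum)
  qed
  show "subgroup (sandwich_span R e) (add_monoid R)"
    by (rule group.subgroupI[OF a_group])
      (use cl zero neg in \<open>auto intro: sandwich_span.sum simp: a_inv_def[symmetric]\<close>)
  fix a x assume a: "a \<in> sandwich_span R e" and x: "x \<in> carrier R"
  from a show "x \<otimes> a \<in> sandwich_span R e"
  proof induction
    case (sandwich u y)
    then have "(x \<otimes> u) \<otimes> e \<otimes> y \<in> sandwich_span R e" by (intro sandwich_span.sandwich) (use x in auto)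
    then show ?case using sandwich e x by (simp add: m_assoc)
  next
    case (sum a b)
    then show ?case by (simp add: r_distr cl x sandwich_span.sum)
  qed
  from a show "a \<otimes> x \<in> sandwich_span R e"
  proof induction
    case (sandwich u y)
    then have "u \<otimes> e \<otimes> (y \<otimes> x) \<in> sandwich_span R e" by (intro sandwich_span.sandwich) (use x in auto)
    then show ?case using sandwich e x by (simp add: m_assoc)
  next
    case (sum a b)
    then show ?case by (simp add: l_distr cl x sandwich_span.sum)
  qed
qed

text \<open>\<open>Idl\<close> is an intersection of ideals; through this inclusion, membership in
  it yields an explicit finite sum.\<close>

lemma (in ring) genideal_subset_sandwich_span:
  assumes e: "e \<in> carrier R"
  shows "Idl {e} \<subseteq> sandwich_span R e"
proof (rule genideal_minimal[OF ideal_sandwich_span[OF e]])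
  have "\<one> \<otimes> e \<otimes> \<one> \<in> sandwich_span R e" by (rule sandwich_span.sandwich) auto
  then show "{e} \<subseteq> sandwich_span R e" using e by simp
qed

context left_module
begin

lemma act_zero: "a \<in> carrier R \<Longrightarrow> a \<odot>\<^bsub>M\<^esub> \<zero>\<^bsub>M\<^esub> = \<zero>\<^bsub>M\<^esub>"
  using act_add_right[of a "\<zero>\<^bsub>M\<^esub>" "\<zero>\<^bsub>M\<^esub>"] act_closed[of a "\<zero>\<^bsub>M\<^esub>"]
  by (metis M.add.one_closed M.add.r_cancel_one' M.l_zero)

lemma act_minus:
  assumes "a \<in> carrier R" "x \<in> carrier M"
  shows "a \<odot>\<^bsub>M\<^esub> (\<ominus>\<^bsub>M\<^esub> x) = \<ominus>\<^bsub>M\<^esub> (a \<odot>\<^bsub>M\<^esub> x)"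
proof -
  have "a \<odot>\<^bsub>M\<^esub> (\<ominus>\<^bsub>M\<^esub> x) \<oplus>\<^bsub>M\<^esub> a \<odot>\<^bsub>M\<^esub> x = \<zero>\<^bsub>M\<^esub>"
    using assms by (simp add: act_add_right[symmetric] M.l_neg act_zero)
  then show ?thesis using assms by (intro M.minus_equality[symmetric]) (auto intro: act_closed)
qed

end

lemma (in unital_algebra) scalar_central:
  "a \<in> carrier A \<Longrightarrow> (c \<odot> \<one>) \<otimes> a = a \<otimes> (c \<odot> \<one>)"
  by (simp add: scalar_mult_left scalar_mult_right)

lemma lmod_homD:
  assumes "f \<in> lmod_hom R M N"
  shows "f \<in> extensional (carrier M)"
    and "x \<in> carrier M \<Longrightarrow> f x \<in> carrier N"
    and "x \<in> carrier M \<Longrightarrow> y \<in> carrier M \<Longrightarrow> f (x \<oplus>\<^bsub>M\<^esub> y) = f x \<oplus>\<^bsub>N\<^esub> f y"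
    and "a \<in> carrier R \<Longrightarrow> x \<in> carrier M \<Longrightarrow> f (a \<odot>\<^bsub>M\<^esub> x) = a \<odot>\<^bsub>N\<^esub> f x"
  using assms by (auto simp: lmod_hom_def PiE_def)

lemma lmod_homI:
  assumes "f \<in> extensional (carrier M)"
    and "\<And>x. x \<in> carrier M \<Longrightarrow> f x \<in> carrier N"
    and "\<And>x y. x \<in> carrier M \<Longrightarrow> y \<in> carrier M \<Longrightarrow> f (x \<oplus>\<^bsub>M\<^esub> y) = f x \<oplus>\<^bsub>N\<^esub> f y"
    and "\<And>a x. a \<in> carrier R \<Longrightarrow> x \<in> carrier M \<Longrightarrow> f (a \<odot>\<^bsub>M\<^esub> x) = a \<odot>\<^bsub>N\<^esub> f x"
  shows "f \<in> lmod_hom R M N"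
  using assms by (auto simp: lmod_hom_def PiE_def)

lemma lmod_hom_eqI:
  assumes "f \<in> lmod_hom R M N" "g \<in> lmod_hom R M N'" "\<And>x. x \<in> carrier M \<Longrightarrow> f x = g x"
  shows "f = g"
  using assms(1,2)[THEN lmod_homD(1)] assms(3) by (rule extensionalityI)

lemma module_category_simps:
  "Obj (module_category U A) = {M. left_module A M}"
  "Hom (module_category U A) = hom_space A"
  "carrier (hom_space A M N) = lmod_hom A M N"
  "Comp (module_category U A) L M N g f = compose (carrier L) g f"
  "Ident (module_category U A) M = (\<lambda>x\<in>carrier M. x)"
  "f \<oplus>\<^bsub>hom_space A M N\<^esub> g = (\<lambda>x\<in>carrier M. f x \<oplus>\<^bsub>N\<^esub> g x)"
  "c \<odot>\<^bsub>hom_space A M N\<^esub> f = (\<lambda>x\<in>carrier M. (c \<odot>\<^bsub>A\<^esub> \<one>\<^bsub>A\<^esub>) \<odot>\<^bsub>N\<^esub> f x)"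
  by (simp_all add: module_category_def hom_space_def)

lemma lmod_hom_add:
  assumes M: "left_module A M" and N: "left_module A N"
    and f: "f \<in> lmod_hom A M N" and g: "g \<in> lmod_hom A M N"
  shows "(\<lambda>x\<in>carrier M. f x \<oplus>\<^bsub>N\<^esub> g x) \<in> lmod_hom A M N"
proof -
  interpret M: left_module A M by fact
  interpret N: left_module A N by fact
  note f = lmod_homD[OF f] and g = lmod_homD[OF g]
  show ?thesis
    by (rule lmod_homI)
      (auto simp: f g M.act_closed N.act_add_right N.M.a_ac)
qed

lemma linear_category_module_category:
  assumes "unital_algebra A"
  shows "linear_category (module_category U A)"
proof -
  interpret A: unital_algebra A by fact
  show ?thesis
  proof (unfold_locales, unfold module_category_simps mem_Collect_eq)
    fix M :: "('a, 'c) module" assume "left_module A M"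
    then interpret M: left_module A M .
    show "(\<lambda>x\<in>carrier M. x) \<in> lmod_hom A M M"
      by (rule lmod_homI) (auto simp: M.act_closed)
  next
    fix L M N :: "('a, 'c) module" and f g assume *: "left_module A L" "left_module A M" "left_module A N"
      and f: "f \<in> lmod_hom A L M" and g: "g \<in> lmod_hom A M N"
    interpret L: left_module A L by fact
    show "compose (carrier L) g f \<in> lmod_hom A L N"
      by (rule lmod_homI) (auto simp: compose_def lmod_homD[OF f] lmod_homD[OF g] L.act_closed)
    fix c :: 'b
    have c: "c \<odot>\<^bsub>A\<^esub> \<one>\<^bsub>A\<^esub> \<in> carrier A" by (simp add: A.scalar_closed)
    show "compose (carrier L) (\<lambda>x\<in>carrier M. (c \<odot>\<^bsub>A\<^esub> \<one>\<^bsub>A\<^esub>) \<odot>\<^bsub>N\<^esub> g x) f =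
       (\<lambda>x\<in>carrier L. (c \<odot>\<^bsub>A\<^esub> \<one>\<^bsub>A\<^esub>) \<odot>\<^bsub>N\<^esub> compose (carrier L) g f x)"
      by (auto simp: compose_def fun_eq_iff lmod_homD[OF f])
    show "compose (carrier L) g (\<lambda>x\<in>carrier L. (c \<odot>\<^bsub>A\<^esub> \<one>\<^bsub>A\<^esub>) \<odot>\<^bsub>M\<^esub> f x) =
       (\<lambda>x\<in>carrier L. (c \<odot>\<^bsub>A\<^esub> \<one>\<^bsub>A\<^esub>) \<odot>\<^bsub>N\<^esub> compose (carrier L) g f x)"
      by (auto simp: compose_def fun_eq_iff lmod_homD[OF f] lmod_homD[OF g] c)
  next
    fix K L M N :: "('a, 'c) module" and f g h
    assume "f \<in> lmod_hom A K L" "g \<in> lmod_hom A L M" "h \<in> lmod_hom A M N"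
    then show "compose (carrier K) (compose (carrier L) h g) f =
       compose (carrier K) h (compose (carrier K) g f)"
      by (auto simp: compose_def fun_eq_iff lmod_homD)
  next
    fix M N :: "('a, 'c) module" and f assume f: "f \<in> lmod_hom A M N"
    note f = lmod_homD[OF f]
    show "compose (carrier M) (\<lambda>x\<in>carrier N. x) f = f"
      using f(1,2) by (auto simp: compose_def fun_eq_iff extensional_def)
    show "compose (carrier M) f (\<lambda>x\<in>carrier M. x) = f"
      using f(1) by (auto simp: compose_def fun_eq_iff extensional_def)
  next
    fix M N :: "('a, 'c) module" and f c assume "left_module A M" "left_module A N"
      and f: "f \<in> lmod_hom A M N"
    then interpret M: left_module A M + N: left_module A N by simp_all
    have c: "c \<odot>\<^bsub>A\<^esub> \<one>\<^bsub>A\<^esub> \<in> carrier A" by (simp add: A.scalar_closed)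
    note f = lmod_homD[OF f]
    \<comment> \<open>A scalar multiple of a homomorphism is again a homomorphism because c 1 is
      central in A.\<close>
    have "a \<odot>\<^bsub>N\<^esub> ((c \<odot>\<^bsub>A\<^esub> \<one>\<^bsub>A\<^esub>) \<odot>\<^bsub>N\<^esub> y) = (c \<odot>\<^bsub>A\<^esub> \<one>\<^bsub>A\<^esub>) \<odot>\<^bsub>N\<^esub> (a \<odot>\<^bsub>N\<^esub> y)"
      if "a \<in> carrier A" "y \<in> carrier N" for a y
      using that c by (simp add: N.act_assoc[symmetric] A.scalar_central)
    then show "(\<lambda>x\<in>carrier M. (c \<odot>\<^bsub>A\<^esub> \<one>\<^bsub>A\<^esub>) \<odot>\<^bsub>N\<^esub> f x) \<in> lmod_hom A M N"
      by (intro lmod_homI) (auto simp: f M.act_closed N.act_closed N.act_add_right c)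
  next
    fix L M N :: "('a, 'c) module" and f g h assume f: "f \<in> lmod_hom A L M"
    then show "compose (carrier L) (\<lambda>x\<in>carrier M. g x \<oplus>\<^bsub>N\<^esub> h x) f =
      (\<lambda>x\<in>carrier L. compose (carrier L) g f x \<oplus>\<^bsub>N\<^esub> compose (carrier L) h f x)"
      by (auto simp: compose_def fun_eq_iff lmod_homD)
  next
    fix L M N :: "('a, 'c) module" and f g h assume "f \<in> lmod_hom A L M" "g \<in> lmod_hom A L M"
      "h \<in> lmod_hom A M N"
    then show "compose (carrier L) h (\<lambda>x\<in>carrier L. f x \<oplus>\<^bsub>M\<^esub> g x) =
      (\<lambda>x\<in>carrier L. compose (carrier L) h f x \<oplus>\<^bsub>N\<^esub> compose (carrier L) h g x)"
      by (auto simp: compose_def fun_eq_iff lmod_homD)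
  qed (auto intro: lmod_hom_add)
qed

lemma isomorphism_module_categoryI:
  assumes M: "left_module A M" and f: "f \<in> lmod_hom A M N" and bij: "bij_betw f (carrier M) (carrier N)"
  shows "isomorphism (module_category U A) M N f"
proof -
  interpret M: left_module A M by fact
  note f' = lmod_homD[OF f]
  define g where "g = (\<lambda>y\<in>carrier N. inv_into (carrier M) f y)"
  have inj: "inj_on f (carrier M)" and im: "f ` carrier M = carrier N"
    using bij by (auto simp: bij_betw_def)
  have gf: "g (f x) = x" if "x \<in> carrier M" for x using that inj f' by (simp add: g_def)
  have gc: "g y \<in> carrier M" and fg: "f (g y) = y" if "y \<in> carrier N" for y
    using that unfolding g_def by (auto simp: im inv_into_into f_inv_into_f)
  have g: "g \<in> lmod_hom A N M"
  proof (rule lmod_homI)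
    fix x y assume "x \<in> carrier N" "y \<in> carrier N"
    then show "g (x \<oplus>\<^bsub>N\<^esub> y) = g x \<oplus>\<^bsub>M\<^esub> g y"
      using gf[of "g x \<oplus>\<^bsub>M\<^esub> g y"] by (simp add: f' gc fg)
  next
    fix a x assume "a \<in> carrier A" "x \<in> carrier N"
    then show "g (a \<odot>\<^bsub>N\<^esub> x) = a \<odot>\<^bsub>M\<^esub> g x"
      using gf[of "a \<odot>\<^bsub>M\<^esub> g x"] by (simp add: f' gc fg M.act_closed)
  qed (auto simp: gc, simp add: g_def)
  show ?thesis unfolding isomorphism_def module_category_simps
    by (intro conjI f bexI[of _ g] g) (auto simp: compose_def gf fg)
qed

text \<open>Objects of the module category must have their elements in \<open>'u\<close>, whereas
  coinduced modules consist of functions; an injection \<open>j\<close> carries such a module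
  over.\<close>

lemma left_module_transport:
  fixes M :: "('r, 'm) module" and j :: "'m \<Rightarrow> 'u"
  assumes M: "left_module R M" and j: "inj_on j (carrier M)"
  obtains M' :: "('r, 'u) module" where "left_module R M'" "carrier M' = j ` carrier M"
    "\<And>x y. x \<in> carrier M \<Longrightarrow> y \<in> carrier M \<Longrightarrow> j x \<oplus>\<^bsub>M'\<^esub> j y = j (x \<oplus>\<^bsub>M\<^esub> y)"
    "\<And>a x. a \<in> carrier R \<Longrightarrow> x \<in> carrier M \<Longrightarrow> a \<odot>\<^bsub>M'\<^esub> j x = j (a \<odot>\<^bsub>M\<^esub> x)"
proof -
  interpret M: left_module R M by fact
  define i where "i = inv_into (carrier M) j"
  have i: "i (j x) = x" if "x \<in> carrier M" for x using that j by (simp add: i_def)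
  define M' :: "('r, 'u) module" where "M' = \<lparr>carrier = j ` carrier M, mult = undefined, one = undefined, zero = j \<zero>\<^bsub>M\<^esub>,
    add = (\<lambda>u v. j (i u \<oplus>\<^bsub>M\<^esub> i v)), smult = (\<lambda>a u. j (a \<odot>\<^bsub>M\<^esub> i u))\<rparr>"
  have "abelian_group M'"
  proof (rule abelian_groupI)
    fix u assume "u \<in> carrier M'"
    then obtain x where x: "x \<in> carrier M" "u = j x" by (auto simp: M'_def)
    then show "\<exists>v\<in>carrier M'. v \<oplus>\<^bsub>M'\<^esub> u = \<zero>\<^bsub>M'\<^esub>"
      by (intro bexI[of _ "j (\<ominus>\<^bsub>M\<^esub> x)"]) (auto simp: M'_def i M.M.l_neg)
  qed (auto simp: M'_def i M.M.a_ac)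
  then have "left_module R M'"
    by (intro left_module.intro left_module_axioms.intro M.R.ring_axioms)
      (auto simp: M'_def i M.act_closed M.act_add_left M.act_add_right M.act_assoc M.act_one)
  then show ?thesis by (rule that) (auto simp: M'_def i)
qed

section \<open>The functor M |-> eM for a full idempotent e\<close>

section \<open>Full corners and Morita equivalence\<close>

text \<open>\<open>\<phi>\<close> identifies Q with the corner eBe, where the idempotent e is the
  image of 1 and in general differs from the unit of B. The assumption \<open>full\<close> says BeB
  = B.\<close>

locale full_corner = B: unital_algebra B + Q: unital_algebra Q
  for B :: "('k::field, 'b) module" and Q :: "('k, 'q) module" and \<phi> :: "'q \<Rightarrow> 'b" +
  assumes phi_closed: "q \<in> carrier Q \<Longrightarrow> \<phi> q \<in> carrier B"
    and phi_add: "p \<in> carrier Q \<Longrightarrow> q \<in> carrier Q \<Longrightarrow> \<phi> (p \<oplus>\<^bsub>Q\<^esub> q) = \<phi> p \<oplus>\<^bsub>B\<^esub> \<phi> q"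
    and phi_mult: "p \<in> carrier Q \<Longrightarrow> q \<in> carrier Q \<Longrightarrow> \<phi> (p \<otimes>\<^bsub>Q\<^esub> q) = \<phi> p \<otimes>\<^bsub>B\<^esub> \<phi> q"
    and phi_smult: "q \<in> carrier Q \<Longrightarrow> \<phi> (c \<odot>\<^bsub>Q\<^esub> q) = c \<odot>\<^bsub>B\<^esub> \<phi> q"
    and phi_inj: "inj_on \<phi> (carrier Q)"
    and phi_onto: "b \<in> carrier B \<Longrightarrow> \<exists>q\<in>carrier Q. \<phi> q = \<phi> \<one>\<^bsub>Q\<^esub> \<otimes>\<^bsub>B\<^esub> b \<otimes>\<^bsub>B\<^esub> \<phi> \<one>\<^bsub>Q\<^esub>"
    and full: "\<one>\<^bsub>B\<^esub> \<in> Idl\<^bsub>B\<^esub> {\<phi> \<one>\<^bsub>Q\<^esub>}"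
begin

abbreviation e where "e \<equiv> \<phi> \<one>\<^bsub>Q\<^esub>"

lemma e_closed: "e \<in> carrier B" by (simp add: phi_closed)

lemma phi_e_left: "q \<in> carrier Q \<Longrightarrow> e \<otimes>\<^bsub>B\<^esub> \<phi> q = \<phi> q"
  by (simp add: phi_mult[symmetric])

lemma phi_e_right: "q \<in> carrier Q \<Longrightarrow> \<phi> q \<otimes>\<^bsub>B\<^esub> e = \<phi> q"
  by (simp add: phi_mult[symmetric])

lemma e_idem: "e \<otimes>\<^bsub>B\<^esub> e = e" by (simp add: phi_e_left)

text \<open>Fullness is used in this form: 1 is a finite sum of products x e y, so a property of
  these products that is stable under sums holds for 1.\<close>

lemma full_induct [consumes 0, case_names sandwich sum]:
  assumes "\<And>x y. x \<in> carrier B \<Longrightarrow> y \<in> carrier B \<Longrightarrow> P (x \<otimes>\<^bsub>B\<^esub> e \<otimes>\<^bsub>B\<^esub> y)"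
    and "\<And>a b. a \<in> carrier B \<Longrightarrow> b \<in> carrier B \<Longrightarrow> P a \<Longrightarrow> P b \<Longrightarrow> P (a \<oplus>\<^bsub>B\<^esub> b)"
  shows "P \<one>\<^bsub>B\<^esub>"
proof -
  have "P a" if "a \<in> sandwich_span B e" for a
    using that by induction (auto intro: assms B.sandwich_span_closed[OF _ e_closed])
  then show ?thesis using full B.genideal_subset_sandwich_span[OF e_closed] by blast
qed

lemma corner_preimage:
  assumes "z \<in> carrier B" "e \<otimes>\<^bsub>B\<^esub> z = z" "z \<otimes>\<^bsub>B\<^esub> e = z"
  obtains q where "q \<in> carrier Q" "\<phi> q = z"
  using phi_onto[of z] assms by auto

text \<open>As e is idempotent, the elements fixed by e are exactly those of eM.\<close>

definition corner_module :: "('b, 'm) module \<Rightarrow> ('q, 'm) module"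
  where "corner_module M = \<lparr>carrier = {m \<in> carrier M. e \<odot>\<^bsub>M\<^esub> m = m}, mult = undefined, one = undefined,
    zero = \<zero>\<^bsub>M\<^esub>, add = add M, smult = (\<lambda>q m. \<phi> q \<odot>\<^bsub>M\<^esub> m)\<rparr>"

lemma corner_module_simps:
  "m \<in> carrier (corner_module M) \<longleftrightarrow> m \<in> carrier M \<and> e \<odot>\<^bsub>M\<^esub> m = m"
  "x \<oplus>\<^bsub>corner_module M\<^esub> y = x \<oplus>\<^bsub>M\<^esub> y" "q \<odot>\<^bsub>corner_module M\<^esub> x = \<phi> q \<odot>\<^bsub>M\<^esub> x"
  "\<zero>\<^bsub>corner_module M\<^esub> = \<zero>\<^bsub>M\<^esub>"
  by (simp_all add: corner_module_def)

lemma left_module_corner_module: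
  assumes "left_module B M"
  shows "left_module Q (corner_module M)"
proof -
  interpret M: left_module B M by fact
  have "abelian_group (corner_module M)"
  proof (rule abelian_groupI, unfold corner_module_simps)
    fix x assume "x \<in> carrier M \<and> e \<odot>\<^bsub>M\<^esub> x = x"
    then show "\<exists>y\<in>carrier (corner_module M). y \<oplus>\<^bsub>M\<^esub> x = \<zero>\<^bsub>M\<^esub>"
      by (intro bexI[of _ "\<ominus>\<^bsub>M\<^esub> x"]) (auto simp: corner_module_simps M.M.l_neg M.act_minus e_closed)
  qed (auto simp: M.act_add_right e_closed M.act_zero M.M.a_ac)
  moreover have "e \<odot>\<^bsub>M\<^esub> (\<phi> q \<odot>\<^bsub>M\<^esub> x) = \<phi> q \<odot>\<^bsub>M\<^esub> x" if "x \<in> carrier M" "q \<in> carrier Q" for x q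
    using that by (simp add: M.act_assoc[symmetric] phi_closed e_closed phi_e_left)
  ultimately show ?thesis
    by (intro left_module.intro left_module_axioms.intro Q.ring_axioms)
      (auto simp: corner_module_simps phi_closed phi_add phi_mult M.act_closed M.act_add_left
        M.act_add_right M.act_assoc)
qed

lemma corner_module_restrict:
  assumes M: "left_module B M" and f: "f \<in> lmod_hom B M N"
  shows "restrict f (carrier (corner_module M)) \<in> lmod_hom Q (corner_module M) (corner_module N)"
proof -
  interpret M: left_module B M by fact
  have ef: "e \<odot>\<^bsub>N\<^esub> f x = f x" if "x \<in> carrier M" "e \<odot>\<^bsub>M\<^esub> x = x" for x
    using lmod_homD(4)[OF f e_closed that(1)] that(2) by simp
  have [simp]: "e \<odot>\<^bsub>M\<^esub> (\<phi> q \<odot>\<^bsub>M\<^esub> x) = \<phi> q \<odot>\<^bsub>M\<^esub> x" if "x \<in> carrier M" "q \<in> carrier Q" for x q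
    using that by (simp add: M.act_assoc[symmetric] phi_closed e_closed phi_e_left)
  show ?thesis
    by (rule lmod_homI)
      (auto simp: corner_module_simps lmod_homD[OF f] M.act_closed M.act_add_right phi_closed e_closed ef)
qed

lemma linear_functor_corner_module:
  "linear_functor (module_category U B) (module_category U Q) corner_module
     (\<lambda>M N f. restrict f (carrier (corner_module M)))"
proof (unfold_locales, unfold module_category_simps mem_Collect_eq)
  fix M N :: "('b, 'c) module" and f and c :: 'k
  assume N: "left_module B N" and f: "f \<in> lmod_hom B M N"
  interpret N: left_module B N by fact
  have c: "c \<odot>\<^bsub>B\<^esub> \<one>\<^bsub>B\<^esub> \<in> carrier B" by (simp add: B.scalar_closed)
  \<comment> \<open>On eN a scalar c acts through the image of c 1 under \<open>\<phi>\<close>,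
    which is (c 1) e; on elements fixed by e this agrees with the action of c 1.\<close>
  have "\<phi> (c \<odot>\<^bsub>Q\<^esub> \<one>\<^bsub>Q\<^esub>) = (c \<odot>\<^bsub>B\<^esub> \<one>\<^bsub>B\<^esub>) \<otimes>\<^bsub>B\<^esub> e"
    by (simp add: phi_smult B.scalar_mult_left e_closed)
  moreover have "e \<odot>\<^bsub>N\<^esub> f x = f x" if "x \<in> carrier M" "e \<odot>\<^bsub>M\<^esub> x = x" for x
    using lmod_homD(4)[OF f e_closed that(1)] that(2) by simp
  ultimately show "restrict (\<lambda>x\<in>carrier M. (c \<odot>\<^bsub>B\<^esub> \<one>\<^bsub>B\<^esub>) \<odot>\<^bsub>N\<^esub> f x) (carrier (corner_module M)) =
    (\<lambda>x\<in>carrier (corner_module M). (c \<odot>\<^bsub>Q\<^esub> \<one>\<^bsub>Q\<^esub>) \<odot>\<^bsub>corner_module N\<^esub>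
      restrict f (carrier (corner_module M)) x)"
    by (auto simp: fun_eq_iff corner_module_simps N.act_assoc e_closed c lmod_homD[OF f])
next
  fix L M N :: "('b, 'c) module" and f g
  assume f: "f \<in> lmod_hom B L M"
  have "e \<odot>\<^bsub>M\<^esub> f x = f x" if "x \<in> carrier L" "e \<odot>\<^bsub>L\<^esub> x = x" for x
    using lmod_homD(4)[OF f e_closed that(1)] that(2) by simp
  then show "restrict (compose (carrier L) g f) (carrier (corner_module L)) =
    compose (carrier (corner_module L)) (restrict g (carrier (corner_module M)))
      (restrict f (carrier (corner_module L)))"
    by (auto simp: fun_eq_iff corner_module_simps compose_def lmod_homD[OF f])
qed (auto simp: corner_module_simps fun_eq_iff intro!: left_module_corner_module corner_module_restrict)

text \<open>Writing n = 1 n as a sum of terms x (e y n) shows that n is determined by how eB acts on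
  it.\<close>

lemma corner_separates:
  assumes N: "left_module B N" and n: "n \<in> carrier N" "n' \<in> carrier N"
    and eq: "\<And>z. z \<in> carrier B \<Longrightarrow> e \<otimes>\<^bsub>B\<^esub> z = z \<Longrightarrow> z \<odot>\<^bsub>N\<^esub> n = z \<odot>\<^bsub>N\<^esub> n'"
  shows "n = n'"
proof -
  interpret N: left_module B N by fact
  have "\<one>\<^bsub>B\<^esub> \<odot>\<^bsub>N\<^esub> n = \<one>\<^bsub>B\<^esub> \<odot>\<^bsub>N\<^esub> n'"
  proof (induction rule: full_induct)
    case (sandwich x y)
    have "(e \<otimes>\<^bsub>B\<^esub> y) \<odot>\<^bsub>N\<^esub> n = (e \<otimes>\<^bsub>B\<^esub> y) \<odot>\<^bsub>N\<^esub> n'"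
      by (rule eq) (use sandwich in \<open>simp_all add: e_closed B.m_assoc[symmetric] e_idem\<close>)
    then show ?case using sandwich n by (simp add: B.m_assoc e_closed N.act_assoc)
  qed (simp add: N.act_add_left n)
  then show ?thesis using n by (simp add: N.act_one)
qed

text \<open>For z in eB the element z m lies in eM and z f(m) = f(z m), so the values on eM
  determine f.\<close>

lemma corner_module_faithful:
  assumes M: "left_module B M" and N: "left_module B N"
  shows "inj_on (\<lambda>f. restrict f (carrier (corner_module M))) (lmod_hom B M N)"
proof (rule inj_onI)
  fix f g assume f: "f \<in> lmod_hom B M N" and g: "g \<in> lmod_hom B M N"
    and fg: "restrict f (carrier (corner_module M)) = restrict g (carrier (corner_module M))"
  interpret M: left_module B M by fact
  show "f = g"
  proof (rule lmod_hom_eqI[OF f g])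
    fix m assume m: "m \<in> carrier M"
    show "f m = g m"
    proof (rule corner_separates[OF N])
      fix z assume z: "z \<in> carrier B" "e \<otimes>\<^bsub>B\<^esub> z = z"
      have "z \<odot>\<^bsub>M\<^esub> m \<in> carrier (corner_module M)"
        using z m by (simp add: corner_module_simps M.act_closed M.act_assoc[symmetric] e_closed)
      then show "z \<odot>\<^bsub>N\<^esub> f m = z \<odot>\<^bsub>N\<^esub> g m"
        using fun_cong[OF fg, of "z \<odot>\<^bsub>M\<^esub> m"] z m by (simp add: lmod_homD[OF f] lmod_homD[OF g])
    qed (use m lmod_homD[OF f] lmod_homD[OF g] in auto)
  qed
qed

text \<open>The extension of \<open>g\<close> sends \<open>m\<close> to the only \<open>n\<close> with \<open>z n = g (z m)\<close> for all \<open>z\<close> in \<open>eB\<close>.\<close>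

lemma corner_module_full:
  assumes M: "left_module B M" and N: "left_module B N"
    and g: "g \<in> lmod_hom Q (corner_module M) (corner_module N)"
  shows "\<exists>f\<in>lmod_hom B M N. restrict f (carrier (corner_module M)) = g"
proof -
  interpret M: left_module B M by fact
  interpret N: left_module B N by fact
  let ?eB = "\<lambda>z. z \<in> carrier B \<and> e \<otimes>\<^bsub>B\<^esub> z = z"
  have eM: "z \<odot>\<^bsub>M\<^esub> m \<in> carrier M \<and> e \<odot>\<^bsub>M\<^esub> (z \<odot>\<^bsub>M\<^esub> m) = z \<odot>\<^bsub>M\<^esub> m" if "?eB z" "m \<in> carrier M" for z m
    using that by (simp add: M.act_closed M.act_assoc[symmetric] e_closed)
  have gc: "g m \<in> carrier N" "e \<odot>\<^bsub>N\<^esub> g m = g m" if "m \<in> carrier M" "e \<odot>\<^bsub>M\<^esub> m = m" for m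
    using lmod_homD(2)[OF g, of m] that by (simp_all add: corner_module_simps)
  have gadd: "g (m \<oplus>\<^bsub>M\<^esub> m') = g m \<oplus>\<^bsub>N\<^esub> g m'"
    if "m \<in> carrier M" "e \<odot>\<^bsub>M\<^esub> m = m" "m' \<in> carrier M" "e \<odot>\<^bsub>M\<^esub> m' = m'" for m m'
    using lmod_homD(3)[OF g, of m m'] that by (simp add: corner_module_simps)
  have gact: "g (z \<odot>\<^bsub>M\<^esub> m) = z \<odot>\<^bsub>N\<^esub> g m"
    if m: "m \<in> carrier M" "e \<odot>\<^bsub>M\<^esub> m = m" and z: "?eB z" "z \<otimes>\<^bsub>B\<^esub> e = z" for m z
  proof -
    obtain q where q: "q \<in> carrier Q" "\<phi> q = z" using corner_preimage[of z] z by auto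
    show ?thesis using lmod_homD(4)[OF g q(1), of m] m by (simp add: corner_module_simps q)
  qed
  have ex: "\<exists>n\<in>carrier N. \<forall>z. ?eB z \<longrightarrow> z \<odot>\<^bsub>N\<^esub> n = g (z \<odot>\<^bsub>M\<^esub> m)" if m: "m \<in> carrier M" for m
  proof -
    \<comment> \<open>The factor 1 is written out in order to be generalized: with x e y in its
      place the witness is x g(e y m), and witnesses for summands add up.\<close>
    have "\<exists>n\<in>carrier N. \<forall>z. ?eB z \<longrightarrow> z \<odot>\<^bsub>N\<^esub> n = g ((z \<otimes>\<^bsub>B\<^esub> \<one>\<^bsub>B\<^esub>) \<odot>\<^bsub>M\<^esub> m)"
    proof (induction rule: full_induct)
      case (sandwich x y)
      have ey: "?eB (e \<otimes>\<^bsub>B\<^esub> y)" using sandwich by (simp add: e_closed B.m_assoc[symmetric] e_idem)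
      let ?m = "(e \<otimes>\<^bsub>B\<^esub> y) \<odot>\<^bsub>M\<^esub> m"
      have m': "?m \<in> carrier M" "e \<odot>\<^bsub>M\<^esub> ?m = ?m" using eM[OF ey m] by auto
      show ?case
      proof (intro bexI[of _ "x \<odot>\<^bsub>N\<^esub> g ?m"] allI impI)
        fix z assume z: "?eB z"
        \<comment> \<open>Since z = e z, the element z x e lies in eBe, and g commutes with its
          action.\<close>
        have "z \<odot>\<^bsub>N\<^esub> (x \<odot>\<^bsub>N\<^esub> g ?m) = (z \<otimes>\<^bsub>B\<^esub> x \<otimes>\<^bsub>B\<^esub> e) \<odot>\<^bsub>N\<^esub> g ?m"
          using z sandwich by (simp add: N.act_assoc gc m' e_closed)
        also have "\<dots> = g ((z \<otimes>\<^bsub>B\<^esub> x \<otimes>\<^bsub>B\<^esub> e) \<odot>\<^bsub>M\<^esub> ?m)"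
          using z sandwich
          by (intro gact[symmetric] m')
            (simp_all add: e_closed B.m_assoc e_idem, simp add: e_closed B.m_assoc[symmetric])
        also have "(z \<otimes>\<^bsub>B\<^esub> x \<otimes>\<^bsub>B\<^esub> e) \<odot>\<^bsub>M\<^esub> ?m = (z \<otimes>\<^bsub>B\<^esub> (x \<otimes>\<^bsub>B\<^esub> e \<otimes>\<^bsub>B\<^esub> y)) \<odot>\<^bsub>M\<^esub> m"
          using z sandwich m m' by (simp add: e_closed B.m_assoc M.act_assoc M.act_closed)
        finally show "z \<odot>\<^bsub>N\<^esub> (x \<odot>\<^bsub>N\<^esub> g ?m) = g ((z \<otimes>\<^bsub>B\<^esub> (x \<otimes>\<^bsub>B\<^esub> e \<otimes>\<^bsub>B\<^esub> y)) \<odot>\<^bsub>M\<^esub> m)" .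
      qed (use sandwich m' in \<open>simp add: N.act_closed gc\<close>)
    next
      case (sum a b)
      obtain n n' where n: "n \<in> carrier N" "\<And>z. ?eB z \<Longrightarrow> z \<odot>\<^bsub>N\<^esub> n = g ((z \<otimes>\<^bsub>B\<^esub> a) \<odot>\<^bsub>M\<^esub> m)"
        and n': "n' \<in> carrier N" "\<And>z. ?eB z \<Longrightarrow> z \<odot>\<^bsub>N\<^esub> n' = g ((z \<otimes>\<^bsub>B\<^esub> b) \<odot>\<^bsub>M\<^esub> m)"
        using sum by blast
      have "z \<odot>\<^bsub>N\<^esub> (n \<oplus>\<^bsub>N\<^esub> n') = g ((z \<otimes>\<^bsub>B\<^esub> (a \<oplus>\<^bsub>B\<^esub> b)) \<odot>\<^bsub>M\<^esub> m)" if z: "?eB z" for z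
      proof -
        have "?eB (z \<otimes>\<^bsub>B\<^esub> a)" "?eB (z \<otimes>\<^bsub>B\<^esub> b)"
          using z sum(1,2) by (simp_all add: B.m_assoc[symmetric] e_closed)
        from this[THEN eM[OF _ m]] show ?thesis
          using z sum(1,2) m by (simp add: N.act_add_right n n' gadd[symmetric] B.r_distr M.act_add_left)
      qed
      then show ?case using n(1) n'(1) by (intro bexI[of _ "n \<oplus>\<^bsub>N\<^esub> n'"]) auto
    qed
    then show ?thesis using e_closed by auto
  qed
  \<comment> \<open>The chosen element is unique by \<open>corner_separates\<close>; hence all
    identities for f are tested by elements z of eB.\<close>
  define f where "f = (\<lambda>m\<in>carrier M. SOME n. n \<in> carrier N \<and> (\<forall>z. ?eB z \<longrightarrow> z \<odot>\<^bsub>N\<^esub> n = g (z \<odot>\<^bsub>M\<^esub> m)))"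
  have f: "f m \<in> carrier N" "\<And>z. ?eB z \<Longrightarrow> z \<odot>\<^bsub>N\<^esub> f m = g (z \<odot>\<^bsub>M\<^esub> m)" if m: "m \<in> carrier M" for m
  proof -
    have "\<exists>n. n \<in> carrier N \<and> (\<forall>z. ?eB z \<longrightarrow> z \<odot>\<^bsub>N\<^esub> n = g (z \<odot>\<^bsub>M\<^esub> m))" using ex[OF m] by blast
    then have "f m \<in> carrier N \<and> (\<forall>z. ?eB z \<longrightarrow> z \<odot>\<^bsub>N\<^esub> f m = g (z \<odot>\<^bsub>M\<^esub> m))"
      unfolding f_def using m by (simp only: restrict_apply if_True) (rule someI_ex)
    then show "f m \<in> carrier N" "\<And>z. ?eB z \<Longrightarrow> z \<odot>\<^bsub>N\<^esub> f m = g (z \<odot>\<^bsub>M\<^esub> m)" by auto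
  qed
  have "f \<in> lmod_hom B M N"
  proof (rule lmod_homI)
    show "f \<in> extensional (carrier M)" by (simp add: f_def)
  next
    fix x y assume x: "x \<in> carrier M" and y: "y \<in> carrier M"
    show "f (x \<oplus>\<^bsub>M\<^esub> y) = f x \<oplus>\<^bsub>N\<^esub> f y"
    proof (rule corner_separates[OF N])
      fix z assume z: "z \<in> carrier B" "e \<otimes>\<^bsub>B\<^esub> z = z"
      then show "z \<odot>\<^bsub>N\<^esub> f (x \<oplus>\<^bsub>M\<^esub> y) = z \<odot>\<^bsub>N\<^esub> (f x \<oplus>\<^bsub>N\<^esub> f y)"
        using eM[OF _ x, of z] eM[OF _ y, of z] x y
        by (simp add: f N.act_add_right M.act_add_right gadd)
    qed (use x y in \<open>simp_all add: f\<close>)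
  next
    fix b x assume b: "b \<in> carrier B" and x: "x \<in> carrier M"
    show "f (b \<odot>\<^bsub>M\<^esub> x) = b \<odot>\<^bsub>N\<^esub> f x"
    proof (rule corner_separates[OF N])
      fix z assume z: "z \<in> carrier B" "e \<otimes>\<^bsub>B\<^esub> z = z"
      then have "?eB (z \<otimes>\<^bsub>B\<^esub> b)" using b by (simp add: B.m_assoc[symmetric] e_closed)
      from f(2)[OF x this] show "z \<odot>\<^bsub>N\<^esub> f (b \<odot>\<^bsub>M\<^esub> x) = z \<odot>\<^bsub>N\<^esub> (b \<odot>\<^bsub>N\<^esub> f x)"
        using z b x by (simp add: f M.act_closed N.act_assoc M.act_assoc)
    qed (use b x in \<open>simp_all add: f M.act_closed N.act_closed\<close>)
  qed (simp add: f)
  moreover have "restrict f (carrier (corner_module M)) = g"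
  proof
    fix m
    show "restrict f (carrier (corner_module M)) m = g m"
    proof (cases "m \<in> carrier (corner_module M)")
      case False
      then show ?thesis using lmod_homD(1)[OF g] by (auto simp: extensional_def)
    next
      case True
      then have m: "m \<in> carrier M" "e \<odot>\<^bsub>M\<^esub> m = m" by (simp_all add: corner_module_simps)
      have "f m = g m"
      proof (rule corner_separates[OF N])
        fix z assume z: "z \<in> carrier B" "e \<otimes>\<^bsub>B\<^esub> z = z"
        \<comment> \<open>As g m is fixed by e, z may be replaced by z e, which lies in eBe and
          therefore commutes with g.\<close>
        have "z \<odot>\<^bsub>N\<^esub> g m = (z \<otimes>\<^bsub>B\<^esub> e) \<odot>\<^bsub>N\<^esub> g m" using z m by (simp add: N.act_assoc gc e_closed)
        also have "\<dots> = g ((z \<otimes>\<^bsub>B\<^esub> e) \<odot>\<^bsub>M\<^esub> m)"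
          by (rule gact[symmetric]) (use m z in \<open>simp_all add: e_closed B.m_assoc e_idem, simp add: e_closed B.m_assoc[symmetric]\<close>)
        also have "\<dots> = z \<odot>\<^bsub>N\<^esub> f m" using m z by (simp add: f M.act_assoc e_closed)
        finally show "z \<odot>\<^bsub>N\<^esub> f m = z \<odot>\<^bsub>N\<^esub> g m" ..
      qed (use m f gc in auto)
      with True show ?thesis by simp
    qed
  qed
  ultimately show ?thesis by blast
qed

section \<open>The quasi-inverse on objects: homomorphisms from eB\<close>

abbreviation eB where "eB \<equiv> corner_module (ideal_module B (carrier B))"

lemma eB_simps:
  "z \<in> carrier eB \<longleftrightarrow> z \<in> carrier B \<and> e \<otimes>\<^bsub>B\<^esub> z = z"
  "x \<oplus>\<^bsub>eB\<^esub> y = x \<oplus>\<^bsub>B\<^esub> y" "q \<odot>\<^bsub>eB\<^esub> x = \<phi> q \<otimes>\<^bsub>B\<^esub> x"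
  by (simp_all add: corner_module_simps ideal_module_def)

lemma eB_closed:
  "x \<in> carrier eB \<Longrightarrow> y \<in> carrier eB \<Longrightarrow> x \<oplus>\<^bsub>B\<^esub> y \<in> carrier eB"
  "x \<in> carrier eB \<Longrightarrow> b \<in> carrier B \<Longrightarrow> x \<otimes>\<^bsub>B\<^esub> b \<in> carrier eB"
  "q \<in> carrier Q \<Longrightarrow> x \<in> carrier eB \<Longrightarrow> \<phi> q \<otimes>\<^bsub>B\<^esub> x \<in> carrier eB"
  "e \<in> carrier eB"
  by (auto simp: eB_simps B.r_distr e_closed B.m_assoc[symmetric] phi_closed phi_e_left e_idem)

text \<open>Hom over eBe from eB to N, which is the right adjoint of the corner functor. Right
  multiplication of B on eB becomes a left action on functions: (b h)(z) = h(z b).\<close>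

definition coinduced :: "('q, 'n) module \<Rightarrow> ('b, 'b \<Rightarrow> 'n) module"
  where "coinduced N = \<lparr>carrier = lmod_hom Q eB N, mult = undefined, one = undefined,
    zero = (\<lambda>z\<in>carrier eB. \<zero>\<^bsub>N\<^esub>), add = (\<lambda>h h'. \<lambda>z\<in>carrier eB. h z \<oplus>\<^bsub>N\<^esub> h' z),
    smult = (\<lambda>b h. \<lambda>z\<in>carrier eB. h (z \<otimes>\<^bsub>B\<^esub> b))\<rparr>"

lemma coinduced_simps:
  "carrier (coinduced N) = lmod_hom Q eB N"
  "h \<oplus>\<^bsub>coinduced N\<^esub> h' = (\<lambda>z\<in>carrier eB. h z \<oplus>\<^bsub>N\<^esub> h' z)"
  "b \<odot>\<^bsub>coinduced N\<^esub> h = (\<lambda>z\<in>carrier eB. h (z \<otimes>\<^bsub>B\<^esub> b))"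
  "\<zero>\<^bsub>coinduced N\<^esub> = (\<lambda>z\<in>carrier eB. \<zero>\<^bsub>N\<^esub>)"
  by (simp_all add: coinduced_def)

lemma hom_eBD:
  assumes "h \<in> lmod_hom Q eB N"
  shows "x \<in> carrier eB \<Longrightarrow> h x \<in> carrier N"
    and "x \<in> carrier eB \<Longrightarrow> y \<in> carrier eB \<Longrightarrow> h (x \<oplus>\<^bsub>B\<^esub> y) = h x \<oplus>\<^bsub>N\<^esub> h y"
    and "q \<in> carrier Q \<Longrightarrow> x \<in> carrier eB \<Longrightarrow> h (\<phi> q \<otimes>\<^bsub>B\<^esub> x) = q \<odot>\<^bsub>N\<^esub> h x"
  using lmod_homD(2-4)[OF assms] by (auto simp: eB_simps(2,3))

lemma hom_eBI:
  assumes "h \<in> extensional (carrier eB)"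
    and "\<And>x. x \<in> carrier eB \<Longrightarrow> h x \<in> carrier N"
    and "\<And>x y. x \<in> carrier eB \<Longrightarrow> y \<in> carrier eB \<Longrightarrow> h (x \<oplus>\<^bsub>B\<^esub> y) = h x \<oplus>\<^bsub>N\<^esub> h y"
    and "\<And>q x. q \<in> carrier Q \<Longrightarrow> x \<in> carrier eB \<Longrightarrow> h (\<phi> q \<otimes>\<^bsub>B\<^esub> x) = q \<odot>\<^bsub>N\<^esub> h x"
  shows "h \<in> lmod_hom Q eB N"
  using assms by (intro lmod_homI) (auto simp: eB_simps(2,3))

lemma coinduced_act_closed:
  assumes "h \<in> lmod_hom Q eB N" "b \<in> carrier B"
  shows "b \<odot>\<^bsub>coinduced N\<^esub> h \<in> lmod_hom Q eB N"
proof -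
  have c: "x \<in> carrier B" if "x \<in> carrier eB" for x using that by (simp add: eB_simps)
  show ?thesis unfolding coinduced_simps
    by (rule hom_eBI) (simp_all add: hom_eBD[OF assms(1)] eB_closed assms(2) c B.l_distr B.m_assoc phi_closed)
qed

lemma left_module_coinduced:
  assumes "left_module Q N"
  shows "left_module B (coinduced N)"
proof -
  interpret N: left_module Q N by fact
  have c: "x \<in> carrier B" "e \<otimes>\<^bsub>B\<^esub> x = x" if "x \<in> carrier eB" for x using that by (simp_all add: eB_simps)
  have "abelian_group (coinduced N)"
  proof (rule abelian_groupI, unfold coinduced_simps)
    show "(\<lambda>z\<in>carrier eB. \<zero>\<^bsub>N\<^esub>) \<in> lmod_hom Q eB N"
      by (rule hom_eBI) (simp_all add: eB_closed N.act_zero)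
  next
    fix f g assume f: "f \<in> lmod_hom Q eB N" and g: "g \<in> lmod_hom Q eB N"
    note f' = hom_eBD[OF f] and g' = hom_eBD[OF g]
    show "(\<lambda>z\<in>carrier eB. f z \<oplus>\<^bsub>N\<^esub> g z) \<in> lmod_hom Q eB N"
      by (rule hom_eBI) (simp_all add: f' g' eB_closed N.act_add_right N.M.a_ac)
    show "(\<lambda>z\<in>carrier eB. f z \<oplus>\<^bsub>N\<^esub> g z) = (\<lambda>z\<in>carrier eB. g z \<oplus>\<^bsub>N\<^esub> f z)"
      by (auto simp: fun_eq_iff f' g' N.M.a_ac)
    fix h assume "h \<in> lmod_hom Q eB N"
    note h' = hom_eBD[OF this]
    show "(\<lambda>z\<in>carrier eB. (\<lambda>z\<in>carrier eB. f z \<oplus>\<^bsub>N\<^esub> g z) z \<oplus>\<^bsub>N\<^esub> h z) =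
       (\<lambda>z\<in>carrier eB. f z \<oplus>\<^bsub>N\<^esub> (\<lambda>z\<in>carrier eB. g z \<oplus>\<^bsub>N\<^esub> h z) z)"
      by (auto simp: fun_eq_iff f' g' h' N.M.a_ac)
  next
    fix f assume f: "f \<in> lmod_hom Q eB N"
    note f' = hom_eBD[OF f]
    show "(\<lambda>z\<in>carrier eB. (\<lambda>z\<in>carrier eB. \<zero>\<^bsub>N\<^esub>) z \<oplus>\<^bsub>N\<^esub> f z) = f"
      using lmod_homD(1)[OF f] by (auto simp: fun_eq_iff f' extensional_def)
    have "(\<lambda>z\<in>carrier eB. \<ominus>\<^bsub>N\<^esub> f z) \<in> lmod_hom Q eB N"
      by (rule hom_eBI) (simp_all add: f' eB_closed N.act_minus N.M.minus_add)
    then show "\<exists>g\<in>lmod_hom Q eB N. (\<lambda>z\<in>carrier eB. g z \<oplus>\<^bsub>N\<^esub> f z) = (\<lambda>z\<in>carrier eB. \<zero>\<^bsub>N\<^esub>)"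
      by (rule bexI[rotated]) (auto simp: fun_eq_iff f' N.M.l_neg)
  qed
  moreover have "\<one>\<^bsub>B\<^esub> \<odot>\<^bsub>coinduced N\<^esub> h = h" if h: "h \<in> lmod_hom Q eB N" for h
    using lmod_homD(1)[OF h] by (auto simp: coinduced_simps fun_eq_iff c extensional_def)
  ultimately show ?thesis
    by (intro left_module.intro left_module_axioms.intro B.ring_axioms)
      (auto simp: coinduced_act_closed coinduced_simps(1),
        auto simp: coinduced_simps fun_eq_iff eB_closed hom_eBD B.r_distr c B.m_assoc)
qed

text \<open>If h is fixed by e then h(z) = h(z e), and z e lies in eBe, so h(z) = (z e) h(e):
  evaluation at e loses nothing. Conversely every n in N defines such an h.\<close>

lemma coinduced_corner:
  assumes "left_module Q N"
  shows "(\<lambda>h\<in>carrier (corner_module (coinduced N)). h e) \<in> lmod_hom Q (corner_module (coinduced N)) N"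
      (is "?f \<in> _")
    and "bij_betw (\<lambda>h\<in>carrier (corner_module (coinduced N)). h e)
      (carrier (corner_module (coinduced N))) (carrier N)"
proof -
  interpret N: left_module Q N by fact
  interpret L: left_module Q "corner_module (coinduced N)"
    by (intro left_module_corner_module left_module_coinduced assms)
  have eBe: "\<exists>q\<in>carrier Q. \<phi> q = z \<otimes>\<^bsub>B\<^esub> e" if "z \<in> carrier eB" for z
    using phi_onto[of z] that by (auto simp: eB_simps)
  have hz: "h z = q \<odot>\<^bsub>N\<^esub> h e"
    if h: "h \<in> carrier (corner_module (coinduced N))" and z: "z \<in> carrier eB"
      and q: "q \<in> carrier Q" "\<phi> q = z \<otimes>\<^bsub>B\<^esub> e" for h z q
  proof -
    have h1: "h \<in> lmod_hom Q eB N" and h2: "e \<odot>\<^bsub>coinduced N\<^esub> h = h"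
      using h by (auto simp: corner_module_simps coinduced_simps)
    have "h z = h (z \<otimes>\<^bsub>B\<^esub> e)" using z fun_cong[OF h2, of z] by (simp add: coinduced_simps)
    also have "z \<otimes>\<^bsub>B\<^esub> e = \<phi> q \<otimes>\<^bsub>B\<^esub> e" using phi_e_right[OF q(1)] q(2) by simp
    finally show ?thesis using hom_eBD(3)[OF h1 q(1) eB_closed(4)] by simp
  qed
  show "?f \<in> lmod_hom Q (corner_module (coinduced N)) N"
  proof (rule lmod_homI)
    fix h h' assume *: "h \<in> carrier (corner_module (coinduced N))" "h' \<in> carrier (corner_module (coinduced N))"
    then show "?f (h \<oplus>\<^bsub>corner_module (coinduced N)\<^esub> h') = ?f h \<oplus>\<^bsub>N\<^esub> ?f h'"
      using L.M.a_closed[OF *] by (simp add: corner_module_simps(2) coinduced_simps eB_closed)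
  next
    fix q h assume q: "q \<in> carrier Q" and h: "h \<in> carrier (corner_module (coinduced N))"
    have "h (\<phi> q) = q \<odot>\<^bsub>N\<^esub> h e"
      by (rule hz[OF h _ q]) (simp_all add: q eB_simps phi_e_left phi_e_right phi_closed)
    then show "?f (q \<odot>\<^bsub>corner_module (coinduced N)\<^esub> h) = q \<odot>\<^bsub>N\<^esub> ?f h"
      using L.act_closed[OF q h] h
      by (simp add: corner_module_simps(3) coinduced_simps eB_closed phi_e_left q)
  qed (auto simp: corner_module_simps coinduced_simps intro: hom_eBD(1)[OF _ eB_closed(4)])
  show "bij_betw ?f (carrier (corner_module (coinduced N))) (carrier N)"
  proof (rule bij_betw_imageI)
    show "inj_on ?f (carrier (corner_module (coinduced N)))"
    proof (rule inj_onI)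
      fix h h' assume h: "h \<in> carrier (corner_module (coinduced N))"
        and h': "h' \<in> carrier (corner_module (coinduced N))" and "?f h = ?f h'"
      then have "h e = h' e" by simp
      then have "h z = h' z" if z: "z \<in> carrier eB" for z
        using eBe[OF z] hz[OF h z] hz[OF h' z] by auto
      with h h' show "h = h'"
        by (auto simp: corner_module_simps coinduced_simps(1) intro: lmod_hom_eqI)
    qed
    show "?f ` carrier (corner_module (coinduced N)) = carrier N"
    proof (intro equalityI subsetI)
      fix n assume n: "n \<in> carrier N"
      \<comment> \<open>\<open>\<psi> z\<close> is z e read as an element of Q; the homomorphism
        with value n at e is z |-> \<open>\<psi> z\<close> n.\<close>
      define \<psi> where "\<psi> z = inv_into (carrier Q) \<phi> (z \<otimes>\<^bsub>B\<^esub> e)" for z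
      have \<psi>: "\<psi> z \<in> carrier Q" "\<phi> (\<psi> z) = z \<otimes>\<^bsub>B\<^esub> e" if z: "z \<in> carrier eB" for z
        using eBe[OF z] unfolding \<psi>_def by (metis image_eqI inv_into_into, metis image_eqI f_inv_into_f)
      have \<psi>I: "\<psi> z = q" if "q \<in> carrier Q" "z \<otimes>\<^bsub>B\<^esub> e = \<phi> q" for q z
        using that phi_inj by (simp add: \<psi>_def)
      define h where "h = (\<lambda>z\<in>carrier eB. \<psi> z \<odot>\<^bsub>N\<^esub> n)"
      have c: "x \<in> carrier B" if "x \<in> carrier eB" for x using that by (simp add: eB_simps)
      have \<psi>a: "\<psi> (x \<oplus>\<^bsub>B\<^esub> y) = \<psi> x \<oplus>\<^bsub>Q\<^esub> \<psi> y" if "x \<in> carrier eB" "y \<in> carrier eB" for x y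
        by (rule \<psi>I) (use that in \<open>simp_all add: \<psi> phi_add B.l_distr e_closed c\<close>)
      have \<psi>m: "\<psi> (\<phi> q \<otimes>\<^bsub>B\<^esub> x) = q \<otimes>\<^bsub>Q\<^esub> \<psi> x" if "x \<in> carrier eB" "q \<in> carrier Q" for x q
        by (rule \<psi>I) (use that in \<open>simp_all add: \<psi> phi_mult B.m_assoc e_closed phi_closed c\<close>)
      have \<psi>e: "\<psi> e = \<one>\<^bsub>Q\<^esub>" by (rule \<psi>I) (simp_all add: e_idem)
      have \<psi>ze: "\<psi> (z \<otimes>\<^bsub>B\<^esub> e) = \<psi> z" if "z \<in> carrier eB" for z
        by (rule \<psi>I) (use that in \<open>simp_all add: \<psi> phi_e_right B.m_assoc e_closed e_idem c\<close>)
      have h: "h \<in> lmod_hom Q eB N" unfolding h_def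
        by (rule hom_eBI) (simp_all add: \<psi> \<psi>a \<psi>m eB_closed n N.act_closed N.act_add_left N.act_assoc)
      moreover have "e \<odot>\<^bsub>coinduced N\<^esub> h = h"
        by (auto simp: coinduced_simps h_def fun_eq_iff eB_closed e_closed \<psi>ze)
      ultimately have hc: "h \<in> carrier (corner_module (coinduced N))"
        by (simp add: corner_module_simps coinduced_simps(1))
      have "n = ?f h" using hc n by (simp add: h_def eB_closed \<psi>e N.act_one)
      then show "n \<in> ?f ` carrier (corner_module (coinduced N))" using hc by (rule image_eqI)
    qed (auto simp: corner_module_simps coinduced_simps intro: hom_eBD(1)[OF _ eB_closed(4)])
  qed
qed

text \<open>Since \<open>BeB = B\<close>, the left \<open>eBe\<close>-module \<open>eB\<close> is finitely generated.\<close>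

lemma hom_eB_determined:
  "\<exists>Y. finite Y \<and> Y \<subseteq> carrier eB \<and> (\<forall>(N :: ('q, 'n) module) h h'. h \<in> lmod_hom Q eB N \<longrightarrow>
    h' \<in> lmod_hom Q eB N \<longrightarrow> (\<forall>y\<in>Y. h y = h' y) \<longrightarrow> h = h')"
proof -
  have c: "x \<in> carrier B" "e \<otimes>\<^bsub>B\<^esub> x = x" if "x \<in> carrier eB" for x using that by (simp_all add: eB_simps)
  \<comment> \<open>\<open>D Y a\<close> means that homomorphisms agreeing on Y agree at z a for all
    z in eB. For a = x e y the single generator e y suffices, since z x e y is z x e from eBe times
    e y; for a sum, the two sets are united. The case a = 1 is the claim.\<close>
  define D where "D Y a \<longleftrightarrow> (\<forall>(N :: ('q, 'n) module) h h' z. h \<in> lmod_hom Q eB N \<longrightarrow>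
    h' \<in> lmod_hom Q eB N \<longrightarrow> (\<forall>y\<in>Y. h y = h' y) \<longrightarrow> z \<in> carrier eB \<longrightarrow>
    h (z \<otimes>\<^bsub>B\<^esub> a) = h' (z \<otimes>\<^bsub>B\<^esub> a))" for Y a
  have D: "h (z \<otimes>\<^bsub>B\<^esub> a) = h' (z \<otimes>\<^bsub>B\<^esub> a)" if "D Y a" "h \<in> lmod_hom Q eB N"
    "h' \<in> lmod_hom Q eB N" "\<forall>y\<in>Y. h y = h' y" "z \<in> carrier eB" for Y a and N :: "('q, 'n) module" and h h' z
    using that unfolding D_def by blast
  have "\<exists>Y. finite Y \<and> Y \<subseteq> carrier eB \<and> D Y \<one>\<^bsub>B\<^esub>"
  proof (induction rule: full_induct)
    case (sandwich x y)
    have ey: "e \<otimes>\<^bsub>B\<^esub> y \<in> carrier eB" using sandwich by (simp add: eB_closed)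
    have "h (z \<otimes>\<^bsub>B\<^esub> (x \<otimes>\<^bsub>B\<^esub> e \<otimes>\<^bsub>B\<^esub> y)) = h' (z \<otimes>\<^bsub>B\<^esub> (x \<otimes>\<^bsub>B\<^esub> e \<otimes>\<^bsub>B\<^esub> y))"
      if h: "h \<in> lmod_hom Q eB N" "h' \<in> lmod_hom Q eB N" and eq: "h (e \<otimes>\<^bsub>B\<^esub> y) = h' (e \<otimes>\<^bsub>B\<^esub> y)"
        and z: "z \<in> carrier eB" for N :: "('q, 'n) module" and h h' z
    proof -
      obtain q where q: "q \<in> carrier Q" "\<phi> q = z \<otimes>\<^bsub>B\<^esub> x \<otimes>\<^bsub>B\<^esub> e"
        by (rule corner_preimage[of "z \<otimes>\<^bsub>B\<^esub> x \<otimes>\<^bsub>B\<^esub> e"])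
          (use z sandwich e_closed c[OF eB_closed(2)[OF eB_closed(2)[OF z]]] in \<open>auto simp: c B.m_assoc e_idem\<close>)
      have "e \<otimes>\<^bsub>B\<^esub> (e \<otimes>\<^bsub>B\<^esub> y) = e \<otimes>\<^bsub>B\<^esub> y" using ey by (simp add: eB_simps)
      then have "z \<otimes>\<^bsub>B\<^esub> (x \<otimes>\<^bsub>B\<^esub> e \<otimes>\<^bsub>B\<^esub> y) = \<phi> q \<otimes>\<^bsub>B\<^esub> (e \<otimes>\<^bsub>B\<^esub> y)"
        unfolding q(2) using c(1)[OF z] sandwich e_closed by (simp add: B.m_assoc)
      then show ?thesis using hom_eBD(3)[OF h(1) q(1) ey] hom_eBD(3)[OF h(2) q(1) ey] eq by simp
    qed
    then have "D {e \<otimes>\<^bsub>B\<^esub> y} (x \<otimes>\<^bsub>B\<^esub> e \<otimes>\<^bsub>B\<^esub> y)" unfolding D_def by blast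
    with ey show ?case by blast
  next
    case (sum a b)
    then obtain Y Y' where Y: "finite Y" "Y \<subseteq> carrier eB" "D Y a"
      and Y': "finite Y'" "Y' \<subseteq> carrier eB" "D Y' b"
      by (elim exE conjE)
    have "D (Y \<union> Y') (a \<oplus>\<^bsub>B\<^esub> b)" unfolding D_def
    proof (intro allI impI)
      fix N :: "('q, 'n) module" and h h' z
      assume h: "h \<in> lmod_hom Q eB N" "h' \<in> lmod_hom Q eB N" and eq: "\<forall>y\<in>Y \<union> Y'. h y = h' y"
        and z: "z \<in> carrier eB"
      have "h (z \<otimes>\<^bsub>B\<^esub> a) = h' (z \<otimes>\<^bsub>B\<^esub> a)" "h (z \<otimes>\<^bsub>B\<^esub> b) = h' (z \<otimes>\<^bsub>B\<^esub> b)"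
        using D[OF Y(3) h _ z] D[OF Y'(3) h _ z] eq by auto
      then show "h (z \<otimes>\<^bsub>B\<^esub> (a \<oplus>\<^bsub>B\<^esub> b)) = h' (z \<otimes>\<^bsub>B\<^esub> (a \<oplus>\<^bsub>B\<^esub> b))"
        using z sum(1,2) hom_eBD(2)[OF h(1) eB_closed(2)[OF z sum(1)] eB_closed(2)[OF z sum(2)]]
          hom_eBD(2)[OF h(2) eB_closed(2)[OF z sum(1)] eB_closed(2)[OF z sum(2)]]
        by (simp add: B.r_distr c)
    qed
    with Y(1,2) Y'(1,2) show ?case by (intro exI[of _ "Y \<union> Y'"]) auto
  qed
  then obtain Y where Y: "finite Y" "Y \<subseteq> carrier eB" "D Y \<one>\<^bsub>B\<^esub>" by blast
  have "h = h'" if h: "h \<in> lmod_hom Q eB N" "h' \<in> lmod_hom Q eB N" "\<forall>y\<in>Y. h y = h' y"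
    for N :: "('q, 'n) module" and h h'
    by (rule lmod_hom_eqI[OF h(1,2)]) (use D[OF Y(3) h] in \<open>simp add: c\<close>)
  with Y(1,2) show ?thesis by blast
qed

text \<open>A homomorphism is recovered from its restriction to a finite generating set Y, and
  functions from Y to \<open>'u\<close> embed into \<open>'u\<close>.\<close>

lemma coinduced_embedding:
  assumes "infinite (UNIV :: 'u set)"
  obtains j :: "('b \<Rightarrow> 'u) \<Rightarrow> 'u" where "inj_on j (carrier (coinduced N))"
proof -
  obtain Y where Y: "finite Y" "Y \<subseteq> carrier eB"
    "\<And>(N :: ('q, 'u) module) h h'. h \<in> lmod_hom Q eB N \<Longrightarrow> h' \<in> lmod_hom Q eB N \<Longrightarrow>
      (\<forall>y\<in>Y. h y = h' y) \<Longrightarrow> h = h'"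
    using hom_eB_determined[where 'n = 'u] by auto
  obtain k :: "('b \<Rightarrow> 'u) \<Rightarrow> 'u" where k: "inj_on k (\<Pi>\<^sub>E y\<in>Y. UNIV)"
    using finite_PiE_lepoll_infinite[OF Y(1) assms] unfolding lepoll_def by blast
  have "inj_on (\<lambda>h. k (restrict h Y)) (carrier (coinduced N))"
  proof (rule inj_onI)
    fix h h' assume h: "h \<in> carrier (coinduced N)" "h' \<in> carrier (coinduced N)"
      and "k (restrict h Y) = k (restrict h' Y)"
    then have "restrict h Y = restrict h' Y" using inj_onD[OF k] by auto
    then have "h y = h' y" if "y \<in> Y" for y using that by (metis restrict_apply')
    then show "h = h'" using h Y(3) by (auto simp: coinduced_simps)
  qed
  then show ?thesis by (rule that)
qed

text \<open>What remains is essential surjectivity: N is isomorphic to eM, where M is a copy of the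
  coinduced module with elements in \<open>'u\<close>.\<close>

theorem morita_equivalent_full_corner:
  assumes inf: "infinite (UNIV :: 'u set)"
  shows "morita_equivalent TYPE('u) B Q"
  unfolding morita_equivalent_def
proof (rule linearly_equivalentI[OF linear_category_module_category linear_category_module_category
      linear_functor_corner_module])
  show "unital_algebra B" "unital_algebra Q" by unfold_locales
next
  fix N :: "('q, 'u) module" assume "N \<in> Obj (module_category TYPE('u) Q)"
  then have N: "left_module Q N" by (simp add: module_category_simps)
  then have C: "left_module B (coinduced N)" by (rule left_module_coinduced)
  interpret C: left_module B "coinduced N" by fact
  interpret eC: left_module Q "corner_module (coinduced N)" by (rule left_module_corner_module) fact
  obtain j :: "('b \<Rightarrow> 'u) \<Rightarrow> 'u" where j: "inj_on j (carrier (coinduced N))"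
    using coinduced_embedding[OF inf] .
  obtain M :: "('b, 'u) module" where M: "left_module B M" "carrier M = j ` carrier (coinduced N)"
    and Madd: "\<And>x y. x \<in> carrier (coinduced N) \<Longrightarrow> y \<in> carrier (coinduced N) \<Longrightarrow>
      j x \<oplus>\<^bsub>M\<^esub> j y = j (x \<oplus>\<^bsub>coinduced N\<^esub> y)"
    and Mact: "\<And>a x. a \<in> carrier B \<Longrightarrow> x \<in> carrier (coinduced N) \<Longrightarrow>
      a \<odot>\<^bsub>M\<^esub> j x = j (a \<odot>\<^bsub>coinduced N\<^esub> x)"
    using left_module_transport[OF C j] by metis
  let ?K = "carrier (corner_module (coinduced N))"
  have Kc: "x \<in> carrier (coinduced N)" if "x \<in> ?K" for x using that by (simp add: corner_module_simps)
  have jinj: "inj_on j ?K" by (rule inj_on_subset[OF j]) (use Kc in blast)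
  \<comment> \<open>The corner of the copy is the copy of the corner: in e m = m the injection
    \<open>j\<close> can be cancelled.\<close>
  have Mc: "carrier (corner_module M) = j ` ?K"
    using inj_onD[OF j] by (auto simp: corner_module_simps M(2) Mact e_closed C.act_closed)
  define i where "i = inv_into ?K j"
  have i: "i (j x) = x" if "x \<in> ?K" for x using that jinj by (simp add: i_def)
  have ibij: "bij_betw i (carrier (corner_module M)) ?K"
    unfolding Mc i_def by (rule inj_on_imp_bij_betw[OF jinj, THEN bij_betw_inv_into])
  let ?f = "\<lambda>h\<in>?K. h e"
  note f = coinduced_corner[OF N]
  \<comment> \<open>Undo the transport along \<open>j\<close>, then evaluate at e.\<close>
  define f' where "f' = (\<lambda>u\<in>carrier (corner_module M). ?f (i u))"
  have f'j: "f' (j x) = x e" if "x \<in> ?K" for x using that by (simp add: f'_def Mc i)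
  have "f' \<in> lmod_hom Q (corner_module M) N"
  proof (rule lmod_homI)
    fix u v assume "u \<in> carrier (corner_module M)" "v \<in> carrier (corner_module M)"
    then obtain x y where xy: "x \<in> ?K" "y \<in> ?K" "u = j x" "v = j y" unfolding Mc by blast
    have "u \<oplus>\<^bsub>corner_module M\<^esub> v = j (x \<oplus>\<^bsub>corner_module (coinduced N)\<^esub> y)"
      by (simp add: xy corner_module_simps(2) Madd Kc)
    then show "f' (u \<oplus>\<^bsub>corner_module M\<^esub> v) = f' u \<oplus>\<^bsub>N\<^esub> f' v"
      using eC.M.a_closed[OF xy(1,2)] xy lmod_homD(3)[OF f(1) xy(1,2)] by (simp add: f'j)
  next
    fix q u assume q: "q \<in> carrier Q" and "u \<in> carrier (corner_module M)"
    then obtain x where x: "x \<in> ?K" "u = j x" unfolding Mc by blast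
    have "q \<odot>\<^bsub>corner_module M\<^esub> u = j (q \<odot>\<^bsub>corner_module (coinduced N)\<^esub> x)"
      by (simp add: x corner_module_simps(3) Mact Kc phi_closed q)
    then show "f' (q \<odot>\<^bsub>corner_module M\<^esub> u) = q \<odot>\<^bsub>N\<^esub> f' u"
      using eC.act_closed[OF q x(1)] x lmod_homD(4)[OF f(1) q x(1)] by (simp add: f'j)
  next
    fix u assume "u \<in> carrier (corner_module M)"
    then show "f' u \<in> carrier N" using bij_betwE[OF ibij] lmod_homD(2)[OF f(1)] by (auto simp: f'_def)
  qed (simp add: f'_def)
  moreover have "bij_betw f' (carrier (corner_module M)) (carrier N)"
    using bij_betw_trans[OF ibij f(2)]
    by (rule bij_betw_cong[THEN iffD1, rotated]) (simp add: f'_def)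
  ultimately have "isomorphism (module_category TYPE('u) Q) (corner_module M) N f'"
    by (intro isomorphism_module_categoryI left_module_corner_module M)
  then show "\<exists>M\<in>Obj (module_category TYPE('u) B).
      \<exists>f. isomorphism (module_category TYPE('u) Q) (corner_module M) N f"
    using M(1) by (auto simp: module_category_simps)
qed (use corner_module_faithful corner_module_full in \<open>auto simp: module_category_simps\<close>)

end

section \<open>Dual bases, and projectivity of B^+ on both sides\<close>

section \<open>Well-tempered elements\<close>

context left_module
begin

lemma act_finsum:
  assumes "a \<in> carrier R" "finite I" "g \<in> I \<rightarrow> carrier M"
  shows "a \<odot>\<^bsub>M\<^esub> (\<Oplus>\<^bsub>M\<^esub>i\<in>I. g i) = (\<Oplus>\<^bsub>M\<^esub>i\<in>I. a \<odot>\<^bsub>M\<^esub> g i)"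
  using assms(2,3)
proof (induction I)
  case (insert i I)
  then have g: "g i \<in> carrier M" "g \<in> I \<rightarrow> carrier M" by auto
  then have "(\<lambda>i. a \<odot>\<^bsub>M\<^esub> g i) \<in> I \<rightarrow> carrier M" using assms(1) by (auto intro: act_closed)
  with g insert show ?case using assms(1)
    by (simp add: M.finsum_insert act_add_right act_closed M.finsum_closed)
qed (use assms(1) in \<open>simp add: act_zero\<close>)

end

text \<open>Each \<open>c i\<close> is a coordinate functional and each \<open>m i\<close> a
  generator. The indices have the element type of P because \<open>projective_module\<close>
  prescribes it; the generators are a separate family, so that distinct indices may share
  one.\<close>

lemma projective_moduleI_dual_basis:
  fixes R :: "('r, 'b) ring_scheme" and P :: "('r, 'm) module" and I :: "'m set"
  assumes P: "left_module R P" and I: "finite I"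
    and m: "\<And>i. i \<in> I \<Longrightarrow> m i \<in> carrier P"
    and c: "\<And>i x. i \<in> I \<Longrightarrow> x \<in> carrier P \<Longrightarrow> c i x \<in> carrier R"
    and c_add: "\<And>i x y. i \<in> I \<Longrightarrow> x \<in> carrier P \<Longrightarrow> y \<in> carrier P \<Longrightarrow> c i (x \<oplus>\<^bsub>P\<^esub> y) = c i x \<oplus>\<^bsub>R\<^esub> c i y"
    and c_act: "\<And>i a x. i \<in> I \<Longrightarrow> a \<in> carrier R \<Longrightarrow> x \<in> carrier P \<Longrightarrow> c i (a \<odot>\<^bsub>P\<^esub> x) = a \<otimes>\<^bsub>R\<^esub> c i x"
    and expansion: "\<And>x. x \<in> carrier P \<Longrightarrow> (\<Oplus>\<^bsub>P\<^esub>i\<in>I. c i x \<odot>\<^bsub>P\<^esub> m i) = x"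
  shows "projective_module R P"
proof -
  interpret P: left_module R P by fact
  let ?F = "free_module R I"
  have F: "f \<in> carrier ?F \<longleftrightarrow> (\<forall>i. f i \<in> carrier R) \<and> (\<forall>i. i \<notin> I \<longrightarrow> f i = \<zero>\<^bsub>R\<^esub>)" for f
  proof -
    have "finite {i. f i \<noteq> \<zero>\<^bsub>R\<^esub>}" if "\<forall>i. i \<notin> I \<longrightarrow> f i = \<zero>\<^bsub>R\<^esub>"
      by (rule finite_subset[OF _ I]) (use that in auto)
    then show ?thesis by (auto simp: free_module_def)
  qed
  have Fops: "f \<oplus>\<^bsub>?F\<^esub> g = (\<lambda>i. f i \<oplus>\<^bsub>R\<^esub> g i)" "a \<odot>\<^bsub>?F\<^esub> f = (\<lambda>i. a \<otimes>\<^bsub>R\<^esub> f i)" for f g a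
    by (simp_all add: free_module_def)
  define \<iota> where "\<iota> = (\<lambda>x\<in>carrier P. \<lambda>i. if i \<in> I then c i x else \<zero>\<^bsub>R\<^esub>)"
  define \<pi> where "\<pi> = (\<lambda>f\<in>carrier ?F. \<Oplus>\<^bsub>P\<^esub>i\<in>I. f i \<odot>\<^bsub>P\<^esub> m i)"
  have fm: "(\<lambda>i. f i \<odot>\<^bsub>P\<^esub> m i) \<in> I \<rightarrow> carrier P" if "f \<in> carrier ?F" for f
    using that m by (auto simp: F P.act_closed)
  have \<iota>: "\<iota> \<in> lmod_hom R P ?F"
    by (rule lmod_homI) (auto simp: \<iota>_def F Fops c c_add c_act P.act_closed)
  have "\<pi> \<in> lmod_hom R ?F P"
  proof (rule lmod_homI)
    fix f assume f: "f \<in> carrier ?F"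
    show "\<pi> f \<in> carrier P" using f fm[OF f] by (simp add: \<pi>_def P.M.finsum_closed)
    fix g assume g: "g \<in> carrier ?F"
    have fg: "f \<oplus>\<^bsub>?F\<^esub> g \<in> carrier ?F" using f g by (auto simp: F Fops)
    have "(\<Oplus>\<^bsub>P\<^esub>i\<in>I. (f i \<oplus>\<^bsub>R\<^esub> g i) \<odot>\<^bsub>P\<^esub> m i) = (\<Oplus>\<^bsub>P\<^esub>i\<in>I. f i \<odot>\<^bsub>P\<^esub> m i \<oplus>\<^bsub>P\<^esub> g i \<odot>\<^bsub>P\<^esub> m i)"
      by (rule P.M.finsum_cong') (use f g m in \<open>auto simp: F P.act_add_left P.act_closed\<close>)
    also have "\<dots> = (\<Oplus>\<^bsub>P\<^esub>i\<in>I. f i \<odot>\<^bsub>P\<^esub> m i) \<oplus>\<^bsub>P\<^esub> (\<Oplus>\<^bsub>P\<^esub>i\<in>I. g i \<odot>\<^bsub>P\<^esub> m i)"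
      by (rule P.M.finsum_addf[OF fm[OF f] fm[OF g]])
    finally show "\<pi> (f \<oplus>\<^bsub>?F\<^esub> g) = \<pi> f \<oplus>\<^bsub>P\<^esub> \<pi> g"
      using f g fg by (simp add: \<pi>_def Fops)
  next
    fix a f assume a: "a \<in> carrier R" and f: "f \<in> carrier ?F"
    have af: "a \<odot>\<^bsub>?F\<^esub> f \<in> carrier ?F" using f a by (auto simp: F Fops)
    have "\<pi> (a \<odot>\<^bsub>?F\<^esub> f) = (\<Oplus>\<^bsub>P\<^esub>i\<in>I. a \<odot>\<^bsub>P\<^esub> (f i \<odot>\<^bsub>P\<^esub> m i))"
      unfolding \<pi>_def using af f a m
      by (auto simp: F Fops P.act_assoc P.act_closed intro!: P.M.finsum_cong')
    then show "\<pi> (a \<odot>\<^bsub>?F\<^esub> f) = a \<odot>\<^bsub>P\<^esub> \<pi> f"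
      using P.act_finsum[OF a I fm[OF f]] f by (simp add: \<pi>_def)
  qed (simp add: \<pi>_def)
  moreover have "\<pi> (\<iota> x) = x" if x: "x \<in> carrier P" for x
  proof -
    have "\<pi> (\<iota> x) = (\<Oplus>\<^bsub>P\<^esub>i\<in>I. c i x \<odot>\<^bsub>P\<^esub> m i)"
      using lmod_homD(2)[OF \<iota> x] x m unfolding \<pi>_def
      by (auto simp: \<iota>_def c P.act_closed intro!: P.M.finsum_cong')
    then show ?thesis using expansion[OF x] by simp
  qed
  ultimately show ?thesis unfolding projective_module_def using P \<iota> by blast
qed

lemma left_module_ideal_module:
  assumes "ideal I R"
  shows "left_module R (ideal_module R I)"
proof -
  interpret ideal I R by fact
  have "abelian_group (ideal_module R I)"
  proof (rule abelian_groupI)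
    fix x assume "x \<in> carrier (ideal_module R I)"
    then show "\<exists>y\<in>carrier (ideal_module R I). y \<oplus>\<^bsub>ideal_module R I\<^esub> x = \<zero>\<^bsub>ideal_module R I\<^esub>"
      by (intro bexI[of _ "\<ominus>\<^bsub>R\<^esub> x"]) (auto simp: ideal_module_def l_neg a_inv_closed)
  qed (auto simp: ideal_module_def a_ac)
  then show ?thesis
    by (intro left_module.intro left_module_axioms.intro ring_axioms)
      (auto simp: ideal_module_def I_l_closed l_distr r_distr m_assoc)
qed

lemma opposite_simps:
  "carrier (opposite R) = carrier R" "x \<otimes>\<^bsub>opposite R\<^esub> y = y \<otimes>\<^bsub>R\<^esub> x" "\<one>\<^bsub>opposite R\<^esub> = \<one>\<^bsub>R\<^esub>"
  "add (opposite R) = add R" "\<zero>\<^bsub>opposite R\<^esub> = \<zero>\<^bsub>R\<^esub>"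
  by (simp_all add: opposite_def)

lemma ring_opposite:
  assumes "ring R"
  shows "ring (opposite R)"
proof -
  interpret ring R by fact
  have "abelian_group (opposite R)"
    by (rule abelian_groupI) (auto simp: opposite_simps a_ac intro: l_neg)
  moreover have "Group.monoid (opposite R)"
    by (rule monoidI) (auto simp: opposite_simps m_assoc)
  ultimately show ?thesis
    by (rule ringI) (auto simp: opposite_simps l_distr r_distr)
qed

lemma ideal_opposite:
  assumes "ideal I R"
  shows "ideal I (opposite R)"
proof -
  interpret ideal I R by fact
  show ?thesis
    by (rule idealI[OF ring_opposite[OF ring_axioms]])
      (auto simp: opposite_simps I_l_closed I_r_closed intro: a_subgroup)
qed

text \<open>Terms are collected by their right factor p, so that ring elements serve as indices,
  from which the index set of a free module is made later. Coefficients vanish off I, which lets two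
  expansions be added over the union of their index sets.\<close>

lemma (in ring) sandwich_span_expansion:
  assumes e: "e \<in> carrier R" and a: "a \<in> sandwich_span R e"
  shows "\<exists>I u. finite I \<and> I \<subseteq> carrier R \<and> u \<in> carrier R \<rightarrow> carrier R \<and> (\<forall>p\<in>carrier R - I. u p = \<zero>) \<and>
    a = (\<Oplus>p\<in>I. u p \<otimes> e \<otimes> p)"
  using a
proof induction
  case (sandwich x y)
  then show ?case using e
    by (intro exI[of _ "{y}"] exI[of _ "\<lambda>p. if p = y then x else \<zero>"]) auto
next
  case (sum a b)
  then obtain I u J v where
    I: "finite I" "I \<subseteq> carrier R" "u \<in> carrier R \<rightarrow> carrier R" "\<forall>p\<in>carrier R - I. u p = \<zero>"
      "a = (\<Oplus>p\<in>I. u p \<otimes> e \<otimes> p)" and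
    J: "finite J" "J \<subseteq> carrier R" "v \<in> carrier R \<rightarrow> carrier R" "\<forall>p\<in>carrier R - J. v p = \<zero>"
      "b = (\<Oplus>p\<in>J. v p \<otimes> e \<otimes> p)"
    by (elim exE conjE)
  have "a = (\<Oplus>p\<in>I \<union> J. u p \<otimes> e \<otimes> p)"
    unfolding I(5) by (rule add.finprod_mono_neutral_cong_left) (use I J e in \<open>auto simp: subset_iff Pi_iff\<close>)
  moreover have "b = (\<Oplus>p\<in>I \<union> J. v p \<otimes> e \<otimes> p)"
    unfolding J(5) by (rule add.finprod_mono_neutral_cong_left) (use I J e in \<open>auto simp: subset_iff Pi_iff\<close>)
  moreover have "(\<Oplus>p\<in>I \<union> J. (u p \<oplus> v p) \<otimes> e \<otimes> p) =
      (\<Oplus>p\<in>I \<union> J. u p \<otimes> e \<otimes> p \<oplus> v p \<otimes> e \<otimes> p)"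
    by (rule finsum_cong') (use I J e in \<open>auto simp: l_distr subset_iff Pi_iff\<close>)
  moreover have "\<dots> = (\<Oplus>p\<in>I \<union> J. u p \<otimes> e \<otimes> p) \<oplus> (\<Oplus>p\<in>I \<union> J. v p \<otimes> e \<otimes> p)"
    by (rule finsum_addf) (use I J e in \<open>auto simp: subset_iff Pi_iff\<close>)
  ultimately show ?case using I J
    by (intro exI[of _ "I \<union> J"] exI[of _ "\<lambda>p. u p \<oplus> v p"]) auto
qed

lemma homotope_simps:
  "carrier (homotope A \<Delta>) = UNIV \<times> carrier A"
  "(c, a) \<otimes>\<^bsub>homotope A \<Delta>\<^esub> (d, b) = (c * d, c \<odot>\<^bsub>A\<^esub> b \<oplus>\<^bsub>A\<^esub> d \<odot>\<^bsub>A\<^esub> a \<oplus>\<^bsub>A\<^esub> a \<otimes>\<^bsub>A\<^esub> \<Delta> \<otimes>\<^bsub>A\<^esub> b)"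
  "\<one>\<^bsub>homotope A \<Delta>\<^esub> = (1, \<zero>\<^bsub>A\<^esub>)" "\<zero>\<^bsub>homotope A \<Delta>\<^esub> = (0, \<zero>\<^bsub>A\<^esub>)"
  "(c, a) \<oplus>\<^bsub>homotope A \<Delta>\<^esub> (d, b) = (c + d, a \<oplus>\<^bsub>A\<^esub> b)"
  "r \<odot>\<^bsub>homotope A \<Delta>\<^esub> (c, a) = (r * c, r \<odot>\<^bsub>A\<^esub> a)"
  by (simp_all add: homotope_def adjoin_unit_def nonunital_homotope_def)

lemma well_temperedI:
  fixes A :: "('k::field, 'a) module"
  assumes A: "unital_algebra A" and \<Delta>: "\<Delta> \<in> carrier A" and full: "\<one>\<^bsub>A\<^esub> \<in> Idl\<^bsub>A\<^esub> {\<Delta>}"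
  shows "well_tempered A \<Delta>"
proof -
  interpret A: unital_algebra A by fact
  let ?H = "homotope A \<Delta>" and ?B = "homotope_ideal A \<Delta>"
  interpret H: unital_algebra ?H by (rule unital_algebra_homotope(1)[OF A \<Delta>])
  have B: "ideal ?B ?H" by (rule unital_algebra_homotope(2)[OF A \<Delta>])
  have one_span: "\<one>\<^bsub>A\<^esub> \<in> sandwich_span A \<Delta>"
    using full A.genideal_subset_sandwich_span[OF \<Delta>] by blast
  obtain I u where I: "finite I" "I \<subseteq> carrier A" "u \<in> carrier A \<rightarrow> carrier A"
    and one: "\<one>\<^bsub>A\<^esub> = (\<Oplus>\<^bsub>A\<^esub>p\<in>I. u p \<otimes>\<^bsub>A\<^esub> \<Delta> \<otimes>\<^bsub>A\<^esub> p)"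
    using A.sandwich_span_expansion[OF \<Delta> one_span] by (elim exE conjE)
  have Ic: "p \<in> carrier A" "u p \<in> carrier A" if "p \<in> I" for p using that I(2,3) by auto
  have z: "0 \<odot>\<^bsub>A\<^esub> x = \<zero>\<^bsub>A\<^esub>" if "x \<in> carrier A" for x
    using A.scalar_add_left[of x 0 0] A.scalar_closed[of x 0] that
    by (metis A.add.r_cancel_one' add_0)
  have exp_left: "x = (\<Oplus>\<^bsub>A\<^esub>p\<in>I. x \<otimes>\<^bsub>A\<^esub> u p \<otimes>\<^bsub>A\<^esub> \<Delta> \<otimes>\<^bsub>A\<^esub> p)" if x: "x \<in> carrier A" for x
  proof -
    have "x = x \<otimes>\<^bsub>A\<^esub> (\<Oplus>\<^bsub>A\<^esub>p\<in>I. u p \<otimes>\<^bsub>A\<^esub> \<Delta> \<otimes>\<^bsub>A\<^esub> p)" using x by (simp add: one[symmetric])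
    also have "\<dots> = (\<Oplus>\<^bsub>A\<^esub>p\<in>I. x \<otimes>\<^bsub>A\<^esub> (u p \<otimes>\<^bsub>A\<^esub> \<Delta> \<otimes>\<^bsub>A\<^esub> p))"
      by (rule A.finsum_rdistr) (use I(1) x \<Delta> Ic in auto)
    also have "\<dots> = (\<Oplus>\<^bsub>A\<^esub>p\<in>I. x \<otimes>\<^bsub>A\<^esub> u p \<otimes>\<^bsub>A\<^esub> \<Delta> \<otimes>\<^bsub>A\<^esub> p)"
      by (rule A.finsum_cong') (use x \<Delta> Ic in \<open>auto simp: A.m_assoc\<close>)
    finally show ?thesis .
  qed
  have exp_right: "x = (\<Oplus>\<^bsub>A\<^esub>p\<in>I. u p \<otimes>\<^bsub>A\<^esub> \<Delta> \<otimes>\<^bsub>A\<^esub> (p \<otimes>\<^bsub>A\<^esub> x))" if x: "x \<in> carrier A" for x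
  proof -
    have "x = (\<Oplus>\<^bsub>A\<^esub>p\<in>I. u p \<otimes>\<^bsub>A\<^esub> \<Delta> \<otimes>\<^bsub>A\<^esub> p) \<otimes>\<^bsub>A\<^esub> x" using x by (simp add: one[symmetric])
    also have "\<dots> = (\<Oplus>\<^bsub>A\<^esub>p\<in>I. u p \<otimes>\<^bsub>A\<^esub> \<Delta> \<otimes>\<^bsub>A\<^esub> p \<otimes>\<^bsub>A\<^esub> x)"
      by (rule A.finsum_ldistr) (use I(1) x \<Delta> Ic in auto)
    also have "\<dots> = (\<Oplus>\<^bsub>A\<^esub>p\<in>I. u p \<otimes>\<^bsub>A\<^esub> \<Delta> \<otimes>\<^bsub>A\<^esub> (p \<otimes>\<^bsub>A\<^esub> x))"
      by (rule A.finsum_cong') (use x \<Delta> Ic in \<open>auto simp: A.m_assoc\<close>)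
    finally show ?thesis .
  qed
  \<comment> \<open>Sums in B^+ are sums of second components in A. The module record is left
    general because the left and the right module both need this.\<close>
  have fin_B: "(\<Oplus>\<^bsub>P\<^esub>j\<in>Pair 0 ` I. g j) = (0, \<Oplus>\<^bsub>A\<^esub>p\<in>I. h p)"
    if P: "left_module R P" "add P = add ?H" "zero P = zero ?H" "carrier P = ?B"
      and g: "\<And>p. p \<in> I \<Longrightarrow> g (0, p) = (0, h p) \<and> h p \<in> carrier A"
    for P :: "('r, 'k \<times> 'a) module" and R :: "('r, 's) ring_scheme" and g h
  proof -
    interpret P: left_module R P by fact
    have "(\<Oplus>\<^bsub>P\<^esub>j\<in>Pair 0 ` J. g j) = (0, \<Oplus>\<^bsub>A\<^esub>p\<in>J. h p) \<and> (\<Oplus>\<^bsub>A\<^esub>p\<in>J. h p) \<in> carrier A"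
      if "finite J" "J \<subseteq> I" for J
      using that
    proof (induction J)
      case (insert p J)
      have "g \<in> Pair 0 ` J \<rightarrow> carrier P" "g (0, p) \<in> carrier P" "h \<in> J \<rightarrow> carrier A" "h p \<in> carrier A"
        using g insert.prems by (auto simp: P(4) homotope_ideal_def nonunital_homotope_def)
      then show ?case using insert g[of p]
        by (simp add: P.M.finsum_insert A.finsum_insert image_iff P(2) homotope_simps)
    qed (simp_all add: P(3) homotope_simps)
    then show ?thesis using I(1) by simp
  qed
  have surj: "multiplication_surjective (nonunital_homotope A \<Delta>)"
    unfolding multiplication_surjective_def
  proof
    let ?P = "nonunital_homotope A \<Delta>"
    fix c assume "c \<in> carrier ?P"
    then have c: "c \<in> carrier A" by (simp add: nonunital_homotope_def)
    \<comment> \<open>\<open>multiplication_surjective\<close> sums over an initial segment of the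
      naturals, hence the enumeration of I.\<close>
    obtain f where f: "bij_betw f {..<card I} I"
      using I(1) ex_bij_betw_nat_finite atLeast0LessThan by metis
    then have fI: "f i \<in> I" if "i < card I" for i using that by (auto dest: bij_betwE)
    have "c = (\<Oplus>\<^bsub>A\<^esub>p\<in>f ` {..<card I}. c \<otimes>\<^bsub>A\<^esub> u p \<otimes>\<^bsub>A\<^esub> \<Delta> \<otimes>\<^bsub>A\<^esub> p)"
      using exp_left[OF c] bij_betw_imp_surj_on[OF f] by simp
    also have "\<dots> = (\<Oplus>\<^bsub>A\<^esub>i\<in>{..<card I}. c \<otimes>\<^bsub>A\<^esub> u (f i) \<otimes>\<^bsub>A\<^esub> \<Delta> \<otimes>\<^bsub>A\<^esub> f i)"
      by (rule A.finsum_reindex) (use bij_betw_imp_inj_on[OF f] fI Ic c \<Delta> in auto)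
    also have "\<dots> = (\<Oplus>\<^bsub>?P\<^esub>i\<in>{..<card I}. (c \<otimes>\<^bsub>A\<^esub> u (f i)) \<otimes>\<^bsub>?P\<^esub> f i)"
      by (simp add: nonunital_homotope_def finsum_def)
    finally have "c = (\<Oplus>\<^bsub>?P\<^esub>i\<in>{..<card I}. (c \<otimes>\<^bsub>A\<^esub> u (f i)) \<otimes>\<^bsub>?P\<^esub> f i)" .
    moreover have "c \<otimes>\<^bsub>A\<^esub> u (f i) \<in> carrier ?P \<and> f i \<in> carrier ?P" if "i < card I" for i
      using Ic[OF fI[OF that]] c by (simp add: nonunital_homotope_def)
    ultimately show "\<exists>(m::nat) x y. (\<forall>i<m. x i \<in> carrier ?P \<and> y i \<in> carrier ?P) \<and>
      c = (\<Oplus>\<^bsub>?P\<^esub>i\<in>{..<m}. x i \<otimes>\<^bsub>?P\<^esub> y i)"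
      by (intro exI[of _ "card I"] exI[of _ "\<lambda>i. c \<otimes>\<^bsub>A\<^esub> u (f i)"] exI[of _ f]) auto
  qed
  have Bc: "x \<in> ?B \<longleftrightarrow> (\<exists>a\<in>carrier A. x = (0, a))" for x
    by (auto simp: homotope_ideal_def nonunital_homotope_def)
  note simps = ideal_module_def homotope_simps Bc A.scalar_closed A.scalar_mult_left A.scalar_mult_right \<Delta>
    A.l_distr A.r_distr A.m_assoc z opposite_simps
  \<comment> \<open>At the generator p the coordinate of x is x u(p), and (x u(p)) \<Delta> p is the
    summand in \<open>exp_left\<close>.\<close>
  have left: "projective_module ?H (ideal_module ?H ?B)"
  proof (rule projective_moduleI_dual_basis[where I = "Pair 0 ` I" and m = "\<lambda>p. p"
        and c = "\<lambda>p x. (0, snd x \<otimes>\<^bsub>A\<^esub> u (snd p))"])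
    show P: "left_module ?H (ideal_module ?H ?B)" by (rule left_module_ideal_module[OF B])
    fix x assume "x \<in> carrier (ideal_module ?H ?B)"
    then obtain a where a: "a \<in> carrier A" "x = (0, a)" by (auto simp: simps)
    have "(\<Oplus>\<^bsub>ideal_module ?H ?B\<^esub>p\<in>Pair 0 ` I. (0, snd x \<otimes>\<^bsub>A\<^esub> u (snd p)) \<odot>\<^bsub>ideal_module ?H ?B\<^esub> p) =
      (0, \<Oplus>\<^bsub>A\<^esub>p\<in>I. a \<otimes>\<^bsub>A\<^esub> u p \<otimes>\<^bsub>A\<^esub> \<Delta> \<otimes>\<^bsub>A\<^esub> p)"
      by (rule fin_B[OF P]) (use a Ic in \<open>auto simp: simps\<close>)
    then show "(\<Oplus>\<^bsub>ideal_module ?H ?B\<^esub>p\<in>Pair 0 ` I. (0, snd x \<otimes>\<^bsub>A\<^esub> u (snd p)) \<odot>\<^bsub>ideal_module ?H ?B\<^esub> p) = x"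
      using exp_left[OF a(1)] a by simp
  qed (use I(1) Ic in \<open>auto simp: simps\<close>)
  \<comment> \<open>Over the opposite ring the roles are exchanged: u(p) is the generator and p x
    the coordinate. The index is still p, because u need not be injective.\<close>
  have right: "projective_module (opposite ?H) (ideal_module (opposite ?H) ?B)"
  proof (rule projective_moduleI_dual_basis[where I = "Pair 0 ` I" and m = "\<lambda>p. (0, u (snd p))"
        and c = "\<lambda>p x. (0, snd p \<otimes>\<^bsub>A\<^esub> snd x)"])
    show P: "left_module (opposite ?H) (ideal_module (opposite ?H) ?B)"
      by (rule left_module_ideal_module[OF ideal_opposite[OF B]])
    fix x assume "x \<in> carrier (ideal_module (opposite ?H) ?B)"
    then obtain a where a: "a \<in> carrier A" "x = (0, a)" by (auto simp: simps)
    have "(\<Oplus>\<^bsub>ideal_module (opposite ?H) ?B\<^esub>p\<in>Pair 0 ` I.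
        (0, snd p \<otimes>\<^bsub>A\<^esub> snd x) \<odot>\<^bsub>ideal_module (opposite ?H) ?B\<^esub> (0, u (snd p))) =
      (0, \<Oplus>\<^bsub>A\<^esub>p\<in>I. u p \<otimes>\<^bsub>A\<^esub> \<Delta> \<otimes>\<^bsub>A\<^esub> (p \<otimes>\<^bsub>A\<^esub> a))"
      by (rule fin_B[OF P]) (use a Ic in \<open>auto simp: simps\<close>)
    then show "(\<Oplus>\<^bsub>ideal_module (opposite ?H) ?B\<^esub>p\<in>Pair 0 ` I.
        (0, snd p \<otimes>\<^bsub>A\<^esub> snd x) \<odot>\<^bsub>ideal_module (opposite ?H) ?B\<^esub> (0, u (snd p))) = x"
      using exp_right[OF a(1)] a by simp
  qed (use I(1) Ic in \<open>auto simp: simps\<close>)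
  show ?thesis unfolding well_tempered_def using surj left right by blast
qed

section \<open>Generalized inverses, with dual bases for kernel and cokernel\<close>

section \<open>Splittings of a linear operator\<close>

context finite_dimensional_vector_space
begin

abbreviation endo where "endo f \<equiv> Vector_Spaces.linear scale scale f"
abbreviation functional where "functional l \<equiv> Vector_Spaces.linear scale (*) l"

lemma endo_simps:
  assumes "endo f"
  shows "f (x + y) = f x + f y" "f (x - y) = f x - f y" "f (scale c x) = scale c (f x)" "f 0 = 0"
    "f (\<Sum>i\<in>I. g i) = (\<Sum>i\<in>I. f (g i))"
proof -
  interpret f: Vector_Spaces.linear scale scale f by fact
  show "f (x + y) = f x + f y" "f (x - y) = f x - f y" "f (scale c x) = scale c (f x)" "f 0 = 0"
    "f (\<Sum>i\<in>I. g i) = (\<Sum>i\<in>I. f (g i))"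
    by (rule f.add f.diff f.scale f.zero f.sum)+
qed

lemma functional_simps:
  assumes "functional l"
  shows "l (x + y) = l x + l y" "l (x - y) = l x - l y" "l (scale c x) = c * l x" "l 0 = 0"
    "l (\<Sum>i\<in>I. g i) = (\<Sum>i\<in>I. l (g i))"
proof -
  interpret l: Vector_Spaces.linear scale "(*)" l by fact
  show "l (x + y) = l x + l y" "l (x - y) = l x - l y" "l (scale c x) = c * l x" "l 0 = 0"
    "l (\<Sum>i\<in>I. g i) = (\<Sum>i\<in>I. l (g i))"
    by (rule l.add l.diff l.scale l.zero l.sum)+
qed

lemma endoI:
  "(\<And>x y. f (x + y) = f x + f y) \<Longrightarrow> (\<And>c x. f (scale c x) = scale c (f x)) \<Longrightarrow> endo f"
  using vector_space_axioms by (simp add: Vector_Spaces.linear_iff)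

lemma vector_space_field: "vector_space ((*) :: 'a \<Rightarrow> 'a \<Rightarrow> 'a)"
  by unfold_locales (auto simp: algebra_simps)

lemma functionalI:
  "(\<And>x y. l (x + y) = l x + l y) \<Longrightarrow> (\<And>c x. l (scale c x) = c * l x) \<Longrightarrow> functional l"
  using vector_space_axioms vector_space_field by (simp add: Vector_Spaces.linear_iff)

lemma functional_exists:
  assumes "y \<noteq> 0"
  shows "\<exists>l. functional l \<and> l y = 1"
proof -
  interpret vector_space_pair scale "(*) :: 'a \<Rightarrow> 'a \<Rightarrow> 'a"
    using vector_space_axioms vector_space_field by (simp add: vector_space_pair_def)
  have y: "independent {y}" using assms by (simp add: dependent_single)
  show ?thesis
    using linear_construct[OF y, of "\<lambda>_. 1"] construct_basis[OF y, of y "\<lambda>_. 1"] by auto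
qed

text \<open>In a basis, f is the sum of the operators b* tensor f(b). This reduces the ideal
  computations in A and in B to rank-one operators.\<close>

lemma endo_rank_one_induct [consumes 1, case_names zero rank_one add]:
  assumes f: "endo f"
    and zero: "P (\<lambda>v. 0)"
    and rank_one: "\<And>l x. functional l \<Longrightarrow> P (\<lambda>v. scale (l v) x)"
    and add: "\<And>g h. endo g \<Longrightarrow> endo h \<Longrightarrow> P g \<Longrightarrow> P h \<Longrightarrow> P (\<lambda>v. g v + h v)"
  shows "P f"
proof -
  let ?r = "representation Basis"
  have r: "functional (\<lambda>v. ?r v b)" for b
    by (rule linear_representation[OF independent_Basis span_Basis])
  have "endo (\<lambda>v. \<Sum>b\<in>S. scale (?r v b) (f b)) \<and> P (\<lambda>v. \<Sum>b\<in>S. scale (?r v b) (f b))" if "finite S" for S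
    using that
  proof induction
    case empty
    show ?case using zero by (auto intro: endoI)
  next
    case (insert b S)
    moreover have "endo (\<lambda>v. scale (?r v b) (f b))"
      by (rule endoI) (simp_all add: functional_simps[OF r] scale_left_distrib)
    ultimately show ?case
      using add[OF _ _ rank_one[OF r]]
      by (auto intro!: endoI simp: endo_simps[of "\<lambda>v. \<Sum>b\<in>S. scale (?r v b) (f b)"] functional_simps[OF r]
          scale_left_distrib scale_right_distrib sum.distrib scale_sum_right)
  qed
  moreover have "f = (\<lambda>v. \<Sum>b\<in>Basis. scale (?r v b) (f b))"
  proof
    fix v
    have "f v = f (\<Sum>b\<in>Basis. scale (?r v b) b)"
      by (subst sum_representation_eq) (auto simp: independent_Basis span_Basis finite_Basis)
    then show "f v = (\<Sum>b\<in>Basis. scale (?r v b) (f b))" by (simp add: endo_simps[OF f])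
  qed
  ultimately show ?thesis using finite_Basis by metis
qed

text \<open>A right inverse g of f on the range satisfies f g f = f; replacing g by g f g secures
  the second identity as well.\<close>

lemma generalized_inverse_exists:
  assumes f: "endo f"
  shows "\<exists>g. endo g \<and> (\<forall>v. f (g (f v)) = f v) \<and> (\<forall>v. g (f (g v)) = g v)"
proof -
  interpret vector_space_pair scale scale ..
  obtain g where g: "endo g" "\<And>v. v \<in> range f \<Longrightarrow> f (g v) = v"
    using linear_exists_right_inverse_on[OF f subspace_UNIV] by auto
  show ?thesis
    by (rule exI[of _ "\<lambda>v. g (f (g v))"])
      (auto simp: g(2) endo_simps[OF f] endo_simps[OF g(1)] intro!: endoI)
qed

text \<open>The ranges of f and g are images of each other, so the ranks agree. Therefore ker f and
  ker g have bases of the same size, one for the arrows \<alpha> and one for the arrows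
  \<beta>.\<close>

lemma corank_eq:
  assumes f: "endo f" and g: "endo g"
    and fgf: "\<And>v. f (g (f v)) = f v" and gfg: "\<And>v. g (f (g v)) = g v"
  shows "corank scale g = corank scale f"
proof -
  interpret pair: finite_dimensional_vector_space_pair_1 scale Basis scale ..
  have "range g = g ` range f" using gfg by (auto simp: image_iff) metis
  then have "dim (range g) \<le> dim (range f)" using pair.dim_image_le[OF g, of "range f"] by simp
  moreover have "range f = f ` range g" using fgf by (auto simp: image_iff) metis
  then have "dim (range f) \<le> dim (range g)" using pair.dim_image_le[OF f, of "range g"] by simp
  ultimately show ?thesis by (simp add: corank_def)
qed

text \<open>v - g (f v) is the projection onto ker f along range g; the \<open>k i\<close> form a
  basis of ker f and the \<open>\<kappa> i\<close> are the coordinates of the projection. With f and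
  g exchanged, the lemma supplies a basis of a complement of range f and functionals vanishing on
  range f.\<close>

lemma kernel_splitting:
  assumes f: "endo f" and g: "endo g"
    and fgf: "\<And>v. f (g (f v)) = f v" and gfg: "\<And>v. g (f (g v)) = g v"
  shows "\<exists>k \<kappa>. (\<forall>i. functional (\<kappa> i)) \<and>
    (\<forall>v. v = g (f v) + (\<Sum>i=1..corank scale f. scale (\<kappa> i v) (k i))) \<and>
    (\<forall>i\<in>{1..corank scale f}. f (k i) = 0) \<and> (\<forall>i v. \<kappa> i (g v) = 0) \<and>
    (\<forall>i\<in>{1..corank scale f}. \<forall>j\<in>{1..corank scale f}. \<kappa> i (k j) = (if i = j then 1 else 0))"
proof -
  interpret pair: vector_space_pair scale scale ..
  let ?K = "{v. f v = 0}"
  note f' = endo_simps[OF f] and g' = endo_simps[OF g]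
  have K: "subspace ?K" by (auto simp: subspace_def f')
  have rg: "subspace (range g)" by (rule pair.linear_subspace_image[OF g subspace_UNIV])
  have "?K \<inter> range g = {0}"
  proof (intro equalityI subsetI)
    fix v assume "v \<in> ?K \<inter> range g"
    then obtain w where "v = g w" "f v = 0" by auto
    then show "v \<in> {0}" using gfg[of w] by (simp add: g')
  next
    fix v assume "v \<in> {0 :: 'b}"
    then show "v \<in> ?K \<inter> range g" using f'(4) g'(4) by (auto intro: range_eqI[of _ g 0])
  qed
  moreover have "v \<in> {x + y |x y. x \<in> ?K \<and> y \<in> range g}" for v
    by (rule CollectI, rule exI[of _ "v - g (f v)"], rule exI[of _ "g (f v)"]) (simp add: f' fgf)
  then have "{x + y |x y. x \<in> ?K \<and> y \<in> range g} = UNIV" by blast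
  \<comment> \<open>The kernel of f is a complement of range g, so its dimension is n minus the rank
    of g.\<close>
  ultimately have "dim (UNIV :: 'b set) = dim ?K + dim (range g)"
    using dim_sums_Int[OF K rg] by simp
  then have dimK: "dim ?K = corank scale f"
    using corank_eq[OF f g fgf gfg] by (simp add: corank_def)
  obtain C where C: "C \<subseteq> ?K" "independent C" "?K \<subseteq> span C" "card C = dim ?K"
    using basis_exists .
  then have spanC: "span C = ?K" using span_minimal[OF _ K] by blast
  have finC: "finite C" by (rule finiteI_independent) fact
  let ?s = "corank scale f"
  obtain k where k: "bij_betw k {1..?s} C"
    using ex_bij_betw_nat_finite_1[OF finC] C(4) dimK by auto
  let ?r = "representation C"
  define \<kappa> where "\<kappa> i v = ?r (v - g (f v)) (k i)" for i v
  have pK: "v - g (f v) \<in> span C" for v by (simp add: spanC f' fgf)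
  have "functional (\<kappa> i)" for i
  proof (rule functionalI)
    fix x y
    have "(x + y) - g (f (x + y)) = (x - g (f x)) + (y - g (f y))" by (simp add: f' g')
    then show "\<kappa> i (x + y) = \<kappa> i x + \<kappa> i y"
      unfolding \<kappa>_def by (simp only: representation_add[OF C(2) pK pK])
  next
    fix c x
    have "scale c x - g (f (scale c x)) = scale c (x - g (f x))" by (simp add: f' g' scale_right_diff_distrib)
    then show "\<kappa> i (scale c x) = c * \<kappa> i x"
      unfolding \<kappa>_def by (simp only: representation_scale[OF C(2) pK])
  qed
  moreover have "v = g (f v) + (\<Sum>i=1..?s. scale (\<kappa> i v) (k i))" for v
  proof -
    have "(\<Sum>i=1..?s. scale (\<kappa> i v) (k i)) = (\<Sum>b\<in>C. scale (?r (v - g (f v)) b) b)"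
      unfolding \<kappa>_def by (rule sum.reindex_bij_betw[OF k])
    also have "\<dots> = v - g (f v)" by (rule sum_representation_eq[OF C(2) pK finC]) simp
    finally show ?thesis by simp
  qed
  moreover have kC: "k i \<in> C" if "i \<in> {1..?s}" for i using bij_betwE[OF k] that by blast
  moreover have fk: "f (k i) = 0" if "i \<in> {1..?s}" for i using kC[OF that] C(1) by auto
  moreover have "\<kappa> i (g v) = 0" for i v by (simp add: \<kappa>_def gfg representation_zero)
  moreover have "\<kappa> i (k j) = (if i = j then 1 else 0)" if "i \<in> {1..?s}" "j \<in> {1..?s}" for i j
    using that bij_betw_imp_inj_on[OF k]
    by (auto simp: \<kappa>_def fk g' representation_basis[OF C(2) kC] dest: inj_onD)
  ultimately show ?thesis by blast
qed

end

text \<open>\<open>k\<close> and \<open>\<kappa>\<close> are dual bases for ker \<Delta>;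
  \<open>c\<close> and \<open>\<rho>\<close> are dual bases for ker E, a complement of range
  \<Delta>. The last three assumptions make w tensor \<mu> a rank-one idempotent of B^+ below E:
  \<open>E\<Delta>w\<close> and \<open>\<mu>\<Delta>E\<close> say that E absorbs into it from the
  left and from the right, \<open>\<mu>\<Delta>w\<close> that it is idempotent.\<close>

locale splitting = finite_dimensional_vector_space scale Basis
  for scale :: "'k::field \<Rightarrow> 'v::ab_group_add \<Rightarrow> 'v" and Basis +
  fixes \<Delta> E :: "'v \<Rightarrow> 'v" and s :: nat and k c :: "nat \<Rightarrow> 'v" and \<kappa> \<rho> :: "nat \<Rightarrow> 'v \<Rightarrow> 'k"
    and w :: 'v and \<mu> :: "'v \<Rightarrow> 'k"
  assumes \<Delta>: "endo \<Delta>" and E: "endo E" and \<kappa>: "functional (\<kappa> i)" and \<rho>: "functional (\<rho> i)"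
    and \<mu>: "functional \<mu>"
    and \<Delta>E\<Delta>: "\<Delta> (E (\<Delta> v)) = \<Delta> v" and E\<Delta>E: "E (\<Delta> (E v)) = E v"
    and split_kernel: "v = E (\<Delta> v) + (\<Sum>i=1..s. scale (\<kappa> i v) (k i))"
    and split_range: "v = \<Delta> (E v) + (\<Sum>i=1..s. scale (\<rho> i v) (c i))"
    and \<Delta>k: "i \<in> {1..s} \<Longrightarrow> \<Delta> (k i) = 0" and Ec: "i \<in> {1..s} \<Longrightarrow> E (c i) = 0"
    and \<kappa>E: "\<kappa> i (E v) = 0" and \<rho>\<Delta>: "\<rho> i (\<Delta> v) = 0"
    and \<kappa>k: "i \<in> {1..s} \<Longrightarrow> j \<in> {1..s} \<Longrightarrow> \<kappa> i (k j) = (if i = j then 1 else 0)"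
    and \<rho>c: "i \<in> {1..s} \<Longrightarrow> j \<in> {1..s} \<Longrightarrow> \<rho> i (c j) = (if i = j then 1 else 0)"
    and E\<Delta>w: "E (\<Delta> w) = w" and \<mu>\<Delta>E: "\<mu> (\<Delta> (E v)) = \<mu> v" and \<mu>\<Delta>w: "\<mu> (\<Delta> w) = 1"

lemma (in finite_dimensional_vector_space) splitting_exists:
  assumes f: "endo f" and u: "f u \<noteq> 0"
  shows "\<exists>E k c \<kappa> \<rho> w \<mu>. splitting scale Basis f E (corank scale f) k c \<kappa> \<rho> w \<mu>"
proof -
  obtain g where g: "endo g" "\<And>v. f (g (f v)) = f v" "\<And>v. g (f (g v)) = g v"
    using generalized_inverse_exists[OF f] by blast
  note f' = endo_simps[OF f] and g' = endo_simps[OF g(1)]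
  obtain k \<kappa> where k: "\<And>i. functional (\<kappa> i)"
    "\<And>v. v = g (f v) + (\<Sum>i=1..corank scale f. scale (\<kappa> i v) (k i))"
    "\<And>i. i \<in> {1..corank scale f} \<Longrightarrow> f (k i) = 0" "\<And>i v. \<kappa> i (g v) = 0"
    "\<And>i j. i \<in> {1..corank scale f} \<Longrightarrow> j \<in> {1..corank scale f} \<Longrightarrow> \<kappa> i (k j) = (if i = j then 1 else 0)"
    using kernel_splitting[OF f g] by (elim exE conjE) blast
  obtain c \<rho> where c: "\<And>i. functional (\<rho> i)"
    "\<And>v. v = f (g v) + (\<Sum>i=1..corank scale f. scale (\<rho> i v) (c i))"
    "\<And>i. i \<in> {1..corank scale f} \<Longrightarrow> g (c i) = 0" "\<And>i v. \<rho> i (f v) = 0"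
    "\<And>i j. i \<in> {1..corank scale f} \<Longrightarrow> j \<in> {1..corank scale f} \<Longrightarrow> \<rho> i (c j) = (if i = j then 1 else 0)"
    using kernel_splitting[OF g(1) f g(3,2)] unfolding corank_eq[OF f g] by (elim exE conjE) blast
  \<comment> \<open>With l(f u) = 1, the vector w = g (f u) and the functional \<mu> = l f g meet
    the requirements because f and g are generalized inverses of each other; in particular \<mu>(f
    w) = l(f u) = 1.\<close>
  obtain l where l: "functional l" "l (f u) = 1" using functional_exists[OF u] by blast
  have \<mu>: "functional (\<lambda>v. l (f (g v)))" by (rule functionalI) (simp_all add: f' g' functional_simps[OF l(1)])
  have "splitting scale Basis f g (corank scale f) k c \<kappa> \<rho> (g (f u)) (\<lambda>v. l (f (g v)))"
    by (intro splitting.intro splitting_axioms.intro finite_dimensional_vector_space_axioms)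
      (fact f g k c \<mu> | simp add: g l)+
  then show ?thesis by blast
qed

section \<open>Normal forms of paths modulo the relations\<close>

section \<open>The path algebra of the quiver\<close>

text \<open>The paths whose classes form a basis of the quiver algebra. Lists run in the order of
  traversal: \<open>[Beta j, Alpha i]\<close> is the product \<alpha>_i \<beta>_j, while the
  relation \<beta>_j \<alpha>_i is the list \<open>[Alpha i, Beta j]\<close>.\<close>

definition reduced_paths :: "nat \<Rightarrow> (vertex \<times> arrow list) set"
  where "reduced_paths s = {(V1, []), (V2, [])} \<union> (\<lambda>i. (V1, [Alpha i])) ` {1..s} \<union>
    (\<lambda>j. (V2, [Beta j])) ` {1..s} \<union> (\<lambda>(j, i). (V2, [Beta j, Alpha i])) ` ({1..s} \<times> {1..s})"

lemma finite_reduced_paths: "finite (reduced_paths s)"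
  by (simp add: reduced_paths_def)

lemma wf_digraph_alpha_beta_quiver: "wf_digraph (alpha_beta_quiver s)"
  by unfold_locales (auto simp: alpha_beta_quiver_def)

lemma alpha_beta_quiver_simps:
  "verts (alpha_beta_quiver s) = {V1, V2}"
  "Alpha i \<in> arcs (alpha_beta_quiver s) \<longleftrightarrow> i \<in> {1..s}"
  "Beta i \<in> arcs (alpha_beta_quiver s) \<longleftrightarrow> i \<in> {1..s}"
  "tail (alpha_beta_quiver s) (Alpha i) = V1" "head (alpha_beta_quiver s) (Alpha i) = V2"
  "tail (alpha_beta_quiver s) (Beta i) = V2" "head (alpha_beta_quiver s) (Beta i) = V1"
  by (auto simp: alpha_beta_quiver_def)

lemma reduced_paths_subset: "reduced_paths s \<subseteq> quiver_paths (alpha_beta_quiver s)"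
proof -
  interpret wf_digraph "alpha_beta_quiver s" by (rule wf_digraph_alpha_beta_quiver)
  show ?thesis
    by (auto simp: reduced_paths_def quiver_paths_def awalk_simps alpha_beta_quiver_simps)
qed

text \<open>The arrows of a path alternate. On a path from \<open>V1\<close> the second arrow is a
  \<open>Beta\<close> that follows an \<open>Alpha\<close>; on a path from \<open>V2\<close> this
  occurs at the third arrow.\<close>

lemma path_not_reduced:
  assumes "(u, p) \<in> quiver_paths (alpha_beta_quiver s)" "(u, p) \<notin> reduced_paths s"
  obtains q i j r where "p = q @ [Alpha i, Beta j] @ r"
proof -
  interpret wf_digraph "alpha_beta_quiver s" by (rule wf_digraph_alpha_beta_quiver)
  note simps = awalk_Cons_iff alpha_beta_quiver_simps
  have from_V1: "q = [] \<or> (\<exists>i. i \<in> {1..s} \<and> (q = [Alpha i] \<or> (\<exists>j r. q = [Alpha i, Beta j] @ r)))"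
    if aw: "awalk V1 q v" for q v
  proof (cases q)
    case (Cons a q')
    then obtain i where i: "a = Alpha i" using aw Cons by (cases a) (auto simp: simps)
    show ?thesis
    proof (cases q')
      case (Cons b r)
      then show ?thesis using aw \<open>q = a # q'\<close> i by (cases b) (auto simp: simps)
    qed (use aw Cons i in \<open>auto simp: simps\<close>)
  qed simp
  obtain v where v: "awalk u p v" using assms by (auto simp: quiver_paths_def)
  show ?thesis
  proof (cases u)
    case V1
    show ?thesis using from_V1[of p v] v V1 assms(2) that[of "[]"] by (auto simp: reduced_paths_def)
  next
    case V2
    then obtain a q where p: "p = a # q" using assms(2) by (cases p) (auto simp: reduced_paths_def)
    obtain j where j: "a = Beta j" "j \<in> {1..s}" using v p V2 by (cases a) (auto simp: simps)
    have q: "awalk V1 q v" using v p j by (auto simp: simps)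
    show ?thesis using from_V1[OF q] p j V2 assms(2) that[of "[Beta j]"] by (auto simp: reduced_paths_def image_iff)
  qed
qed

lemma awlast_simps:
  "pre_digraph.awlast Q u [] = u" "pre_digraph.awlast Q u (e # p) = pre_digraph.awlast Q (head Q e) p"
proof -
  have "pre_digraph.awalk_verts Q v r \<noteq> []" for v r
    by (cases r) (auto simp: pre_digraph.awalk_verts.simps)
  then show "pre_digraph.awlast Q u [] = u"
    "pre_digraph.awlast Q u (e # p) = pre_digraph.awlast Q (head Q e) p"
    by (simp_all add: pre_digraph.awalk_verts.simps)
qed

lemma path_algebra_simps:
  "\<zero>\<^bsub>path_algebra Q\<^esub> = (\<lambda>x. 0)" "f \<oplus>\<^bsub>path_algebra Q\<^esub> g = (\<lambda>x. f x + g x)"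
  "a \<odot>\<^bsub>path_algebra Q\<^esub> f = (\<lambda>x. a * f x)"
  "\<one>\<^bsub>path_algebra Q\<^esub> (u, p) = (if u \<in> verts Q \<and> p = [] then 1 else 0)"
  "f \<in> carrier (path_algebra Q) \<longleftrightarrow> finite {x. f x \<noteq> 0} \<and> {x. f x \<noteq> 0} \<subseteq> quiver_paths Q"
  by (simp_all add: path_algebra_def)

text \<open>Pieces of a reduced path are reduced, so a product at reduced paths depends only on the
  values of its factors there. This is why \<open>rep\<close> can be multiplicative before the
  quotient is taken.\<close>

lemma path_algebra_mult_reduced:
  fixes f g :: "vertex \<times> arrow list \<Rightarrow> 'k::field" and s :: nat
  defines "fg \<equiv> f \<otimes>\<^bsub>path_algebra (alpha_beta_quiver s)\<^esub> g"
  shows "fg (u, []) = f (u, []) * g (u, [])"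
    and "fg (V1, [Alpha i]) = f (V1, [Alpha i]) * g (V1, []) + f (V2, []) * g (V1, [Alpha i])"
    and "fg (V2, [Beta j]) = f (V2, [Beta j]) * g (V2, []) + f (V1, []) * g (V2, [Beta j])"
    and "fg (V2, [Beta j, Alpha i]) = f (V2, [Beta j, Alpha i]) * g (V2, []) +
      f (V1, [Alpha i]) * g (V2, [Beta j]) + f (V2, []) * g (V2, [Beta j, Alpha i])"
proof -
  have mult: "fg (u, p) =
      (\<Sum>(q, r) | q @ r = p. f (pre_digraph.awlast (alpha_beta_quiver s) u q, r) * g (u, q))" for u p
    by (simp add: fg_def path_algebra_def)
  have splits: "{(q, r). q @ r = []} = {([], [] :: arrow list)}"
    "{(q, r). q @ r = [a]} = {([], [a]), ([a], [])}"
    "{(q, r). q @ r = [a, b]} = {([], [a, b]), ([a], [b]), ([a, b], [])}" for a b :: arrow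
    by (auto simp: append_eq_Cons_conv)
  show "fg (u, []) = f (u, []) * g (u, [])"
    "fg (V1, [Alpha i]) = f (V1, [Alpha i]) * g (V1, []) + f (V2, []) * g (V1, [Alpha i])"
    "fg (V2, [Beta j]) = f (V2, [Beta j]) * g (V2, []) + f (V1, []) * g (V2, [Beta j])"
    "fg (V2, [Beta j, Alpha i]) = f (V2, [Beta j, Alpha i]) * g (V2, []) +
      f (V1, [Alpha i]) * g (V2, [Beta j]) + f (V2, []) * g (V2, [Beta j, Alpha i])"
    by (simp_all add: mult splits awlast_simps alpha_beta_quiver_simps)
qed

definition path_element :: "'q \<times> 'e list \<Rightarrow> 'k::field \<Rightarrow> 'q \<times> 'e list \<Rightarrow> 'k"
  where "path_element x a = (\<lambda>y. if y = x then a else 0)"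

lemma path_element_closed:
  "x \<in> quiver_paths Q \<Longrightarrow> path_element x a \<in> carrier (path_algebra Q)"
  by (auto simp: path_algebra_simps path_element_def)

lemma path_element_mult:
  fixes Q :: "('q, 'e) pre_digraph" and a b :: "'k::field"
  assumes "pre_digraph.awlast Q u q = v"
  shows "path_element (v, r) a \<otimes>\<^bsub>path_algebra Q\<^esub> path_element (u, q) b = path_element (u, q @ r) (a * b)"
proof
  fix y :: "'q \<times> 'e list" obtain u' p where y: "y = (u', p)" by (cases y)
  have "(path_element (v, r) a \<otimes>\<^bsub>path_algebra Q\<^esub> path_element (u, q) b) (u', p) =
    (\<Sum>(q', r') | q' @ r' = p. if u' = u \<and> q' = q \<and> r' = r then a * b else 0)"
    using assms by (auto simp: path_algebra_def path_element_def intro!: sum.cong)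
  also have "\<dots> = (\<Sum>(q', r') \<in> (if u' = u \<and> p = q @ r then {(q, r)} else {}). a * b)"
    by (rule sum.mono_neutral_cong_right) (auto simp: finite_splits split: if_splits)
  finally show "(path_element (v, r) a \<otimes>\<^bsub>path_algebra Q\<^esub> path_element (u, q) b) y =
    path_element (u, q @ r) (a * b) y"
    by (auto simp: y path_element_def)
qed

lemma beta_alpha_relations_eq:
  "beta_alpha_relations s =
    {path_element (V1, [Alpha i, Beta j]) 1 | i j. i \<in> {1..s} \<and> j \<in> {1..s}}"
  unfolding beta_alpha_relations_def beta_alpha_product path_element_def by auto

lemma beta_alpha_relations_closed:
  "beta_alpha_relations s \<subseteq> carrier (path_algebra (alpha_beta_quiver s))"
proof -
  interpret wf_digraph "alpha_beta_quiver s" by (rule wf_digraph_alpha_beta_quiver)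
  show ?thesis unfolding beta_alpha_relations_eq
    by (auto intro!: path_element_closed exI[of _ V1]
        simp: quiver_paths_def awalk_simps alpha_beta_quiver_simps)
qed

text \<open>A path that is not reduced contains a relation and so lies in the ideal, and f is a
  combination of such paths. The converse comes out of \<open>rep\<close>, which kills the relations
  and separates the reduced paths.\<close>

lemma vanishing_on_reduced_paths:
  fixes f :: "vertex \<times> arrow list \<Rightarrow> 'k::field"
  assumes "f \<in> carrier (path_algebra (alpha_beta_quiver s))" and "\<And>x. x \<in> reduced_paths s \<Longrightarrow> f x = 0"
  shows "f \<in> Idl\<^bsub>path_algebra (alpha_beta_quiver s)\<^esub> (beta_alpha_relations s)"
proof -
  let ?T = "path_algebra (alpha_beta_quiver s) :: ('k, _) module"
  let ?J = "Idl\<^bsub>?T\<^esub> (beta_alpha_relations s)"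
  interpret wf_digraph "alpha_beta_quiver s" by (rule wf_digraph_alpha_beta_quiver)
  interpret T: unital_algebra ?T
    by (rule unital_algebra_path_algebra[OF wf_digraph_axioms]) (simp add: alpha_beta_quiver_simps)
  interpret J: ideal ?J ?T by (rule T.genideal_ideal[OF beta_alpha_relations_closed])
  have path: "path_element x a \<in> ?J"
    if x: "x \<in> quiver_paths (alpha_beta_quiver s)" "x \<notin> reduced_paths s" for x and a :: 'k
  proof -
    obtain u p where up: "x = (u, p)" by (cases x)
    obtain q i j r where p: "p = q @ [Alpha i, Beta j] @ r" using path_not_reduced x up by metis
    obtain v where "awalk u (q @ [Alpha i, Beta j] @ r) v" using x(1) up p by (auto simp: quiver_paths_def)
    then have *: "awalk u q V1" "awlast u q = V1" "i \<in> {1..s}" "j \<in> {1..s}" "awalk V1 r v"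
      by (auto simp: awalk_Cons_iff alpha_beta_quiver_simps)
    have q: "(u, q) \<in> quiver_paths (alpha_beta_quiver s)" and r: "(V1, r) \<in> quiver_paths (alpha_beta_quiver s)"
      using * by (auto simp: quiver_paths_def)
    have "path_element (V1, [Alpha i, Beta j]) 1 \<in> ?J"
      using T.genideal_self[OF beta_alpha_relations_closed] *(3,4) by (auto simp: beta_alpha_relations_eq)
    \<comment> \<open>What is traversed last is the left factor; the coefficient a is carried by the
      right one.\<close>
    then have "path_element (V1, r) 1 \<otimes>\<^bsub>?T\<^esub> (path_element (V1, [Alpha i, Beta j]) 1 \<otimes>\<^bsub>?T\<^esub>
        path_element (u, q) a) \<in> ?J"
      by (intro J.I_l_closed J.I_r_closed path_element_closed q r)
    also have "path_element (V1, r) 1 \<otimes>\<^bsub>?T\<^esub> (path_element (V1, [Alpha i, Beta j]) 1 \<otimes>\<^bsub>?T\<^esub>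
        path_element (u, q) a) = path_element x a"
      using *(2) by (simp add: path_element_mult awlast_append awlast_simps alpha_beta_quiver_simps up p)
    finally show ?thesis .
  qed
  \<comment> \<open>Induction on the support, with one path split off at a time.\<close>
  have step: "f \<in> ?J" if "finite S" "{x. f x \<noteq> 0} = S" "S \<subseteq> quiver_paths (alpha_beta_quiver s) - reduced_paths s"
    for S and f :: "vertex \<times> arrow list \<Rightarrow> 'k"
    using that
  proof (induction S arbitrary: f)
    case empty
    then have "f = \<zero>\<^bsub>?T\<^esub>" by (auto simp: path_algebra_simps)
    then show ?case using J.zero_closed by simp
  next
    case (insert x S)
    have "{y. (f(x := 0)) y \<noteq> 0} = S" using insert by auto
    then have "f(x := 0) \<in> ?J" using insert by simp
    moreover have "path_element x (f x) \<in> ?J" using insert.prems by (intro path) auto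
    moreover have "f = f(x := 0) \<oplus>\<^bsub>?T\<^esub> path_element x (f x)"
      by (auto simp: path_algebra_simps path_element_def fun_eq_iff)
    ultimately show ?case using J.a_closed by metis
  qed
  show ?thesis by (rule step[of "{x. f x \<noteq> 0}"]) (use assms in \<open>auto simp: path_algebra_simps\<close>)
qed

section \<open>Identification of eBe with the quiver algebra\<close>

section \<open>The corner of the homotope\<close>

text \<open>The homomorphism theorem for a map f whose image is the corner at the idempotent f(1). A
  coset goes to the common value of f on it, which \<open>the_elem\<close> extracts.\<close>

lemma quotient_algebra_full_corner:
  fixes B :: "('k::field, 'b) module" and T :: "('k, 't) module" and f :: "'t \<Rightarrow> 'b"
  assumes B: "unital_algebra B" and T: "unital_algebra T" and J: "ideal J T"
    and closed: "\<And>t. t \<in> carrier T \<Longrightarrow> f t \<in> carrier B"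
    and add: "\<And>t u. t \<in> carrier T \<Longrightarrow> u \<in> carrier T \<Longrightarrow> f (t \<oplus>\<^bsub>T\<^esub> u) = f t \<oplus>\<^bsub>B\<^esub> f u"
    and mult: "\<And>t u. t \<in> carrier T \<Longrightarrow> u \<in> carrier T \<Longrightarrow> f (t \<otimes>\<^bsub>T\<^esub> u) = f t \<otimes>\<^bsub>B\<^esub> f u"
    and smult: "\<And>a t. t \<in> carrier T \<Longrightarrow> f (a \<odot>\<^bsub>T\<^esub> t) = a \<odot>\<^bsub>B\<^esub> f t"
    and kernel: "\<And>t. t \<in> carrier T \<Longrightarrow> f t = \<zero>\<^bsub>B\<^esub> \<longleftrightarrow> t \<in> J"
    and onto: "\<And>b. b \<in> carrier B \<Longrightarrow> \<exists>t\<in>carrier T. f t = f \<one>\<^bsub>T\<^esub> \<otimes>\<^bsub>B\<^esub> b \<otimes>\<^bsub>B\<^esub> f \<one>\<^bsub>T\<^esub>"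
    and full: "\<one>\<^bsub>B\<^esub> \<in> Idl\<^bsub>B\<^esub> {f \<one>\<^bsub>T\<^esub>}"
  shows "full_corner B (quotient_algebra T J) (\<lambda>X. the_elem (f ` X))"
proof -
  interpret B: unital_algebra B by fact
  interpret T: unital_algebra T by fact
  interpret J: ideal J T by fact
  let ?Q = "quotient_algebra T J" and ?\<phi> = "\<lambda>X. the_elem (f ` X)"
  have cosetD: "u \<in> carrier T \<and> f u = f t" if t: "t \<in> carrier T" and u: "u \<in> J +>\<^bsub>T\<^esub> t" for t u
  proof -
    obtain j where j: "j \<in> J" "u = j \<oplus>\<^bsub>T\<^esub> t" using u unfolding a_r_coset_def' by blast
    then have "j \<in> carrier T" "f j = \<zero>\<^bsub>B\<^esub>" using J.Icarr kernel by auto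
    then show ?thesis using j t by (simp add: add closed)
  qed
  have self: "t \<in> J +>\<^bsub>T\<^esub> t" if "t \<in> carrier T" for t by (rule J.a_rcos_self[OF that])
  have \<phi>I: "?\<phi> X = f t" if "t \<in> X" "\<And>u. u \<in> X \<Longrightarrow> f u = f t" for X t
  proof -
    have "f ` X \<subseteq> {f t}" "{f t} \<subseteq> f ` X" using that by blast+
    then have "f ` X = {f t}" by (rule subset_antisym)
    then show ?thesis by simp
  qed
  have \<phi>: "?\<phi> (J +>\<^bsub>T\<^esub> t) = f t" if "t \<in> carrier T" for t
    by (rule \<phi>I[OF self[OF that]]) (use cosetD[OF that] in blast)
  have rep: "\<exists>t\<in>carrier T. X = J +>\<^bsub>T\<^esub> t" if "X \<in> carrier ?Q" for X
    using that by (auto simp: quotient_algebra_def FactRing_simps)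
  have cc: "J +>\<^bsub>T\<^esub> t \<in> carrier ?Q" if "t \<in> carrier T" for t
    using that by (auto simp: quotient_algebra_def FactRing_simps)
  have addQ: "(J +>\<^bsub>T\<^esub> t) \<oplus>\<^bsub>?Q\<^esub> (J +>\<^bsub>T\<^esub> u) = J +>\<^bsub>T\<^esub> (t \<oplus>\<^bsub>T\<^esub> u)"
    if "t \<in> carrier T" "u \<in> carrier T" for t u
    using that by (simp add: quotient_algebra_def FactRing_def J.a_rcos_sum)
  have multQ: "(J +>\<^bsub>T\<^esub> t) \<otimes>\<^bsub>?Q\<^esub> (J +>\<^bsub>T\<^esub> u) = J +>\<^bsub>T\<^esub> (t \<otimes>\<^bsub>T\<^esub> u)"
    if "t \<in> carrier T" "u \<in> carrier T" for t u
    using that by (simp add: quotient_algebra_def FactRing_def J.rcoset_mult_add)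
  have oneQ: "\<one>\<^bsub>?Q\<^esub> = J +>\<^bsub>T\<^esub> \<one>\<^bsub>T\<^esub>"
    by (simp add: quotient_algebra_def FactRing_def)
  \<comment> \<open>A scalar multiple in the quotient is defined as a union of cosets, so f has to
    be constant on the whole union before \<open>the_elem\<close> can be evaluated.\<close>
  have smultQ: "?\<phi> (a \<odot>\<^bsub>?Q\<^esub> (J +>\<^bsub>T\<^esub> t)) = a \<odot>\<^bsub>B\<^esub> f t" if t: "t \<in> carrier T" for a t
  proof -
    have at: "a \<odot>\<^bsub>T\<^esub> t \<in> carrier T" using t by (rule T.scalar_closed)
    have "?\<phi> (a \<odot>\<^bsub>?Q\<^esub> (J +>\<^bsub>T\<^esub> t)) = f (a \<odot>\<^bsub>T\<^esub> t)"
    proof (rule \<phi>I)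
      show "a \<odot>\<^bsub>T\<^esub> t \<in> a \<odot>\<^bsub>?Q\<^esub> (J +>\<^bsub>T\<^esub> t)"
        using self[OF t] self[OF at] by (auto simp: quotient_algebra_def)
      fix u assume "u \<in> a \<odot>\<^bsub>?Q\<^esub> (J +>\<^bsub>T\<^esub> t)"
      then obtain v where v: "v \<in> J +>\<^bsub>T\<^esub> t" "u \<in> J +>\<^bsub>T\<^esub> (a \<odot>\<^bsub>T\<^esub> v)"
        by (auto simp: quotient_algebra_def)
      then show "f u = f (a \<odot>\<^bsub>T\<^esub> t)"
        using cosetD[OF t v(1)] cosetD[OF T.scalar_closed v(2)] t by (simp add: smult)
    qed
    then show ?thesis using t by (simp add: smult)
  qed
  have inj: "J +>\<^bsub>T\<^esub> t = J +>\<^bsub>T\<^esub> u" if tu: "t \<in> carrier T" "u \<in> carrier T" "f t = f u" for t u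
  proof (rule T.a_repr_independence[OF _ tu(1) J.a_subgroup])
    have ut: "u = (u \<ominus>\<^bsub>T\<^esub> t) \<oplus>\<^bsub>T\<^esub> t" using tu by (simp add: T.minus_eq T.a_assoc T.l_neg)
    have d: "u \<ominus>\<^bsub>T\<^esub> t \<in> carrier T" using tu by simp
    have "f (u \<ominus>\<^bsub>T\<^esub> t) \<oplus>\<^bsub>B\<^esub> f t = f u" using add[OF d tu(1)] ut by simp
    then have "f (u \<ominus>\<^bsub>T\<^esub> t) \<oplus>\<^bsub>B\<^esub> f t = \<zero>\<^bsub>B\<^esub> \<oplus>\<^bsub>B\<^esub> f t" using tu by (simp add: closed)
    then have "f (u \<ominus>\<^bsub>T\<^esub> t) = \<zero>\<^bsub>B\<^esub>"
      using B.add.right_cancel[OF closed[OF tu(1)] closed[OF d] B.zero_closed] by blast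
    then have "u \<ominus>\<^bsub>T\<^esub> t \<in> J" using kernel[OF d] by blast
    moreover note ut
    ultimately show "u \<in> J +>\<^bsub>T\<^esub> t" unfolding a_r_coset_def' by blast
  qed
  have \<phi>one: "?\<phi> \<one>\<^bsub>?Q\<^esub> = f \<one>\<^bsub>T\<^esub>" by (simp only: oneQ \<phi>[OF T.one_closed])
  show ?thesis
  proof (intro full_corner.intro full_corner_axioms.intro B unital_algebra_quotient_algebra[OF T J])
    show "inj_on ?\<phi> (carrier ?Q)"
    proof (rule inj_onI)
      fix X Y assume "X \<in> carrier ?Q" "Y \<in> carrier ?Q" and eq: "?\<phi> X = ?\<phi> Y"
      then obtain t u where tu: "t \<in> carrier T" "X = J +>\<^bsub>T\<^esub> t" "u \<in> carrier T" "Y = J +>\<^bsub>T\<^esub> u"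
        using rep by blast
      have "f t = f u" using eq unfolding tu(2,4) \<phi>[OF tu(1)] \<phi>[OF tu(3)] .
      then show "X = Y" unfolding tu(2,4) by (rule inj[OF tu(1,3)])
    qed
    show "\<exists>X\<in>carrier ?Q. ?\<phi> X = ?\<phi> \<one>\<^bsub>?Q\<^esub> \<otimes>\<^bsub>B\<^esub> b \<otimes>\<^bsub>B\<^esub> ?\<phi> \<one>\<^bsub>?Q\<^esub>" if bc: "b \<in> carrier B" for b
    proof -
      obtain t where t: "t \<in> carrier T" "f t = f \<one>\<^bsub>T\<^esub> \<otimes>\<^bsub>B\<^esub> b \<otimes>\<^bsub>B\<^esub> f \<one>\<^bsub>T\<^esub>"
        using onto[OF bc] by blast
      show ?thesis unfolding \<phi>one using \<phi>[OF t(1)] t(2) by (intro bexI[OF _ cc[OF t(1)]]) simp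
    qed
    show "\<one>\<^bsub>B\<^esub> \<in> Idl\<^bsub>B\<^esub> {?\<phi> \<one>\<^bsub>?Q\<^esub>}" unfolding \<phi>one by (rule full)
  qed (auto dest!: rep simp: \<phi> closed addQ multQ smultQ add mult)
qed

lemma operator_algebra_simps:
  "f \<in> carrier (operator_algebra scale) \<longleftrightarrow> Vector_Spaces.linear scale scale f"
  "f \<otimes>\<^bsub>operator_algebra scale\<^esub> g = (\<lambda>v. f (g v))" "\<one>\<^bsub>operator_algebra scale\<^esub> = (\<lambda>v. v)"
  "\<zero>\<^bsub>operator_algebra scale\<^esub> = (\<lambda>v. 0)" "f \<oplus>\<^bsub>operator_algebra scale\<^esub> g = (\<lambda>v. f v + g v)"
  "a \<odot>\<^bsub>operator_algebra scale\<^esub> f = (\<lambda>v. scale a (f v))"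
  by (simp_all add: operator_algebra_def fun_eq_iff)

context splitting
begin

abbreviation "A \<equiv> operator_algebra scale"
abbreviation "B \<equiv> homotope A \<Delta>"
abbreviation "T \<equiv> path_algebra (alpha_beta_quiver s) :: ('k, vertex \<times> arrow list \<Rightarrow> 'k) module"

lemmas \<Delta>_simps = endo_simps[OF \<Delta>] and E_simps = endo_simps[OF E]
  and \<mu>_simps = functional_simps[OF \<mu>] and \<kappa>_simps = functional_simps[OF \<kappa>]
  and \<rho>_simps = functional_simps[OF \<rho>]

lemma \<mu>_c: "i \<in> {1..s} \<Longrightarrow> \<mu> (c i) = 0"
  using \<mu>\<Delta>E[of "c i"] by (simp add: Ec \<Delta>_simps \<mu>_simps)

lemma \<kappa>_w: "\<kappa> i w = 0"
  using \<kappa>E[of i "\<Delta> w"] by (simp add: E\<Delta>w)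

lemma unital_algebra_A: "unital_algebra A"
  by (rule unital_algebra_operator_algebra) (rule vector_space_axioms)

lemma \<Delta>_closed: "\<Delta> \<in> carrier A"
  by (simp add: operator_algebra_simps \<Delta>)

lemma unital_algebra_B: "unital_algebra B"
  by (rule unital_algebra_homotope(1)[OF unital_algebra_A \<Delta>_closed])

lemma unital_algebra_T: "unital_algebra T"
  by (rule unital_algebra_path_algebra[OF wf_digraph_alpha_beta_quiver]) (simp add: alpha_beta_quiver_simps)

lemma endo_rank_one: "functional l \<Longrightarrow> endo (\<lambda>v. scale (l v) x)"
  by (rule endoI) (simp_all add: functional_simps scale_left_distrib)

text \<open>Simplicity of A made explicit: as \<mu>(\<Delta> w) = 1, the operator x tensor l equals
  (x tensor \<mu>) \<Delta> (w tensor l).\<close>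

lemma one_in_genideal_\<Delta>: "\<one>\<^bsub>A\<^esub> \<in> Idl\<^bsub>A\<^esub> {\<Delta>}"
proof -
  interpret A: unital_algebra A by (rule unital_algebra_A)
  interpret J: ideal "Idl\<^bsub>A\<^esub> {\<Delta>}" A by (rule A.genideal_ideal) (simp add: \<Delta>_closed)
  have \<Delta>J: "\<Delta> \<in> Idl\<^bsub>A\<^esub> {\<Delta>}" using A.genideal_self[of "{\<Delta>}"] \<Delta>_closed by simp
  have "f \<in> Idl\<^bsub>A\<^esub> {\<Delta>}" if "endo f" for f
    using that
  proof (induction rule: endo_rank_one_induct)
    case zero
    show ?case using J.zero_closed by (simp add: operator_algebra_simps)
  next
    case (rank_one l x)
    have "(\<lambda>v. scale (\<mu> v) x) \<otimes>\<^bsub>A\<^esub> \<Delta> \<otimes>\<^bsub>A\<^esub> (\<lambda>v. scale (l v) w) \<in> Idl\<^bsub>A\<^esub> {\<Delta>}"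
      by (intro J.I_l_closed J.I_r_closed \<Delta>J)
        (simp_all add: operator_algebra_simps endo_rank_one rank_one \<mu>)
    then show ?case by (simp add: operator_algebra_simps \<Delta>_simps \<mu>_simps \<mu>\<Delta>w)
  next
    case (add g h)
    then show ?case using J.a_closed[of g h] by (simp add: operator_algebra_simps)
  qed
  moreover have "endo (\<lambda>v. v)" by (rule endoI) auto
  ultimately show ?thesis by (simp add: operator_algebra_simps)
qed

text \<open>The non-unital homomorphism from the path algebra to \<open>B\<close> with \<open>e\<^sub>1 \<mapsto> w \<otimes> \<mu>\<close>,
  \<open>e\<^sub>2 \<mapsto> 1 - E\<close>, \<open>\<alpha>\<^sub>i \<mapsto> k\<^sub>i \<otimes> \<mu>\<close> and \<open>\<beta>\<^sub>j \<mapsto> w \<otimes> \<rho>\<^sub>j\<close>.\<close>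

definition rep_op :: "(vertex \<times> arrow list \<Rightarrow> 'k) \<Rightarrow> 'v \<Rightarrow> 'v"
  where "rep_op f v = scale (f (V1, []) * \<mu> v) w - scale (f (V2, [])) (E v) +
    scale (\<mu> v) (\<Sum>i=1..s. scale (f (V1, [Alpha i])) (k i)) +
    scale (\<Sum>j=1..s. f (V2, [Beta j]) * \<rho> j v) w +
    (\<Sum>j=1..s. scale (\<rho> j v) (\<Sum>i=1..s. scale (f (V2, [Beta j, Alpha i])) (k i)))"

text \<open>Among the images of paths only that of the trivial path at \<open>V2\<close>, which is
  (1, -E), has a scalar part. The double sum in \<open>rep_op\<close> sends \<alpha>_i \<beta>_j to
  \<open>k i\<close> tensor \<open>\<rho> j\<close>.\<close>

definition rep :: "(vertex \<times> arrow list \<Rightarrow> 'k) \<Rightarrow> 'k \<times> ('v \<Rightarrow> 'v)"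
  where "rep f = (f (V2, []), rep_op f)"

lemma endo_rep_op: "endo (rep_op f)"
  by (rule endoI)
    (simp_all add: rep_op_def \<mu>_simps \<rho>_simps E_simps scale_left_distrib scale_right_distrib
      distrib_left distrib_right sum.distrib scale_sum_right sum_distrib_left algebra_simps)

lemma rep_closed: "rep f \<in> carrier B"
  by (simp add: rep_def homotope_simps operator_algebra_simps endo_rep_op)

lemma rep_add: "rep (f \<oplus>\<^bsub>T\<^esub> g) = rep f \<oplus>\<^bsub>B\<^esub> rep g"
  by (simp add: rep_def homotope_simps operator_algebra_simps path_algebra_simps rep_op_def fun_eq_iff
      scale_left_distrib scale_right_distrib distrib_left distrib_right sum.distrib algebra_simps)

lemma rep_smult: "rep (a \<odot>\<^bsub>T\<^esub> f) = a \<odot>\<^bsub>B\<^esub> rep f"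
  by (simp add: rep_def homotope_simps operator_algebra_simps path_algebra_simps rep_op_def fun_eq_iff
      scale_sum_right sum_distrib_left scale_sum_left algebra_simps)

text \<open>As \<Delta> kills each \<open>k i\<close>, it maps \<open>rep_op g v\<close> to a
  combination of \<Delta> w and \<Delta> (E v). A product in B therefore evaluates its left operator
  only at these two vectors.\<close>

lemma rep_op_\<Delta>w: "rep_op f (\<Delta> w) = scale (f (V1, []) - f (V2, [])) w + (\<Sum>i=1..s. scale (f (V1, [Alpha i])) (k i))"
  by (simp add: rep_op_def \<mu>\<Delta>w E\<Delta>w \<rho>\<Delta> scale_left_diff_distrib)

lemma rep_op_\<Delta>E: "rep_op f (\<Delta> (E v)) = scale (\<mu> v) (scale (f (V1, [])) w +
    (\<Sum>i=1..s. scale (f (V1, [Alpha i])) (k i))) - scale (f (V2, [])) (E v)"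
  by (simp add: rep_op_def \<mu>\<Delta>E E\<Delta>E \<rho>\<Delta> scale_right_distrib mult.commute)

lemma \<Delta>_rep_op: "\<Delta> (rep_op g v) = scale (g (V1, []) * \<mu> v + (\<Sum>j=1..s. g (V2, [Beta j]) * \<rho> j v)) (\<Delta> w) -
    scale (g (V2, [])) (\<Delta> (E v))"
  by (simp add: rep_op_def \<Delta>_simps \<Delta>k scale_left_distrib)

lemma rep_mult: "rep (f \<otimes>\<^bsub>T\<^esub> g) = rep f \<otimes>\<^bsub>B\<^esub> rep g"
proof -
  \<comment> \<open>The \<alpha>, \<beta> and \<alpha>\<beta> parts. A \<beta> part of g followed by
    an \<alpha> part of f lands in \<open>?S\<close>; in the opposite order nothing appears because
    \<Delta> kills the \<open>k i\<close>.\<close>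
  let ?P = "\<lambda>f. \<Sum>i=1..s. scale (f (V1, [Alpha i])) (k i)" and ?R = "\<lambda>f v. \<Sum>j=1..s. f (V2, [Beta j]) * \<rho> j v"
    and ?S = "\<lambda>f v. \<Sum>j=1..s. scale (\<rho> j v) (\<Sum>i=1..s. scale (f (V2, [Beta j, Alpha i])) (k i))"
  \<comment> \<open>The right-hand side is the second component of (c, a) (d, b) in the homotope: c
    b + d a + a \<Delta> b.\<close>
  have "rep_op (f \<otimes>\<^bsub>T\<^esub> g) v = scale (f (V2, [])) (rep_op g v) + scale (g (V2, [])) (rep_op f v) +
      rep_op f (\<Delta> (rep_op g v))" for v
  proof -
    have P: "?P (f \<otimes>\<^bsub>T\<^esub> g) = scale (g (V1, [])) (?P f) + scale (f (V2, [])) (?P g)"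
      by (simp add: path_algebra_mult_reduced scale_left_distrib sum.distrib scale_sum_right mult.commute)
    have R: "?R (f \<otimes>\<^bsub>T\<^esub> g) v = g (V2, []) * ?R f v + f (V1, []) * ?R g v"
      by (simp add: path_algebra_mult_reduced sum.distrib sum_distrib_left algebra_simps)
    have S: "?S (f \<otimes>\<^bsub>T\<^esub> g) v = scale (g (V2, [])) (?S f v) + scale (?R g v) (?P f) + scale (f (V2, [])) (?S g v)"
    proof -
      have "(\<Sum>j=1..s. scale (\<rho> j v) (\<Sum>i=1..s. scale (h (V2, [Beta j, Alpha i]) * a) (k i))) = scale a (?S h v)"
        for h a by (simp add: scale_sum_right mult_ac)
      moreover have "(\<Sum>j=1..s. scale (\<rho> j v) (\<Sum>i=1..s. scale (a * h (V2, [Beta j, Alpha i])) (k i))) = scale a (?S h v)"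
        for h a by (simp add: scale_sum_right mult_ac)
      moreover have "(\<Sum>j=1..s. scale (\<rho> j v) (\<Sum>i=1..s. scale (f (V1, [Alpha i]) * g (V2, [Beta j])) (k i))) =
          scale (?R g v) (?P f)"
        unfolding scale_sum_left by (rule sum.cong[OF refl]) (simp add: scale_sum_right mult_ac)
      ultimately show ?thesis
        by (simp only: path_algebra_mult_reduced scale_left_distrib scale_right_distrib sum.distrib)
    qed
    have "rep_op f (\<Delta> (rep_op g v)) =
        scale (g (V1, []) * \<mu> v + ?R g v) (scale (f (V1, []) - f (V2, [])) w + ?P f) -
        scale (g (V2, [])) (scale (\<mu> v) (scale (f (V1, [])) w + ?P f) - scale (f (V2, [])) (E v))"
      by (simp add: \<Delta>_rep_op endo_simps[OF endo_rep_op] rep_op_\<Delta>w rep_op_\<Delta>E)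
    moreover have "rep_op h v = scale (h (V1, []) * \<mu> v) w - scale (h (V2, [])) (E v) +
      scale (\<mu> v) (?P h) + scale (?R h v) w + ?S h v" for h
      by (rule rep_op_def)
    moreover have "(f \<otimes>\<^bsub>T\<^esub> g) (u, []) = f (u, []) * g (u, [])" for u by (rule path_algebra_mult_reduced)
    ultimately show ?thesis
      by (simp only: P R S)
        (simp add: algebra_simps scale_left_distrib scale_right_distrib scale_left_diff_distrib scale_right_diff_distrib)
  qed
  then show ?thesis
    by (simp add: rep_def homotope_simps operator_algebra_simps path_algebra_mult_reduced(1) fun_eq_iff)
qed

text \<open>The relations vanish at the reduced paths, the only places that \<open>rep\<close>
  reads. Conversely, all coefficients are recovered from the values of \<open>rep_op f\<close> at
  \<Delta> w and at the \<open>c j\<close>.\<close>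

lemma rep_kernel:
  assumes f: "f \<in> carrier T"
  shows "rep f = \<zero>\<^bsub>B\<^esub> \<longleftrightarrow> f \<in> Idl\<^bsub>T\<^esub> (beta_alpha_relations s)"
proof
  interpret T: unital_algebra T by (rule unital_algebra_T)
  interpret B: unital_algebra B by (rule unital_algebra_B)
  have zero: "rep g = \<zero>\<^bsub>B\<^esub>" if "\<And>x. x \<in> reduced_paths s \<Longrightarrow> g x = 0" for g
  proof -
    have "g (V1, []) = 0" "g (V2, []) = 0" "i \<in> {1..s} \<Longrightarrow> g (V1, [Alpha i]) = 0"
      "j \<in> {1..s} \<Longrightarrow> g (V2, [Beta j]) = 0"
      "j \<in> {1..s} \<Longrightarrow> i \<in> {1..s} \<Longrightarrow> g (V2, [Beta j, Alpha i]) = 0" for i j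
      by (rule that, auto simp: reduced_paths_def image_iff)+
    then show ?thesis
      by (simp add: rep_def rep_op_def homotope_simps operator_algebra_simps fun_eq_iff)
  qed
  show "rep f = \<zero>\<^bsub>B\<^esub>" if "f \<in> Idl\<^bsub>T\<^esub> (beta_alpha_relations s)"
  proof -
    have ker: "ideal {t \<in> carrier T. rep t = \<zero>\<^bsub>B\<^esub>} T"
    proof (rule idealI[OF T.ring_axioms])
      show "subgroup {t \<in> carrier T. rep t = \<zero>\<^bsub>B\<^esub>} (add_monoid T)"
      proof (rule group.subgroupI[OF T.a_group])
        have "rep \<zero>\<^bsub>T\<^esub> = \<zero>\<^bsub>B\<^esub>" by (rule zero) (simp add: path_algebra_simps)
        then show "{t \<in> carrier T. rep t = \<zero>\<^bsub>B\<^esub>} \<noteq> {}" by blast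
        fix t assume t: "t \<in> {t \<in> carrier T. rep t = \<zero>\<^bsub>B\<^esub>}"
        have "rep (\<ominus>\<^bsub>T\<^esub> t) \<oplus>\<^bsub>B\<^esub> rep t = rep \<zero>\<^bsub>T\<^esub>"
          using t by (simp only: rep_add[symmetric]) (simp add: T.l_neg)
        then have "rep (\<ominus>\<^bsub>T\<^esub> t) = \<zero>\<^bsub>B\<^esub>"
          using t \<open>rep \<zero>\<^bsub>T\<^esub> = \<zero>\<^bsub>B\<^esub>\<close> rep_closed by simp
        then show "inv\<^bsub>add_monoid T\<^esub> t \<in> {t \<in> carrier T. rep t = \<zero>\<^bsub>B\<^esub>}"
          using t rep_closed by (simp add: a_inv_def[symmetric])
      qed (auto simp: rep_add)
    qed (auto simp: rep_mult rep_closed)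
    have "Idl\<^bsub>T\<^esub> (beta_alpha_relations s) \<subseteq> {t \<in> carrier T. rep t = \<zero>\<^bsub>B\<^esub>}"
    proof (rule T.genideal_minimal[OF ker], rule subsetI)
      fix t assume "t \<in> (beta_alpha_relations s :: (vertex \<times> arrow list \<Rightarrow> 'k) set)"
      then obtain i j where "t = path_element (V1, [Alpha i, Beta j]) 1" by (auto simp: beta_alpha_relations_eq)
      then have "rep t = \<zero>\<^bsub>B\<^esub>" by (intro zero) (auto simp: reduced_paths_def path_element_def)
      then show "t \<in> {t \<in> carrier T. rep t = \<zero>\<^bsub>B\<^esub>}"
        using \<open>t \<in> beta_alpha_relations s\<close> beta_alpha_relations_closed by auto
    qed
    then show ?thesis using that by blast
  qed
  assume rf: "rep f = \<zero>\<^bsub>B\<^esub>"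
  then have f2: "f (V2, []) = 0" and op: "rep_op f v = 0" for v
    by (simp_all add: rep_def homotope_simps operator_algebra_simps fun_eq_iff)
  have \<kappa>sum: "\<kappa> l (\<Sum>i=1..s. scale (x i) (k i)) = x l" if "l \<in> {1..s}" for l x
    using that by (simp add: \<kappa>_simps \<kappa>k if_distrib[of "\<lambda>y. _ * y"] sum.delta cong: if_cong)
  have \<mu>sum: "\<mu> (\<Delta> (\<Sum>i=1..s. scale (x i) (k i))) = 0" for x
    by (simp add: \<mu>_simps \<Delta>_simps \<Delta>k)
  \<comment> \<open>With f zero at the trivial path at \<open>V2\<close>, the value at \<Delta> w is
    a multiple of w plus the \<alpha> part. The functional v |-> \<mu>(\<Delta> v) detects w and
    kills the \<open>k i\<close>; \<open>\<kappa> i\<close> detects \<open>k i\<close> and kills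
    w.\<close>
  note w = op[of "\<Delta> w", unfolded rep_op_\<Delta>w f2]
  have f1: "f (V1, []) = 0" using arg_cong[OF w, of "\<lambda>v. \<mu> (\<Delta> v)"]
    by (simp add: \<Delta>_simps(1,3,4) \<mu>_simps(1,3,4) \<mu>\<Delta>w \<mu>sum del: One_nat_def)
  have \<alpha>: "f (V1, [Alpha i]) = 0" if "i \<in> {1..s}" for i
    using arg_cong[OF w, of "\<kappa> i"] that by (simp add: \<kappa>_simps(1,3,4) \<kappa>_w \<kappa>sum del: One_nat_def)
  \<comment> \<open>Both \<mu> and E vanish at \<open>c j\<close>, and only \<open>\<rho> j\<close>
    survives there, which isolates the coefficients of \<beta>_j and of all \<alpha>_i
    \<beta>_j.\<close>
  have cj: "scale (f (V2, [Beta j])) w + (\<Sum>i=1..s. scale (f (V2, [Beta j, Alpha i])) (k i)) = 0"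
    if j: "j \<in> {1..s}" for j
  proof -
    have "(\<Sum>l=1..s. f (V2, [Beta l]) * \<rho> l (c j)) = (\<Sum>l=1..s. if l = j then f (V2, [Beta l]) else 0)"
      by (rule sum.cong) (use j in \<open>auto simp: \<rho>c\<close>)
    moreover have "(\<Sum>l=1..s. scale (\<rho> l (c j)) (\<Sum>i=1..s. scale (f (V2, [Beta l, Alpha i])) (k i))) =
      (\<Sum>l=1..s. if l = j then (\<Sum>i=1..s. scale (f (V2, [Beta l, Alpha i])) (k i)) else 0)"
      by (rule sum.cong) (use j in \<open>auto simp: \<rho>c\<close>)
    ultimately show ?thesis using op[of "c j"] j
      by (simp add: rep_op_def f1 f2 \<mu>_c Ec sum.delta)
  qed
  have \<beta>: "f (V2, [Beta j]) = 0" if "j \<in> {1..s}" for j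
    using arg_cong[OF cj[OF that], of "\<lambda>v. \<mu> (\<Delta> v)"]
    by (simp add: \<Delta>_simps(1,3,4) \<mu>_simps(1,3,4) \<mu>\<Delta>w \<mu>sum del: One_nat_def)
  have "f (V2, [Beta j, Alpha i]) = 0" if "j \<in> {1..s}" "i \<in> {1..s}" for i j
    using arg_cong[OF cj[OF that(1)], of "\<kappa> i"] that(2) by (simp add: \<kappa>_simps(1,3,4) \<kappa>_w \<kappa>sum del: One_nat_def)
  with f1 f2 \<alpha> \<beta> show "f \<in> Idl\<^bsub>T\<^esub> (beta_alpha_relations s)"
    by (intro vanishing_on_reduced_paths[OF f]) (auto simp: reduced_paths_def)
qed

lemma rep_one: "rep \<one>\<^bsub>T\<^esub> = (1, \<lambda>v. scale (\<mu> v) w - E v)"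
  by (simp add: rep_def rep_op_def path_algebra_simps alpha_beta_quiver_simps fun_eq_iff)

text \<open>Compression by e1 reads a through v |-> \<mu>(\<Delta> v) on the left and at \<Delta> w
  on the right; compression by 1 - E reads it through the \<open>\<kappa> i\<close> and at the
  \<open>c j\<close>. So e b e is given by matrix entries of a.\<close>

lemma rep_onto:
  assumes "b \<in> carrier B"
  shows "\<exists>f\<in>carrier T. rep f = rep \<one>\<^bsub>T\<^esub> \<otimes>\<^bsub>B\<^esub> b \<otimes>\<^bsub>B\<^esub> rep \<one>\<^bsub>T\<^esub>"
proof -
  obtain d a where b: "b = (d, a)" and a: "endo a"
    using assms by (auto simp: homotope_simps operator_algebra_simps)
  note a' = endo_simps[OF a]
  \<comment> \<open>Four kinds of entries of a. The scalar d of b contributes to e1 and e2 only, and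
    e2 receives nothing from a because its compression of a consists of terms \<alpha>_i
    \<beta>_j.\<close>
  define h :: "vertex \<times> arrow list \<Rightarrow> 'k" where "h = (\<lambda>(u, p). case (u, p) of
      (V1, []) \<Rightarrow> d + \<mu> (\<Delta> (a (\<Delta> w))) | (V2, []) \<Rightarrow> d
    | (V1, [Alpha i]) \<Rightarrow> \<kappa> i (a (\<Delta> w)) | (V2, [Beta j]) \<Rightarrow> \<mu> (\<Delta> (a (c j)))
    | (V2, [Beta j, Alpha i]) \<Rightarrow> \<kappa> i (a (c j)) | _ \<Rightarrow> 0)"
  \<comment> \<open>Cutting off at the reduced paths removes arrow indices outside
    \<open>{1..s}\<close> and makes the support finite.\<close>
  define f where "f = (\<lambda>x. if x \<in> reduced_paths s then h x else 0)"
  have supp: "{x. f x \<noteq> 0} \<subseteq> reduced_paths s" by (auto simp: f_def)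
  have "f \<in> carrier T"
    using finite_subset[OF supp finite_reduced_paths] subset_trans[OF supp reduced_paths_subset]
    by (simp add: path_algebra_simps)
  moreover have "rep f = rep \<one>\<^bsub>T\<^esub> \<otimes>\<^bsub>B\<^esub> b \<otimes>\<^bsub>B\<^esub> rep \<one>\<^bsub>T\<^esub>"
  proof -
    have fv: "f (V1, []) = d + \<mu> (\<Delta> (a (\<Delta> w)))" "f (V2, []) = d"
      "i \<in> {1..s} \<Longrightarrow> f (V1, [Alpha i]) = \<kappa> i (a (\<Delta> w))"
      "j \<in> {1..s} \<Longrightarrow> f (V2, [Beta j]) = \<mu> (\<Delta> (a (c j)))"
      "j \<in> {1..s} \<Longrightarrow> i \<in> {1..s} \<Longrightarrow> f (V2, [Beta j, Alpha i]) = \<kappa> i (a (c j))" for i j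
      by (auto simp: f_def h_def reduced_paths_def)
    let ?e = "\<lambda>v. scale (\<mu> v) w - E v"
    \<comment> \<open>The operator part of the product e b, whose scalar part is d.\<close>
    define a2 where "a2 v = a v + scale d (?e v) + ?e (\<Delta> (a v))" for v
    have e: "endo ?e"
      by (rule endoI) (simp_all add: \<mu>_simps E_simps scale_left_distrib scale_right_diff_distrib)
    have a2: "endo a2"
      unfolding a2_def by (rule endoI) (simp_all add: a' endo_simps[OF e] \<Delta>_simps scale_right_distrib mult.commute)
    have a2': "a2 v = (\<Sum>i=1..s. scale (\<kappa> i (a v)) (k i)) + scale (\<mu> (\<Delta> (a v))) w + scale d (?e v)" for v
      using split_kernel[of "a v"] unfolding a2_def by (simp add: algebra_simps)
    \<comment> \<open>Multiplying by e on the right replaces the argument v by v + \<Delta> (?e v),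
      up to a scalar term. \<open>split_range\<close> expresses this vector by \<Delta> w and the
      \<open>c j\<close>, so only the values of \<open>a2\<close> at these enter.\<close>
    have R: "v + \<Delta> (?e v) = scale (\<mu> v) (\<Delta> w) + (\<Sum>j=1..s. scale (\<rho> j v) (c j))" for v
      using split_range[of v] by (simp add: \<Delta>_simps algebra_simps)
    have "a2 v + a2 (\<Delta> (?e v)) = a2 (v + \<Delta> (?e v))" for v
      by (rule endo_simps(1)[OF a2, symmetric])
    then have "a2 v + a2 (\<Delta> (?e v)) = scale (\<mu> v) (a2 (\<Delta> w)) + (\<Sum>j=1..s. scale (\<rho> j v) (a2 (c j)))" for v
      by (simp only: R endo_simps(1,3,5)[OF a2])
    moreover have "?e (\<Delta> w) = 0" by (simp add: \<mu>\<Delta>w E\<Delta>w)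
    moreover have "?e (c j) = 0" if "j \<in> {1..s}" for j using that by (simp add: \<mu>_c Ec)
    ultimately have *: "a2 v + a2 (\<Delta> (?e v)) + scale d (?e v) = rep_op f v" for v
      by (simp add: rep_op_def a2' fv scale_right_distrib scale_left_distrib sum.distrib scale_sum_left
          algebra_simps)
    then have "rep_op f = (\<lambda>v. scale d (?e v) + a2 v + a2 (\<Delta> (?e v)))"
      by (simp only: fun_eq_iff add_ac simp_thms)
    moreover have "(1, ?e) \<otimes>\<^bsub>B\<^esub> (d, a) = (d, a2)"
      by (simp add: homotope_simps operator_algebra_simps a2_def fun_eq_iff)
    moreover have "(d, a2) \<otimes>\<^bsub>B\<^esub> (1, ?e) = (d, \<lambda>v. scale d (?e v) + a2 v + a2 (\<Delta> (?e v)))"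
      by (simp add: homotope_simps operator_algebra_simps)
    ultimately show ?thesis unfolding b rep_one by (simp add: rep_def fv)
  qed
  ultimately show ?thesis by blast
qed

text \<open>The ideal contains e1 = e1 e, hence each x tensor l = (x tensor \<mu>) e1 (w tensor l),
  hence all of B^+; and 1 differs from e by an element of B^+.\<close>

lemma rep_full: "\<one>\<^bsub>B\<^esub> \<in> Idl\<^bsub>B\<^esub> {rep \<one>\<^bsub>T\<^esub>}"
proof -
  interpret B: unital_algebra B by (rule unital_algebra_B)
  let ?e = "rep \<one>\<^bsub>T\<^esub>"
  let ?J = "Idl\<^bsub>B\<^esub> {?e}"
  interpret J: ideal ?J B by (rule B.genideal_ideal) (simp add: rep_closed)
  have eJ: "?e \<in> ?J" using B.genideal_self[of "{?e}"] rep_closed by simp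
  have Bc: "(d, a) \<in> carrier B \<longleftrightarrow> endo a" for d a by (simp add: homotope_simps operator_algebra_simps)
  note ops = homotope_simps operator_algebra_simps \<Delta>_simps \<mu>_simps \<mu>\<Delta>w
  have "(0, \<lambda>v. scale (\<mu> v) w) \<otimes>\<^bsub>B\<^esub> ?e \<in> ?J"
    by (intro J.I_l_closed eJ) (simp add: Bc endo_rank_one \<mu>)
  then have e1: "(0, \<lambda>v. scale (\<mu> v) w) \<in> ?J"
    by (simp add: rep_one ops \<mu>\<Delta>E scale_left_diff_distrib)
  have endoJ: "(0, a) \<in> ?J" if "endo a" for a
    using that
  proof (induction rule: endo_rank_one_induct)
    case zero
    show ?case using J.zero_closed by (simp add: homotope_simps operator_algebra_simps)
  next
    case (rank_one l x)
    have "(0, \<lambda>v. scale (\<mu> v) x) \<otimes>\<^bsub>B\<^esub> (0, \<lambda>v. scale (\<mu> v) w) \<otimes>\<^bsub>B\<^esub> (0, \<lambda>v. scale (l v) w) \<in> ?J"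
      by (intro J.I_l_closed J.I_r_closed e1) (simp_all add: Bc endo_rank_one rank_one \<mu>)
    then show ?case by (simp add: ops)
  next
    case (add g h)
    then show ?case using J.a_closed[of "(0, g)" "(0, h)"] by (simp add: homotope_simps operator_algebra_simps)
  qed
  have "endo (\<lambda>v. E v - scale (\<mu> v) w)"
    by (rule endoI) (simp_all add: \<mu>_simps E_simps scale_left_distrib scale_right_diff_distrib)
  from J.a_closed[OF eJ endoJ[OF this]] show ?thesis
    by (simp add: rep_one homotope_simps operator_algebra_simps)
qed

lemma morita_equivalent_quiver_algebra:
  assumes "infinite (UNIV :: 'u set)"
  shows "morita_equivalent TYPE('u) B (quiver_algebra (alpha_beta_quiver s) (beta_alpha_relations s))"
proof -
  interpret T: unital_algebra T by (rule unital_algebra_T)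
  interpret full_corner B "quotient_algebra T (Idl\<^bsub>T\<^esub> (beta_alpha_relations s))" "\<lambda>X. the_elem (rep ` X)"
    by (rule quotient_algebra_full_corner[OF unital_algebra_B unital_algebra_T T.genideal_ideal[OF beta_alpha_relations_closed]])
      (simp_all add: rep_closed rep_add rep_mult rep_smult rep_kernel rep_onto rep_full)
  show ?thesis unfolding quiver_algebra_def by (rule morita_equivalent_full_corner) (rule assms)
qed

end

theorem proposition62:
  fixes scale :: "'k::field \<Rightarrow> 'v::ab_group_add \<Rightarrow> 'v" and Basis :: "'v set"
    and \<Delta> :: "'v \<Rightarrow> 'v"
  assumes "finite_dimensional_vector_space scale Basis"
    and "\<Delta> \<in> carrier (operator_algebra scale)"
    and "\<Delta> \<noteq> \<zero>\<^bsub>operator_algebra scale\<^esub>"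
    and "infinite (UNIV :: 'u set)"
  shows "well_tempered (operator_algebra scale) \<Delta> \<and>
    (\<forall>s. corank scale \<Delta> = s \<longrightarrow>
      morita_equivalent TYPE('u) (homotope (operator_algebra scale) \<Delta>)
        (quiver_algebra (alpha_beta_quiver s) (beta_alpha_relations s)))"
proof -
  interpret finite_dimensional_vector_space scale Basis by fact
  obtain u where "\<Delta> u \<noteq> 0" using assms(3) by (auto simp: operator_algebra_simps fun_eq_iff)
  moreover have "endo \<Delta>" using assms(2) by (simp add: operator_algebra_simps)
  ultimately obtain E k c \<kappa> \<rho> w \<mu> where
    "splitting scale Basis \<Delta> E (corank scale \<Delta>) k c \<kappa> \<rho> w \<mu>"
    using splitting_exists by metis
  then interpret S: splitting scale Basis \<Delta> E "corank scale \<Delta>" k c \<kappa> \<rho> w \<mu> .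
  show ?thesis
    using well_temperedI[OF S.unital_algebra_A S.\<Delta>_closed S.one_in_genideal_\<Delta>]
      S.morita_equivalent_quiver_algebra[OF assms(4)] by blast
qed

end
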